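(* Let $\mathcal{P}$ be an (order-)hereditary property of $k$-colourings with $\mathcal{P}_n\ne\emptyset$ for every $n$. Then (i) $\displaystyle\pi(\mathcal{P})=\max_{W\in\widehat{\mathcal{P}}}\mathrm{Ent}(W)$; and (ii) $\displaystyle\lim_{n\to\infty}\frac{\log_k|\mathcal{P}_n|}{\binom n2}=\max_{W\in\widehat{\mathcal{P}}}\mathrm{Ent}(W)$.
   Context: $k\ge2$ is a fixed integer, $[k]=\{1,\dots,k\}$. A $k$-colouring of $K_n$ (complete graph on $[n]$) is a map $c:E(K_n)\to[k]$. For $A=\{a_1<\dots<a_m\}\subseteq[n]$, $c_{|A}$ is the $k$-colouring of $K_m$ with $c_{|A}(ij)=c(a_ia_j)$. An order-hereditary property is a sequence $\mathcal{P}=(\mathcal{P}_n)_n$ with $\mathcal{P}_n$ a set of $k$-colourings of $K_n$ such that $c_{|A}\in\mathcal{P}_{|A|}$ whenever $c\in\mathcal{P}_n$, $A\subseteq[n]$ (it is hereditary if moreover each $\mathcal{P}_n$ is closed under permutations of $[n]$). A template for $K_n$ assigns to each edge $e$ a nonempty set $t(e)\subseteq[k]$; $\langle t\rangle$ is the set of $k$-colourings with $c(e)\in t(e)$ for all $e$; $\mathrm{Ent}(t)=\sum_e\log_k|t(e)|$; $\mathrm{ex}(n,\mathcal{P})=\max\{\mathrm{Ent}(t):\langle t\rangle\subseteq\mathcal{P}_n\}$; $\pi(\mathcal{P})=\lim_n\mathrm{ex}(n,\mathcal{P})/\binom n2$ (the limit exists). A $k$-graphon is a symmetric measurable $W:[0,1]^2\to\{\text{probability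 measures on }[k]\}$; $W_i(x,y)$ is the mass $W(x,y)$ gives to $i$. Put $d_{\square_k}(U,W)=\sup_{S,T}\sum_{i=1}^k|\int_{S\times T}(U_i-W_i)|$ (sup over measurable $S,T\subseteq[0,1]$) and $\delta_{\square_k}(U,W)=\inf_\varphi d_{\square_k}(U,W^\varphi)$, with $W^\varphi(x,y)=W(\varphi(x),\varphi(y))$ and $\varphi$ ranging over measure-preserving maps $[0,1]\to[0,1]$. A $k$-colouring $c$ of $K_n$ gives a step $k$-graphon $W_c$, equal on $I_i\times I_j$ ($i\neq j$, $I_i=[(i-1)/n,i/n)$) to the point mass at $c(ij)$ (on the diagonal blocks, an arbitrary fixed point mass). $\widehat{\mathcal{P}}$ is the set of limits of $\mathcal{P}$ under the cut distance: all $k$-graphons $W$ for which there are $c_j\in\mathcal{P}_{n_j}$ with $n_j\to\infty$ and $\delta_{\square_k}(W_{c_j},W)\to0$. The entropy of a $k$-graphon is $\mathrm{Ent}(W)=\iint_{[0,1]^2}h_k(W_1(x,y),\dots,W_k(x,y))\,dx\,dy$, where $h_k(p_1,\dots,p_k)=-\sum_{c=1}^kp_c\log_kp_c$ (with $0\log_k0=0$). *)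

theory Defs
  imports "HOL-Probability.Probability"
begin

definition edges :: "nat \<Rightarrow> nat set set" where
  "edges n = {e. e \<subseteq> {1..n} \<and> card e = 2}"

text \<open>Colourings and templates are extensional functions on the edge set, so that they can be
  counted and compared by equality.\<close>

definition colourings :: "nat \<Rightarrow> nat \<Rightarrow> (nat set \<Rightarrow> nat) set" where
  "colourings k n = edges n \<rightarrow>\<^sub>E {1..k}"

text \<open>For \<open>A = {a\<^sub>1 < \<dots> < a\<^sub>m}\<close>, the entry \<open>sorted_list_of_set A ! (i - 1)\<close> is \<open>a\<^sub>i\<close>.\<close>

definition induced :: "(nat set \<Rightarrow> nat) \<Rightarrow> nat set \<Rightarrow> (nat set \<Rightarrow> nat)" where
  "induced c A =
     (\<lambda>e \<in> edges (card A). c ((\<lambda>i. sorted_list_of_set A ! (i - 1)) ` e))"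

text \<open>Hereditary properties are the order-hereditary ones that are moreover closed under
  permutations of the vertices.\<close>

definition order_hereditary :: "nat \<Rightarrow> (nat \<Rightarrow> (nat set \<Rightarrow> nat) set) \<Rightarrow> bool" where
  "order_hereditary k P \<longleftrightarrow>
     (\<forall>n. P n \<subseteq> colourings k n) \<and>
     (\<forall>n. \<forall>c \<in> P n. \<forall>A. A \<subseteq> {1..n} \<longrightarrow> induced c A \<in> P (card A))"

definition templates :: "nat \<Rightarrow> nat \<Rightarrow> (nat set \<Rightarrow> nat set) set" where
  "templates k n = edges n \<rightarrow>\<^sub>E {S. S \<subseteq> {1..k} \<and> S \<noteq> {}}"

definition realisations :: "nat \<Rightarrow> nat \<Rightarrow> (nat set \<Rightarrow> nat set) \<Rightarrow> (nat set \<Rightarrow> nat) set" where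
  "realisations k n t = {c \<in> colourings k n. \<forall>e \<in> edges n. c e \<in> t e}"

definition template_entropy :: "nat \<Rightarrow> nat \<Rightarrow> (nat set \<Rightarrow> nat set) \<Rightarrow> real" where
  "template_entropy k n t = (\<Sum>e \<in> edges n. log (real k) (real (card (t e))))"

definition extremal_entropy :: "nat \<Rightarrow> nat \<Rightarrow> (nat \<Rightarrow> (nat set \<Rightarrow> nat) set) \<Rightarrow> real" where
  "extremal_entropy k n P =
     Max {template_entropy k n t |t. t \<in> templates k n \<and> realisations k n t \<subseteq> P n}"

definition extremal_density :: "nat \<Rightarrow> (nat \<Rightarrow> (nat set \<Rightarrow> nat) set) \<Rightarrow> real" where
  "extremal_density k P = lim (\<lambda>n. extremal_entropy k n P / real (n choose 2))"

text \<open>A probability measure on \<open>{1..k}\<close> is a \<^typ>\<open>nat pmf\<close> supported in that set, and measurability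
  means Lebesgue measurability of all coordinates. Values off the unit square are
  irrelevant.\<close>

definition kgraphon :: "nat \<Rightarrow> (real \<times> real \<Rightarrow> nat pmf) \<Rightarrow> bool" where
  "kgraphon k W \<longleftrightarrow>
     (\<forall>x \<in> {0..1}. \<forall>y \<in> {0..1}. set_pmf (W (x, y)) \<subseteq> {1..k} \<and> W (x, y) = W (y, x)) \<and>
     (\<forall>i \<in> {1..k}. (\<lambda>z. pmf (W z) i) \<in> borel_measurable (lebesgue_on ({0..1} \<times> {0..1})))"

definition cut_diff :: "nat \<Rightarrow> (real \<times> real \<Rightarrow> nat pmf) \<Rightarrow> (real \<times> real \<Rightarrow> nat pmf) \<Rightarrow> real" where
  "cut_diff k U W =
     (SUP (S, T) \<in> {S \<in> sets lebesgue. S \<subseteq> {0..1}} \<times> {T \<in> sets lebesgue. T \<subseteq> {0..1}}.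
        \<Sum>i = 1..k. \<bar>LINT z : S \<times> T | lebesgue. pmf (U z) i - pmf (W z) i\<bar>)"

definition measure_preserving_maps :: "(real \<Rightarrow> real) set" where
  "measure_preserving_maps =
     {\<phi> \<in> measurable (lebesgue_on {0..1}) (lebesgue_on {0..1}).
        distr (lebesgue_on {0..1}) (lebesgue_on {0..1}) \<phi> = lebesgue_on {0..1}}"

definition cut_dist :: "nat \<Rightarrow> (real \<times> real \<Rightarrow> nat pmf) \<Rightarrow> (real \<times> real \<Rightarrow> nat pmf) \<Rightarrow> real" where
  "cut_dist k U W =
     (INF \<phi> \<in> measure_preserving_maps. cut_diff k U (\<lambda>(x, y). W (\<phi> x, \<phi> y)))"

text \<open>The point \<open>x\<close> lies in \<open>[(i - 1) / n, i / n)\<close> for \<open>i = nat \<lfloor>n x\<rfloor> + 1\<close>. The colour \<open>d\<close> gives the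
  arbitrary fixed point mass on the diagonal blocks, and also on the null set where a coordinate
  is 1, which no block contains.\<close>

definition step_graphon :: "nat \<Rightarrow> nat \<Rightarrow> (nat set \<Rightarrow> nat) \<Rightarrow> (real \<times> real \<Rightarrow> nat pmf)" where
  "step_graphon d n c = (\<lambda>(x, y).
     let i = nat \<lfloor>real n * x\<rfloor> + 1; j = nat \<lfloor>real n * y\<rfloor> + 1
     in return_pmf (if i \<in> {1..n} \<and> j \<in> {1..n} \<and> i \<noteq> j then c {i, j} else d))"

definition limit_graphons ::
    "nat \<Rightarrow> nat \<Rightarrow> (nat \<Rightarrow> (nat set \<Rightarrow> nat) set) \<Rightarrow> (real \<times> real \<Rightarrow> nat pmf) set" where
  "limit_graphons k d P =
     {W. kgraphon k W \<and>
        (\<exists>n c. (\<forall>j. c j \<in> P (n j)) \<and> filterlim n at_top sequentially \<and>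
           (\<lambda>j::nat. cut_dist k (step_graphon d (n j) (c j)) W) \<longlonglongrightarrow> 0)}"

text \<open>The convention \<open>0 log 0 = 0\<close> is built in, since multiplication by 0 gives 0.\<close>

definition entropy_fun :: "nat \<Rightarrow> (nat \<Rightarrow> real) \<Rightarrow> real" where
  "entropy_fun k p = - (\<Sum>i = 1..k. p i * log (real k) (p i))"

definition graphon_entropy :: "nat \<Rightarrow> (real \<times> real \<Rightarrow> nat pmf) \<Rightarrow> real" where
  "graphon_entropy k W = (LINT z : {0..1} \<times> {0..1} | lebesgue. entropy_fun k (pmf (W z)))"

end

theory Submission
  imports Defs "HOL-Complex_Analysis.Great_Picard" "HOL-Real_Asymp.Real_Asymp"
begin

text \<open>Let \<open>W\<close> be a limit graphon, approximated by a colouring \<open>c\<close> of a large complete graph. Average \<open>W\<close>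
  over small blocks and choose for \<open>m\<close> random vertices the template that lists at every edge the colours
  whose block average exceeds a small threshold. Its expected entropy is at least about
  \<open>m\<^sup>2 / 2\<close> times the entropy of \<open>W\<close> (Jensen), and by the counting lemma all its realisations occur as
  induced colourings of \<open>c\<close>. Hence the entropy of \<open>W\<close> bounds the normalised extremal entropy from below,
  and the latter is at most the normalised logarithm of the number of colourings. Conversely, let \<open>L\<close>
  be the upper limit of these logarithms. Weak regularity with respect to dyadic blocks after a
  permutation of the vertices sorts the colourings into few classes, so some class has nearly full
  size, and subadditivity of entropy yields a colouring whose block densities have entropy about
  \<open>L\<close>. Along a subsequence the dyadic block densities converge and form a martingale; its limit is a
  limit graphon of entropy at least \<open>L\<close>.\<close>

section \<open>Averages and cut norms\<close>

text \<open>The cut distance controls only rectangle sums, and this weak control suffices in both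
  directions. For the lower bound, a forbidden colouring of the \<open>m\<close> vertices never
  occurs in \<open>c\<close>, so its weighted count is at most the counting error, whereas every
  sample whose template admits it has weight at least \<open>\<epsilon> ^ N\<close>; hence few
  samples are bad. For the converse, a class must be described by so little data that the number of
  classes is negligible on the scale \<open>n\<^sup>2\<close>, yet by enough to fix a limit. Regular
  partitions of different colourings are not comparable; after sorting they all consist of
  intervals, and one fixed dyadic grid approximates them. A permutation with boundedly many block
  counts costs only \<open>n log n\<close>. The grids are exactly nested, so the limiting densities
  are consistent and no compactness theorem for graphons is invoked. Reordering does no harm
  although the property is only order-hereditary: the permutation acts on the graphon through a
  measure-preserving map, never on the members of \<open>P\<close>. Since the constructed limit
  attains the upper limit \<open>L\<close> of the counts, one squeeze yields both convergences and
  the maximum.\<close>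

definition fibre_avg :: "'a set \<Rightarrow> ('a \<Rightarrow> 'b) \<Rightarrow> ('a \<Rightarrow> real) \<Rightarrow> 'a \<Rightarrow> real" where
  "fibre_avg A \<kappa> f x = (\<Sum>y\<in>{y\<in>A. \<kappa> y = \<kappa> x}. f y) / real (card {y\<in>A. \<kappa> y = \<kappa> x})"

lemma fibre_avg_eq: "\<kappa> x = \<kappa> y \<Longrightarrow> fibre_avg A \<kappa> f x = fibre_avg A \<kappa> f y"
  by (simp add: fibre_avg_def)

lemma fibre_avg_measurable:
  assumes "finite A" "x \<in> A" "\<And>y. y \<in> A \<Longrightarrow> \<kappa> y = \<kappa> x \<Longrightarrow> g y = g x"
  shows "fibre_avg A \<kappa> g x = g x"
proof -
  have "(\<Sum>y\<in>{y\<in>A. \<kappa> y = \<kappa> x}. g y) = (\<Sum>y\<in>{y\<in>A. \<kappa> y = \<kappa> x}. g x)"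
    by (intro sum.cong refl assms(3)) auto
  moreover have "card {y\<in>A. \<kappa> y = \<kappa> x} \<noteq> 0" using assms(1,2) by auto
  ultimately show ?thesis by (simp add: fibre_avg_def)
qed

lemma fibre_avg_const: "finite A \<Longrightarrow> x \<in> A \<Longrightarrow> fibre_avg A \<kappa> (\<lambda>_. c) x = c"
  by (rule fibre_avg_measurable) auto

lemma fibre_avg_mono:
  "(\<And>y. y \<in> A \<Longrightarrow> f y \<le> g y) \<Longrightarrow> fibre_avg A \<kappa> f x \<le> fibre_avg A \<kappa> g x"
  by (auto simp: fibre_avg_def intro!: divide_right_mono sum_mono)

lemma fibre_avg_nonneg: "(\<And>y. y \<in> A \<Longrightarrow> 0 \<le> f y) \<Longrightarrow> 0 \<le> fibre_avg A \<kappa> f x"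
  by (auto simp: fibre_avg_def intro!: divide_nonneg_nonneg sum_nonneg)

lemma fibre_avg_le_1:
  "finite A \<Longrightarrow> x \<in> A \<Longrightarrow> (\<And>y. y \<in> A \<Longrightarrow> f y \<le> 1) \<Longrightarrow> fibre_avg A \<kappa> f x \<le> 1"
  using fibre_avg_mono[of A f "\<lambda>_. 1" \<kappa> x] by (simp add: fibre_avg_const)

lemma fibre_avg_diff: "fibre_avg A \<kappa> (\<lambda>x. f x - g x) x = fibre_avg A \<kappa> f x - fibre_avg A \<kappa> g x"
  by (simp add: fibre_avg_def sum_subtractf diff_divide_distrib)

lemma fibre_avg_sum: "fibre_avg A \<kappa> (\<lambda>x. \<Sum>i\<in>I. f i x) x = (\<Sum>i\<in>I. fibre_avg A \<kappa> (f i) x)"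
  by (simp add: fibre_avg_def sum_divide_distrib sum.swap[of _ I])

text \<open>\<open>fibre_avg\<close> is conditional expectation given \<open>\<kappa>\<close> on a
  uniform finite space. Its kernel \<open>w\<close> is symmetric because points with equal key share
  one fibre size.\<close>

lemma fibre_avg_selfadjoint:
  assumes "finite A"
  shows "(\<Sum>x\<in>A. fibre_avg A \<kappa> f x * g x) = (\<Sum>x\<in>A. f x * fibre_avg A \<kappa> g x)"
proof -
  define w where "w x y = (if \<kappa> x = \<kappa> y then 1 / real (card {z\<in>A. \<kappa> z = \<kappa> x}) else 0)" for x y
  have avg: "fibre_avg A \<kappa> h x = (\<Sum>y\<in>A. w x y * h y)" for h x
  proof -
    have "(\<Sum>y\<in>A. w x y * h y) = (\<Sum>y\<in>A. if \<kappa> y = \<kappa> x then h y / real (card {z\<in>A. \<kappa> z = \<kappa> x}) else 0)"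
      by (intro sum.cong) (auto simp: w_def)
    also have "\<dots> = fibre_avg A \<kappa> h x"
      by (subst sum.inter_filter[symmetric]) (auto simp: assms fibre_avg_def sum_divide_distrib)
    finally show ?thesis ..
  qed
  have "w x y = w y x" for x y by (auto simp: w_def)
  then show ?thesis
    unfolding avg sum_distrib_left sum_distrib_right
    by (subst sum.swap) (simp add: mult_ac)
qed

lemma fibre_avg_idem:
  assumes "finite A" "x \<in> A"
  shows "fibre_avg A \<kappa> (fibre_avg A \<kappa> f) x = fibre_avg A \<kappa> f x"
  by (rule fibre_avg_measurable) (auto simp: assms intro: fibre_avg_eq)

lemma sum_fibre_avg: "finite A \<Longrightarrow> (\<Sum>x\<in>A. fibre_avg A \<kappa> f x) = (\<Sum>x\<in>A. f x)"
  using fibre_avg_selfadjoint[of A \<kappa> f "\<lambda>_. 1"] by (simp add: fibre_avg_const)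

text \<open>Pythagoras for the projections onto nested spaces of fibrewise constant functions.\<close>

lemma fibre_avg_pythagoras:
  assumes "finite A"
    and fine: "\<And>x y. x \<in> A \<Longrightarrow> y \<in> A \<Longrightarrow> \<kappa>' x = \<kappa>' y \<Longrightarrow> \<kappa> x = \<kappa> y"
  shows "(\<Sum>x\<in>A. (fibre_avg A \<kappa>' f x - fibre_avg A \<kappa> f x)\<^sup>2) =
    (\<Sum>x\<in>A. (fibre_avg A \<kappa>' f x)\<^sup>2) - (\<Sum>x\<in>A. (fibre_avg A \<kappa> f x)\<^sup>2)"
proof -
  let ?E = "fibre_avg A \<kappa> f" and ?E' = "fibre_avg A \<kappa>' f"
  \<comment> \<open>Self-adjointness moves the fine average onto \<open>?E\<close>. Since
    \<open>?E\<close> is constant on the finer fibres, both averages fix it.\<close>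
  have "(\<Sum>x\<in>A. ?E' x * ?E x) = (\<Sum>x\<in>A. f x * fibre_avg A \<kappa>' ?E x)"
    by (rule fibre_avg_selfadjoint) fact
  also have "\<dots> = (\<Sum>x\<in>A. f x * fibre_avg A \<kappa> ?E x)"
    using assms by (intro sum.cong refl arg_cong2[of _ _ _ _ "(*)"])
      (auto simp: fibre_avg_idem intro!: fibre_avg_measurable fibre_avg_eq)
  also have "\<dots> = (\<Sum>x\<in>A. (?E x)\<^sup>2)"
    by (subst fibre_avg_selfadjoint[symmetric]) (simp_all add: assms power2_eq_square)
  finally have "(\<Sum>x\<in>A. ?E' x * ?E x) = (\<Sum>x\<in>A. (?E x)\<^sup>2)" .
  then show ?thesis
    by (simp add: power2_diff sum.distrib sum_subtractf mult.assoc flip: sum_distrib_left)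
qed

text \<open>The case of \<open>fibre_avg_pythagoras\<close> whose finer key is \<open>id\<close>,
  for which averaging does nothing.\<close>

lemma fibre_avg_energy_le:
  assumes "finite A"
  shows "(\<Sum>x\<in>A. (fibre_avg A \<kappa> f x)\<^sup>2) \<le> (\<Sum>x\<in>A. (f x)\<^sup>2)"
proof -
  have "0 \<le> (\<Sum>x\<in>A. (fibre_avg A id f x - fibre_avg A \<kappa> f x)\<^sup>2)" by (simp add: sum_nonneg)
  also have "\<dots> = (\<Sum>x\<in>A. (fibre_avg A id f x)\<^sup>2) - (\<Sum>x\<in>A. (fibre_avg A \<kappa> f x)\<^sup>2)"
    by (rule fibre_avg_pythagoras) (auto simp: assms)
  also have "(\<Sum>x\<in>A. (fibre_avg A id f x)\<^sup>2) = (\<Sum>x\<in>A. (f x)\<^sup>2)"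
    using assms by (intro sum.cong refl arg_cong[of _ _ "\<lambda>x. x\<^sup>2"] fibre_avg_measurable) auto
  finally show ?thesis by simp
qed

lemma fibre_avg_reindex:
  assumes "bij_betw \<sigma> A A"
  shows "fibre_avg A (\<kappa> \<circ> \<sigma>) (f \<circ> \<sigma>) x = fibre_avg A \<kappa> f (\<sigma> x)"
proof -
  have bij: "bij_betw \<sigma> {y\<in>A. (\<kappa> \<circ> \<sigma>) y = (\<kappa> \<circ> \<sigma>) x} {y\<in>A. \<kappa> y = \<kappa> (\<sigma> x)}"
    using assms unfolding bij_betw_def by (auto simp: inj_on_def image_iff)
  show ?thesis
    unfolding fibre_avg_def using sum.reindex_bij_betw[OF bij, of f] bij_betw_same_card[OF bij] by simp
qed

lemma fibre_map_prod:
  "{y \<in> A \<times> B. map_prod \<kappa> \<kappa>' y = map_prod \<kappa> \<kappa>' z} =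
     {y \<in> A. \<kappa> y = \<kappa> (fst z)} \<times> {y \<in> B. \<kappa>' y = \<kappa>' (snd z)}"
  by (cases z) auto

lemma fibre_avg_product:
  "fibre_avg (A \<times> B) (map_prod \<kappa> \<kappa>') (\<lambda>z. s (fst z) * t (snd z)) z =
    fibre_avg A \<kappa> s (fst z) * fibre_avg B \<kappa>' t (snd z)"
  unfolding fibre_avg_def fibre_map_prod
  by (simp add: card_cartesian_product sum_product sum.cartesian_product case_prod_beta)

text \<open>The unnormalised cut norm, tested with weights in [0,1] instead of sets. Weights are
  stable under averaging and under products of edge factors, and they are what a measurable set
  leaves on a grid of blocks.\<close>

definition cut_bounded :: "'a set \<Rightarrow> ('a \<times> 'a \<Rightarrow> real) \<Rightarrow> real \<Rightarrow> bool" where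
  "cut_bounded V F e \<longleftrightarrow> (\<forall>s t. (\<forall>u\<in>V. 0 \<le> s u \<and> s u \<le> 1) \<longrightarrow> (\<forall>u\<in>V. 0 \<le> t u \<and> t u \<le> 1) \<longrightarrow>
     \<bar>\<Sum>z\<in>V \<times> V. F z * (s (fst z) * t (snd z))\<bar> \<le> e)"

lemma cut_boundedD:
  assumes "cut_bounded V F e" "\<And>u. u \<in> V \<Longrightarrow> 0 \<le> s u" "\<And>u. u \<in> V \<Longrightarrow> s u \<le> 1"
    "\<And>u. u \<in> V \<Longrightarrow> 0 \<le> t u" "\<And>u. u \<in> V \<Longrightarrow> t u \<le> 1"
  shows "\<bar>\<Sum>z\<in>V \<times> V. F z * (s (fst z) * t (snd z))\<bar> \<le> e"
  using assms unfolding cut_bounded_def by blast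

lemma cut_bounded_mono: "cut_bounded V F e \<Longrightarrow> e \<le> e' \<Longrightarrow> cut_bounded V F e'"
  unfolding cut_bounded_def by (meson order_trans)

lemma cut_bounded_cong:
  "(\<And>z. z \<in> V \<times> V \<Longrightarrow> F z = G z) \<Longrightarrow> cut_bounded V F e \<longleftrightarrow> cut_bounded V G e"
  unfolding cut_bounded_def by (simp cong: sum.cong)

lemma cut_bounded_add:
  assumes "cut_bounded V F e" "cut_bounded V G e'"
  shows "cut_bounded V (\<lambda>z. F z + G z) (e + e')"
  unfolding cut_bounded_def
proof (intro allI impI)
  fix s t :: "'a \<Rightarrow> real"
  assume "\<forall>u\<in>V. 0 \<le> s u \<and> s u \<le> 1" "\<forall>u\<in>V. 0 \<le> t u \<and> t u \<le> 1"
  then have "\<bar>\<Sum>z\<in>V \<times> V. F z * (s (fst z) * t (snd z))\<bar> \<le> e"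
    "\<bar>\<Sum>z\<in>V \<times> V. G z * (s (fst z) * t (snd z))\<bar> \<le> e'"
    using assms by (auto intro!: cut_boundedD)
  then show "\<bar>\<Sum>z\<in>V \<times> V. (F z + G z) * (s (fst z) * t (snd z))\<bar> \<le> e + e'"
    by (simp add: distrib_right sum.distrib)
qed

lemma cut_bounded_uminus: "cut_bounded V F e \<Longrightarrow> cut_bounded V (\<lambda>z. - F z) e"
  unfolding cut_bounded_def by (simp add: sum_negf)

lemma cut_bounded_l1:
  assumes "(\<Sum>z\<in>V \<times> V. \<bar>F z\<bar>) \<le> e"
  shows "cut_bounded V F e"
  unfolding cut_bounded_def
proof (intro allI impI)
  fix s t :: "'a \<Rightarrow> real"
  assume st: "\<forall>u\<in>V. 0 \<le> s u \<and> s u \<le> 1" "\<forall>u\<in>V. 0 \<le> t u \<and> t u \<le> 1"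
  have "\<bar>\<Sum>z\<in>V \<times> V. F z * (s (fst z) * t (snd z))\<bar> \<le> (\<Sum>z\<in>V \<times> V. \<bar>F z * (s (fst z) * t (snd z))\<bar>)"
    by (rule sum_abs)
  also have "\<dots> \<le> (\<Sum>z\<in>V \<times> V. \<bar>F z\<bar>)"
  proof (rule sum_mono)
    fix z assume "z \<in> V \<times> V"
    then have "0 \<le> s (fst z)" "s (fst z) \<le> 1" "0 \<le> t (snd z)" "t (snd z) \<le> 1" using st by auto
    then have "\<bar>s (fst z) * t (snd z)\<bar> \<le> 1" by (simp add: abs_mult mult_le_one)
    then show "\<bar>F z * (s (fst z) * t (snd z))\<bar> \<le> \<bar>F z\<bar>"
      unfolding abs_mult[of "F z"] by (rule mult_left_le) simp
  qed
  finally show "\<bar>\<Sum>z\<in>V \<times> V. F z * (s (fst z) * t (snd z))\<bar> \<le> e" using assms by simp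
qed

text \<open>Averaging over products of fibres can be moved to the test function, where it acts on
  \<open>s\<close> and \<open>t\<close> separately and keeps them in [0,1].\<close>

lemma cut_bounded_fibre_avg:
  assumes "finite V" "cut_bounded V F e"
  shows "cut_bounded V (fibre_avg (V \<times> V) (map_prod \<kappa> \<kappa>) F) e"
  unfolding cut_bounded_def
proof (intro allI impI)
  fix s t :: "'a \<Rightarrow> real"
  assume st: "\<forall>u\<in>V. 0 \<le> s u \<and> s u \<le> 1" "\<forall>u\<in>V. 0 \<le> t u \<and> t u \<le> 1"
  have "(\<Sum>z\<in>V \<times> V. fibre_avg (V \<times> V) (map_prod \<kappa> \<kappa>) F z * (s (fst z) * t (snd z))) =
     (\<Sum>z\<in>V \<times> V. F z * (fibre_avg V \<kappa> s (fst z) * fibre_avg V \<kappa> t (snd z)))"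
    by (subst fibre_avg_selfadjoint) (simp_all add: assms fibre_avg_product)
  also have "\<bar>\<dots>\<bar> \<le> e"
    using st by (intro cut_boundedD[OF assms(2)] fibre_avg_nonneg fibre_avg_le_1) (auto simp: assms)
  finally show "\<bar>\<Sum>z\<in>V \<times> V. fibre_avg (V \<times> V) (map_prod \<kappa> \<kappa>) F z * (s (fst z) * t (snd z))\<bar> \<le> e" .
qed

text \<open>A linear functional on the cube is maximal at a vertex: keep exactly the points with
  positive coefficient.\<close>

lemma sum_weighted_le_subset:
  fixes a s :: "'a \<Rightarrow> real"
  assumes "finite V" "\<And>u. u \<in> V \<Longrightarrow> 0 \<le> s u" "\<And>u. u \<in> V \<Longrightarrow> s u \<le> 1"
  shows "\<exists>S\<subseteq>V. (\<Sum>u\<in>V. a u * s u) \<le> (\<Sum>u\<in>S. a u)"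
proof (intro exI conjI)
  let ?S = "{u\<in>V. 0 < a u}"
  have "a u * s u \<le> (if 0 < a u then a u else 0)" if "u \<in> V" for u
    using assms(2,3)[OF that] by (auto simp: mult_left_le mult_nonpos_nonneg)
  then have "(\<Sum>u\<in>V. a u * s u) \<le> (\<Sum>u\<in>V. if 0 < a u then a u else 0)" by (rule sum_mono)
  also have "\<dots> = (\<Sum>u\<in>?S. a u)" using assms(1) by (simp add: sum.inter_filter)
  finally show "(\<Sum>u\<in>V. a u * s u) \<le> (\<Sum>u\<in>?S. a u)" .
qed auto

text \<open>The form is linear in each weight while the other is fixed, so weights are exchanged for
  sets one side at a time.\<close>

lemma bilinear_le_rectangle:
  assumes "finite V" "\<And>u. u \<in> V \<Longrightarrow> 0 \<le> s u" "\<And>u. u \<in> V \<Longrightarrow> s u \<le> 1"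
    "\<And>u. u \<in> V \<Longrightarrow> 0 \<le> t u" "\<And>u. u \<in> V \<Longrightarrow> t u \<le> 1"
  shows "\<exists>S\<subseteq>V. \<exists>T\<subseteq>V. (\<Sum>z\<in>V \<times> V. F z * (s (fst z) * t (snd z))) \<le> (\<Sum>z\<in>S \<times> T. (F z :: real))"
proof -
  have 1: "(\<Sum>z\<in>V \<times> V. F z * (s (fst z) * t (snd z))) = (\<Sum>u\<in>V. (\<Sum>v\<in>V. F (u, v) * t v) * s u)"
    unfolding sum.cartesian_product' sum_distrib_right by (simp add: mult_ac)
  obtain S where S: "S \<subseteq> V"
      "(\<Sum>u\<in>V. (\<Sum>v\<in>V. F (u, v) * t v) * s u) \<le> (\<Sum>u\<in>S. \<Sum>v\<in>V. F (u, v) * t v)"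
    using sum_weighted_le_subset[where V=V and s=s and a="\<lambda>u. \<Sum>v\<in>V. F (u, v) * t v", OF assms(1-3)] by auto
  have 2: "(\<Sum>u\<in>S. \<Sum>v\<in>V. F (u, v) * t v) = (\<Sum>v\<in>V. (\<Sum>u\<in>S. F (u, v)) * t v)"
    unfolding sum_distrib_right by (rule sum.swap)
  obtain T where T: "T \<subseteq> V" "(\<Sum>v\<in>V. (\<Sum>u\<in>S. F (u, v)) * t v) \<le> (\<Sum>v\<in>T. \<Sum>u\<in>S. F (u, v))"
    using sum_weighted_le_subset[where V=V and s=t and a="\<lambda>v. \<Sum>u\<in>S. F (u, v)", OF assms(1,4,5)] by auto
  have 3: "(\<Sum>v\<in>T. \<Sum>u\<in>S. F (u, v)) = (\<Sum>z\<in>S \<times> T. F z)"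
    unfolding sum.cartesian_product' by (rule sum.swap)
  show ?thesis
    using S T unfolding 1 2 3 by (intro exI[of _ S] conjI exI[of _ T]) auto
qed

lemma cut_bounded_rectangles:
  assumes "finite V" and rect: "\<And>S T. S \<subseteq> V \<Longrightarrow> T \<subseteq> V \<Longrightarrow> \<bar>\<Sum>z\<in>S \<times> T. F z\<bar> \<le> e"
  shows "cut_bounded V F e"
  unfolding cut_bounded_def
proof (intro allI impI)
  fix s t :: "'a \<Rightarrow> real"
  assume st: "\<forall>u\<in>V. 0 \<le> s u \<and> s u \<le> 1" "\<forall>u\<in>V. 0 \<le> t u \<and> t u \<le> 1"
  \<comment> \<open>Used for \<open>F\<close> and for \<open>- F\<close>; the rectangles that
    dominate the two signs may differ.\<close>
  have 1: "\<exists>S\<subseteq>V. \<exists>T\<subseteq>V. (\<Sum>z\<in>V \<times> V. G z * (s (fst z) * t (snd z))) \<le> (\<Sum>z\<in>S \<times> T. (G z :: real))" for G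
    by (rule bilinear_le_rectangle) (use st assms(1) in blast)+
  obtain S T where ST: "S \<subseteq> V" "T \<subseteq> V" "(\<Sum>z\<in>V \<times> V. F z * (s (fst z) * t (snd z))) \<le> (\<Sum>z\<in>S \<times> T. F z)"
    using 1[of F] by blast
  obtain S' T' where ST': "S' \<subseteq> V" "T' \<subseteq> V" "(\<Sum>z\<in>V \<times> V. - F z * (s (fst z) * t (snd z))) \<le> (\<Sum>z\<in>S' \<times> T'. - F z)"
    using 1[of "\<lambda>z. - F z"] by blast
  have "- (\<Sum>z\<in>V \<times> V. F z * (s (fst z) * t (snd z))) \<le> - (\<Sum>z\<in>S' \<times> T'. F z)"
    using ST'(3) by (simp only: sum_negf mult_minus_left)
  then have "- (\<Sum>z\<in>V \<times> V. F z * (s (fst z) * t (snd z))) \<le> e"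
    using abs_le_D2[OF rect[OF ST'(1,2)]] by (rule order_trans)
  moreover have "(\<Sum>z\<in>V \<times> V. F z * (s (fst z) * t (snd z))) \<le> e"
    using ST(3) abs_le_D1[OF rect[OF ST(1,2)]] by (rule order_trans)
  ultimately show "\<bar>\<Sum>z\<in>V \<times> V. F z * (s (fst z) * t (snd z))\<bar> \<le> e"
    by (intro abs_leI)
qed

section \<open>Regularity\<close>

text \<open>Each split appends one base-4 digit recording membership in \<open>S\<close> and in
  \<open>T\<close>. The leading digits are thus the keys of all coarser partitions, and ordering by
  the last key respects every earlier one.\<close>

definition refine_key :: "('a \<Rightarrow> nat) \<Rightarrow> 'a set \<Rightarrow> 'a set \<Rightarrow> 'a \<Rightarrow> nat" where
  "refine_key \<kappa> S T u = 4 * \<kappa> u + (if u \<in> S then 2 else 0) + (if u \<in> T then 1 else 0)"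

lemma refine_key_div: "refine_key \<kappa> S T u div 4 = \<kappa> u"
proof -
  have "(4 * x + 2 + 1) div 4 = x" "(4 * x + 2) div 4 = x" "(4 * x + 1) div 4 = x" for x :: nat
    by presburger+
  then show ?thesis by (auto simp: refine_key_def simp del: add_2_eq_Suc add_2_eq_Suc' One_nat_def)
qed

lemma refine_key_mem:
  assumes "refine_key \<kappa> S T u = refine_key \<kappa> S T v"
  shows "u \<in> S \<longleftrightarrow> v \<in> S" "u \<in> T \<longleftrightarrow> v \<in> T"
proof -
  have "\<kappa> u = \<kappa> v" using assms refine_key_div by metis
  then show "u \<in> S \<longleftrightarrow> v \<in> S" "u \<in> T \<longleftrightarrow> v \<in> T"
    using assms by (auto simp: refine_key_def split: if_splits)
qed

abbreviation avg2 :: "'a set \<Rightarrow> ('a \<Rightarrow> 'b) \<Rightarrow> ('a \<times> 'a \<Rightarrow> real) \<Rightarrow> 'a \<times> 'a \<Rightarrow> real" where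
  "avg2 V \<kappa> \<equiv> fibre_avg (V \<times> V) (map_prod \<kappa> \<kappa>)"

definition energy :: "'a set \<Rightarrow> 'i set \<Rightarrow> ('i \<Rightarrow> 'a \<times> 'a \<Rightarrow> real) \<Rightarrow> ('a \<Rightarrow> nat) \<Rightarrow> real" where
  "energy V I f \<kappa> = (\<Sum>i\<in>I. \<Sum>z\<in>V \<times> V. (avg2 V \<kappa> (f i) z)\<^sup>2)"

text \<open>The energy increment of the Frieze--Kannan argument: splitting by a worst pair of sets.\<close>

lemma energy_increment:
  assumes fin: "finite V" "V \<noteq> {}" "finite I" "I \<noteq> {}"
  shows "\<exists>S T e. 0 \<le> e \<and> (\<forall>i\<in>I. cut_bounded V (\<lambda>z. f i z - avg2 V \<kappa> (f i) z) e) \<and>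
    energy V I f \<kappa> + e\<^sup>2 / (real (card V))\<^sup>2 \<le> energy V I f (refine_key \<kappa> S T)"
proof -
  \<comment> \<open>Finitely many colours and rectangles compete, so a worst one exists; its
    discrepancy \<open>e\<close> bounds all the others, and splitting by it is the
    refinement.\<close>
  define r where "r = (\<lambda>(i, S, T). \<bar>\<Sum>z\<in>S \<times> T. f i z - avg2 V \<kappa> (f i) z\<bar>)"
  obtain x where x: "x \<in> I \<times> Pow V \<times> Pow V" and max: "r x = Max (r ` (I \<times> Pow V \<times> Pow V))"
  proof -
    have "finite (I \<times> Pow V \<times> Pow V)" "I \<times> Pow V \<times> Pow V \<noteq> {}" using fin by auto
    then show ?thesis using that by (metis obtains_MAX)
  qed
  obtain i S T where x_eq: "x = (i, S, T)" by (cases x)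
  define e where "e = r x"
  have i: "i \<in> I" "S \<subseteq> V" "T \<subseteq> V" using x x_eq by auto
  have le_e: "r y \<le> e" if "y \<in> I \<times> Pow V \<times> Pow V" for y
    unfolding e_def max using that fin by (intro Max_ge) auto
  have cut: "cut_bounded V (\<lambda>z. f i z - avg2 V \<kappa> (f i) z) e" if "i \<in> I" for i
    by (rule cut_bounded_rectangles) (use le_e[of "(i, _, _)"] that fin in \<open>auto simp: r_def\<close>)
  define \<kappa>' where "\<kappa>' = refine_key \<kappa> S T"
  have fine: "map_prod \<kappa> \<kappa> x = map_prod \<kappa> \<kappa> y" if "map_prod \<kappa>' \<kappa>' x = map_prod \<kappa>' \<kappa>' y" for x y
  proof -
    have "\<kappa>' (fst x) = \<kappa>' (fst y)" "\<kappa>' (snd x) = \<kappa>' (snd y)"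
      using that by (cases x; cases y; simp)+
    then have "\<kappa> (fst x) = \<kappa> (fst y)" "\<kappa> (snd x) = \<kappa> (snd y)"
      unfolding \<kappa>'_def by (metis refine_key_div)+
    then show ?thesis by (cases x; cases y) simp
  qed
  let ?D = "\<lambda>j z. avg2 V \<kappa>' (f j) z - avg2 V \<kappa> (f j) z"
  have pyth: "(\<Sum>z\<in>V \<times> V. (?D j z)\<^sup>2) =
      (\<Sum>z\<in>V \<times> V. (avg2 V \<kappa>' (f j) z)\<^sup>2) - (\<Sum>z\<in>V \<times> V. (avg2 V \<kappa> (f j) z)\<^sup>2)" for j
    by (rule fibre_avg_pythagoras, simp add: fin, erule fine)
  have rect: "(\<Sum>z\<in>V \<times> V. h z * indicator (S \<times> T) z) = sum h (S \<times> T)" for h :: "'a \<times> 'a \<Rightarrow> real"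
    using i fin by (intro sum.mono_neutral_cong_right) (auto simp: indicator_def)
  have ind: "indicator (S \<times> T) y = (indicator (S \<times> T) z :: real)"
    if "map_prod \<kappa>' \<kappa>' y = map_prod \<kappa>' \<kappa>' z" for y z
  proof -
    obtain a b a' b' where yz: "y = (a, b)" "z = (a', b')" by (cases y; cases z)
    then have "\<kappa>' a = \<kappa>' a'" "\<kappa>' b = \<kappa>' b'" using that by simp_all
    then have "a \<in> S \<longleftrightarrow> a' \<in> S" "b \<in> T \<longleftrightarrow> b' \<in> T"
      unfolding \<kappa>'_def by (blast dest: refine_key_mem)+
    then show ?thesis by (simp add: yz indicator_def)
  qed
  \<comment> \<open>The indicator of \<open>S \<times> T\<close> is constant on refined fibres, so
    refined averaging preserves the sum over this rectangle. Thus \<open>e\<close> becomes a sum of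
    differences of two averages.\<close>
  have "(\<Sum>z\<in>V \<times> V. avg2 V \<kappa>' (f i) z * indicator (S \<times> T) z) =
      (\<Sum>z\<in>V \<times> V. f i z * avg2 V \<kappa>' (indicator (S \<times> T)) z)"
    by (rule fibre_avg_selfadjoint) (use fin in auto)
  also have "\<dots> = (\<Sum>z\<in>V \<times> V. f i z * indicator (S \<times> T) z)"
    using fin by (intro sum.cong refl arg_cong2[of _ _ _ _ "(*)"] fibre_avg_measurable ind) auto
  finally have "(\<Sum>z\<in>S \<times> T. avg2 V \<kappa>' (f i) z) = (\<Sum>z\<in>S \<times> T. f i z)" unfolding rect .
  then have "e = \<bar>\<Sum>z\<in>S \<times> T. ?D i z\<bar>"
    by (simp add: e_def r_def x_eq sum_subtractf)
  then have "e\<^sup>2 = (\<Sum>z\<in>S \<times> T. ?D i z)\<^sup>2" by simp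
  \<comment> \<open>Cauchy-Schwarz; after enlarging the rectangle to the whole square, Pythagoras
    turns the squares into an energy difference.\<close>
  also have "\<dots> \<le> (\<Sum>z\<in>S \<times> T. (?D i z)\<^sup>2) * real (card (S \<times> T))"
    by (rule sum_squared_le_sum_of_squares)
  also have "\<dots> \<le> (\<Sum>z\<in>V \<times> V. (?D i z)\<^sup>2) * real (card (V \<times> V))"
    using i fin by (intro mult_mono sum_mono2 sum_nonneg of_nat_mono card_mono) auto
  finally have "e\<^sup>2 \<le> (\<Sum>z\<in>V \<times> V. (?D i z)\<^sup>2) * (real (card V))\<^sup>2"
    by (simp add: power2_eq_square card_cartesian_product)
  then have "e\<^sup>2 / (real (card V))\<^sup>2 \<le> (\<Sum>z\<in>V \<times> V. (?D i z)\<^sup>2)"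
    using fin by (simp add: divide_le_eq card_gt_0_iff)
  also have "\<dots> \<le> (\<Sum>j\<in>I. \<Sum>z\<in>V \<times> V. (?D j z)\<^sup>2)"
    using i fin by (intro member_le_sum) (auto intro: sum_nonneg)
  also have "\<dots> = energy V I f \<kappa>' - energy V I f \<kappa>"
    by (simp add: pyth energy_def sum_subtractf)
  finally have "energy V I f \<kappa> + e\<^sup>2 / (real (card V))\<^sup>2 \<le> energy V I f \<kappa>'" by simp
  moreover have "0 \<le> e" by (auto simp: e_def r_def split: prod.split)
  ultimately show ?thesis using cut unfolding \<kappa>'_def by blast
qed

text \<open>The values lie in [0,1], where squaring decreases them, and the colours sum to at most
  1; hence the bound does not grow with the number of colours.\<close>

lemma energy_le:
  assumes fin: "finite V" "finite I" and f: "\<And>i z. i \<in> I \<Longrightarrow> z \<in> V \<times> V \<Longrightarrow> 0 \<le> f i z"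
    "\<And>z. z \<in> V \<times> V \<Longrightarrow> (\<Sum>i\<in>I. f i z) \<le> 1"
  shows "energy V I f \<kappa> \<le> (real (card V))\<^sup>2"
proof -
  have "energy V I f \<kappa> \<le> (\<Sum>i\<in>I. \<Sum>z\<in>V \<times> V. (f i z)\<^sup>2)"
    unfolding energy_def using fin by (intro sum_mono fibre_avg_energy_le) auto
  also have "\<dots> \<le> (\<Sum>i\<in>I. \<Sum>z\<in>V \<times> V. f i z)"
  proof (intro sum_mono)
    fix i z assume iz: "i \<in> I" "z \<in> V \<times> V"
    have "f i z \<le> (\<Sum>i\<in>I. f i z)" using iz f fin by (intro member_le_sum) auto
    then have "f i z \<le> 1" using f(2)[OF iz(2)] by simp
    then show "(f i z)\<^sup>2 \<le> f i z" using f(1)[OF iz] by (simp add: power2_eq_square mult_left_le)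
  qed
  also have "\<dots> = (\<Sum>z\<in>V \<times> V. \<Sum>i\<in>I. f i z)" by (rule sum.swap)
  also have "\<dots> \<le> (\<Sum>z\<in>V \<times> V. 1)" using f by (intro sum_mono) auto
  finally show ?thesis by (simp add: power2_eq_square card_cartesian_product)
qed

text \<open>If each of the first \<open>M\<close> splits had an error above
  \<open>n\<^sup>2 / sqrt M\<close> with \<open>n = card V\<close>, the energy would exceed its
  bound \<open>n\<^sup>2\<close>. The keys are built without reference to \<open>M\<close>, so one
  sequence serves every accuracy.\<close>

lemma greedy_keys:
  assumes fin: "finite V" "V \<noteq> {}" "finite I" "I \<noteq> {}"
    and f: "\<And>i z. i \<in> I \<Longrightarrow> z \<in> V \<times> V \<Longrightarrow> 0 \<le> f i z"
    "\<And>z. z \<in> V \<times> V \<Longrightarrow> (\<Sum>i\<in>I. f i z) \<le> 1"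
  shows "\<exists>K :: nat \<Rightarrow> 'a \<Rightarrow> nat. (\<forall>u. K 0 u = 0) \<and> (\<forall>m u. K (Suc m) u div 4 = K m u) \<and>
    (\<forall>M>0. \<exists>m<M. \<forall>i\<in>I. cut_bounded V (\<lambda>z. f i z - avg2 V (K m) (f i) z) ((real (card V))\<^sup>2 / sqrt (real M)))"
proof -
  let ?n = "real (card V)"
  have n: "?n > 0" using fin by (simp add: card_gt_0_iff)
  define Q where "Q \<kappa> S T e \<longleftrightarrow> 0 \<le> e \<and> (\<forall>i\<in>I. cut_bounded V (\<lambda>z. f i z - avg2 V \<kappa> (f i) z) e) \<and>
    energy V I f \<kappa> + e\<^sup>2 / ?n\<^sup>2 \<le> energy V I f (refine_key \<kappa> S T)" for \<kappa> S T e
  have "\<exists>p. Q \<kappa> (fst p) (fst (snd p)) (snd (snd p))" for \<kappa>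
    using energy_increment[OF fin, of f \<kappa>] unfolding Q_def[symmetric] by force
  then obtain p where p: "\<And>\<kappa>. Q \<kappa> (fst (p \<kappa>)) (fst (snd (p \<kappa>))) (snd (snd (p \<kappa>)))"
    by metis
  define S T e where "S \<kappa> = fst (p \<kappa>)" and "T \<kappa> = fst (snd (p \<kappa>))" and "e \<kappa> = snd (snd (p \<kappa>))" for \<kappa>
  have "Q \<kappa> (S \<kappa>) (T \<kappa>) (e \<kappa>)" for \<kappa> using p by (simp add: S_def T_def e_def)
  then have step: "0 \<le> e \<kappa>"
    "i \<in> I \<Longrightarrow> cut_bounded V (\<lambda>z. f i z - avg2 V \<kappa> (f i) z) (e \<kappa>)"
    "energy V I f \<kappa> + (e \<kappa>)\<^sup>2 / ?n\<^sup>2 \<le> energy V I f (refine_key \<kappa> (S \<kappa>) (T \<kappa>))" for \<kappa> i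
    by (auto simp: Q_def)
  define K where "K = rec_nat (\<lambda>_. 0) (\<lambda>_ \<kappa>. refine_key \<kappa> (S \<kappa>) (T \<kappa>))"
  have K: "K 0 = (\<lambda>_. 0)" "K (Suc m) = refine_key (K m) (S (K m)) (T (K m))" for m
    by (simp_all add: K_def)
  have incr: "(\<Sum>m<M. (e (K m))\<^sup>2 / ?n\<^sup>2) \<le> energy V I f (K M)" for M
  proof (induction M)
    case 0
    show ?case by (simp add: energy_def sum_nonneg)
  next
    case (Suc M)
    then show ?case using step(3)[of "K M"] by (simp add: K)
  qed
  have "\<exists>m<M. e (K m) \<le> ?n\<^sup>2 / sqrt M" if M: "M > 0" for M
  proof (rule ccontr)
    assume "\<not> (\<exists>m<M. e (K m) \<le> ?n\<^sup>2 / sqrt M)"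
    then have "(?n\<^sup>2 / sqrt M)\<^sup>2 < (e (K m))\<^sup>2" if "m < M" for m
      using that by (intro power_strict_mono) (auto simp: not_le)
    then have "?n\<^sup>2 / M < (e (K m))\<^sup>2 / ?n\<^sup>2" if "m < M" for m
      using that n M by (simp add: power_divide field_simps power2_eq_square)
    then have "(\<Sum>m<M. ?n\<^sup>2 / M) < (\<Sum>m<M. (e (K m))\<^sup>2 / ?n\<^sup>2)"
      using M by (intro sum_strict_mono) auto
    also have "\<dots> \<le> energy V I f (K M)" by (rule incr)
    also have "\<dots> \<le> ?n\<^sup>2" by (rule energy_le) (use fin f in blast)+
    finally show False using M by simp
  qed
  then have "\<forall>M>0. \<exists>m<M. \<forall>i\<in>I. cut_bounded V (\<lambda>z. f i z - avg2 V (K m) (f i) z) (?n\<^sup>2 / sqrt (real M))"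
    using step(2) cut_bounded_mono by meson
  then show ?thesis by (intro exI[of _ K]) (auto simp: K refine_key_div)
qed

text \<open>Division is monotone, so an order of the vertices by the deepest key is also an order by
  every earlier key.\<close>

lemma key_prefix:
  assumes "\<And>m u. K (Suc m) u div 4 = (K m u :: nat)"
  shows "m \<le> N \<Longrightarrow> K m u = K N u div 4 ^ (N - m)"
proof (induction N)
  case (Suc N)
  show ?case
  proof (cases "m = Suc N")
    case False
    then have "K m u = K N u div 4 ^ (N - m)" using Suc by simp
    also have "\<dots> = K (Suc N) u div (4 * 4 ^ (N - m))"
      by (simp add: assms[of N u, symmetric] div_mult2_eq)
    finally show ?thesis using Suc.prems False by (simp add: Suc_diff_le)
  qed simp
qed simp

lemma key_less:
  assumes "\<And>m u. K (Suc m) u div 4 = (K m u :: nat)" "\<And>u. K 0 u = 0"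
  shows "K m u < 4 ^ m"
proof (induction m)
  case (Suc m)
  then have "K (Suc m) u div 4 < 4 ^ m" by (simp add: assms)
  then show ?case by (simp add: div_less_iff_less_mult mult.commute)
qed (simp add: assms)

section \<open>Sorting the vertices and passing from intervals to equal blocks\<close>

lemma sorting_bijection:
  fixes key :: "nat \<Rightarrow> nat"
  shows "\<exists>\<sigma>. bij_betw \<sigma> {..<n} {..<n} \<and> (\<forall>u v. u \<le> v \<longrightarrow> v < n \<longrightarrow> key (\<sigma> u) \<le> key (\<sigma> v))"
proof -
  let ?xs = "sort_key key [0..<n]"
  have "bij_betw ((!) ?xs) {..<n} {..<n}"
    by (rule bij_betw_nth) auto
  moreover have "key (?xs ! u) \<le> key (?xs ! v)" if "u \<le> v" "v < n" for u v
    using sorted_nth_mono[of "map key ?xs" u v] that by simp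
  ultimately show ?thesis by blast
qed

lemma cut_bounded_reindex:
  assumes bij: "bij_betw \<sigma> V V" and F: "cut_bounded V F e"
  shows "cut_bounded V (F \<circ> map_prod \<sigma> \<sigma>) e"
  unfolding cut_bounded_def
proof (intro allI impI)
  fix s t :: "'a \<Rightarrow> real"
  assume st: "\<forall>u\<in>V. 0 \<le> s u \<and> s u \<le> 1" "\<forall>u\<in>V. 0 \<le> t u \<and> t u \<le> 1"
  let ?g = "the_inv_into V \<sigma>"
  have g: "?g (\<sigma> u) = u" if "u \<in> V" for u
    using that bij by (simp add: bij_betw_def the_inv_into_f_f)
  have gV: "?g u \<in> V" if "u \<in> V" for u
    using that bij the_inv_into_into[of \<sigma> V u V] by (simp add: bij_betw_def)
  have bij2: "bij_betw (map_prod \<sigma> \<sigma>) (V \<times> V) (V \<times> V)"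
    by (rule bij_betw_map_prod) (use bij in auto)
  have "(\<Sum>z\<in>V \<times> V. F z * (s (?g (fst z)) * t (?g (snd z)))) =
      (\<Sum>z\<in>V \<times> V. F (map_prod \<sigma> \<sigma> z) * (s (?g (\<sigma> (fst z))) * t (?g (\<sigma> (snd z)))))"
    by (subst sum.reindex_bij_betw[OF bij2, symmetric]) simp
  also have "\<dots> = (\<Sum>z\<in>V \<times> V. (F \<circ> map_prod \<sigma> \<sigma>) z * (s (fst z) * t (snd z)))"
    by (intro sum.cong) (auto simp: g)
  finally show "\<bar>\<Sum>z\<in>V \<times> V. (F \<circ> map_prod \<sigma> \<sigma>) z * (s (fst z) * t (snd z))\<bar> \<le> e"
    using cut_boundedD[OF F, of "\<lambda>u. s (?g u)" "\<lambda>u. t (?g u)"] st gV by simp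
qed

text \<open>A block on which the monotone key is not constant shows a strict rise between its two
  ends. The end values of such blocks increase strictly from one block to the next, so at most
  \<open>m\<close> blocks qualify.\<close>

lemma card_nonconstant_blocks:
  fixes \<kappa> :: "nat \<Rightarrow> nat"
  assumes b: "b > 0" and mono: "\<And>u v. u \<le> v \<Longrightarrow> v < n \<Longrightarrow> \<kappa> u \<le> \<kappa> v"
    and less: "\<And>u. \<kappa> u < m" and n: "n = b * B"
  shows "card {u\<in>{..<n}. \<exists>v<n. v div b = u div b \<and> \<kappa> v \<noteq> \<kappa> u} \<le> m * b"
proof -
  let ?bad = "{u\<in>{..<n}. \<exists>v<n. v div b = u div b \<and> \<kappa> v \<noteq> \<kappa> u}"
  define C where "C = {\<beta>. \<beta> < B \<and> \<kappa> (\<beta> * b) < \<kappa> (\<beta> * b + (b - 1))}"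
  have end_less: "\<beta> * b + (b - 1) < n" if "\<beta> < B" for \<beta>
  proof -
    have "\<beta> * b + b \<le> B * b" using that by (metis Suc_leI add.commute mult_Suc mult_le_mono1)
    then show ?thesis using b n by (simp add: mult.commute)
  qed
  have start: "(u div b) * b \<le> u" "u \<le> (u div b) * b + (b - 1)" "u < n \<Longrightarrow> u div b < B" for u
  proof -
    have "u = (u div b) * b + u mod b" "u mod b < b" using b by simp_all
    then show "(u div b) * b \<le> u" "u \<le> (u div b) * b + (b - 1)" by linarith+
    show "u < n \<Longrightarrow> u div b < B" using n by (simp add: less_mult_imp_div_less mult.commute)
  qed
  have sub: "?bad \<subseteq> (\<lambda>(\<beta>, r). \<beta> * b + r) ` (C \<times> {..<b})"
  proof
    fix u assume "u \<in> ?bad"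
    then obtain v where uv: "u < n" "v < n" "v div b = u div b" "\<kappa> v \<noteq> \<kappa> u" by auto
    define \<beta> where "\<beta> = u div b"
    have B: "\<beta> < B" using start(3) uv unfolding \<beta>_def by blast
    have l: "\<kappa> (\<beta> * b) \<le> \<kappa> x" "\<kappa> x \<le> \<kappa> (\<beta> * b + (b - 1))" if "x < n" "x div b = \<beta>" for x
      using start(1,2)[of x] that end_less[OF B] by (auto intro!: mono)
    have "\<kappa> (\<beta> * b) < \<kappa> (\<beta> * b + (b - 1))"
      using l[of u] l[of v] uv \<beta>_def by linarith
    then have "\<beta> \<in> C" using B by (simp add: C_def)
    moreover have "u = \<beta> * b + u mod b" by (simp add: \<beta>_def)
    ultimately show "u \<in> (\<lambda>(\<beta>, r). \<beta> * b + r) ` (C \<times> {..<b})"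
      using b by (intro image_eqI[of _ _ "(\<beta>, u mod b)"]) auto
  qed
  have "inj_on (\<lambda>\<beta>. \<kappa> (\<beta> * b + (b - 1))) C"
  proof (rule linorder_inj_onI)
    fix \<beta> \<gamma> assume "\<beta> < \<gamma>" "\<beta> \<in> C" "\<gamma> \<in> C"
    have "\<beta> * b + b \<le> \<gamma> * b" using \<open>\<beta> < \<gamma>\<close> by (metis Suc_leI add.commute mult_Suc mult_le_mono1)
    moreover have "\<gamma> * b < n" using end_less[of \<gamma>] \<open>\<gamma> \<in> C\<close> by (simp add: C_def)
    ultimately have "\<kappa> (\<beta> * b + (b - 1)) \<le> \<kappa> (\<gamma> * b)" by (intro mono) auto
    also have "\<dots> < \<kappa> (\<gamma> * b + (b - 1))" using \<open>\<gamma> \<in> C\<close> by (simp add: C_def)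
    finally show "\<kappa> (\<beta> * b + (b - 1)) \<noteq> \<kappa> (\<gamma> * b + (b - 1))" by simp
  qed auto
  then have "card C \<le> card {..<m}"
    by (rule card_inj_on_le) (auto simp: less)
  moreover have "card ?bad \<le> card (C \<times> {..<b})"
    by (rule order_trans[OF card_mono[OF _ sub] card_image_le]) (auto simp: C_def)
  ultimately show ?thesis
    by (simp add: card_cartesian_product) (meson mult_le_mono1 order_trans)
qed

text \<open>Block averaging changes \<open>F\<close> only where one of the two coordinates lies in a
  block meeting several intervals, and there by at most 1. The factor 2 accounts for rows and
  columns.\<close>

lemma interval_step_block_avg:
  fixes \<kappa> :: "nat \<Rightarrow> nat"
  assumes b: "b > 0" and mono: "\<And>u v. u \<le> v \<Longrightarrow> v < n \<Longrightarrow> \<kappa> u \<le> \<kappa> v"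
    and less: "\<And>u. \<kappa> u < m" and n: "n = b * B"
    and F: "\<And>z z'. map_prod \<kappa> \<kappa> z = map_prod \<kappa> \<kappa> z' \<Longrightarrow> F z = F z'"
      "\<And>z. z \<in> {..<n} \<times> {..<n} \<Longrightarrow> 0 \<le> F z" "\<And>z. z \<in> {..<n} \<times> {..<n} \<Longrightarrow> F z \<le> 1"
  shows "(\<Sum>z\<in>{..<n} \<times> {..<n}. \<bar>F z - avg2 {..<n} (\<lambda>u. u div b) F z\<bar>) \<le> 2 * real (m * b * n)"
proof -
  let ?V = "{..<n}" and ?A = "avg2 {..<n} (\<lambda>u. u div b) F"
  define bad where "bad = {u\<in>{..<n}. \<exists>v<n. v div b = u div b \<and> \<kappa> v \<noteq> \<kappa> u}"
  have zero: "F z = ?A z" if "z \<in> ?V \<times> ?V" "z \<notin> bad \<times> ?V \<union> ?V \<times> bad" for z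
  proof (rule fibre_avg_measurable[symmetric])
    fix y assume y: "y \<in> ?V \<times> ?V" "map_prod (\<lambda>u. u div b) (\<lambda>u. u div b) y = map_prod (\<lambda>u. u div b) (\<lambda>u. u div b) z"
    obtain p q p' q' where yz: "y = (p, q)" "z = (p', q')" by (cases y; cases z)
    have "p < n" "q < n" "p' < n" "q' < n" "p div b = p' div b" "q div b = q' div b" "p' \<notin> bad" "q' \<notin> bad"
      using that y yz by simp_all
    then have "\<kappa> p = \<kappa> p'" "\<kappa> q = \<kappa> q'" unfolding bad_def by blast+
    then show "F y = F z" by (intro F(1)) (simp add: yz)
  qed (use that in auto)
  have le1: "\<bar>F z - ?A z\<bar> \<le> 1" if "z \<in> ?V \<times> ?V" for z
  proof -
    have "0 \<le> ?A z" by (rule fibre_avg_nonneg) (rule F(2))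
    moreover have "?A z \<le> 1" by (rule fibre_avg_le_1[OF _ that]) (simp, rule F(3))
    ultimately show ?thesis using F(2,3)[OF that] by linarith
  qed
  have "(\<Sum>z\<in>?V \<times> ?V. \<bar>F z - ?A z\<bar>) = (\<Sum>z\<in>bad \<times> ?V \<union> ?V \<times> bad. \<bar>F z - ?A z\<bar>)"
    by (rule sum.mono_neutral_right) (use zero in \<open>auto simp: bad_def\<close>)
  also have "\<dots> \<le> (\<Sum>z\<in>bad \<times> ?V \<union> ?V \<times> bad. 1)"
    by (intro sum_mono le1) (auto simp: bad_def)
  also have "\<dots> \<le> real (card (bad \<times> ?V) + card (?V \<times> bad))"
    by (simp only: sum_constant mult_1_right of_nat_mono card_Un_le mult.right_neutral)
  also have "\<dots> = 2 * real (card bad * n)" by (simp add: card_cartesian_product mult.commute)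
  also have "\<dots> \<le> 2 * real (m * b * n)"
    using card_nonconstant_blocks[OF b mono less n] unfolding bad_def
    by (intro mult_left_mono of_nat_mono mult_le_mono1) auto
  finally show ?thesis .
qed

text \<open>Sorting the vertices by the greedy keys makes every part of the regular partitions an
  interval, so that the partition into dyadic blocks is regular as well.\<close>

lemma sorted_regularity:
  assumes n: "n > 0" and I: "finite I" "I \<noteq> {}"
    and f: "\<And>i z. i \<in> I \<Longrightarrow> z \<in> {..<n} \<times> {..<n} \<Longrightarrow> 0 \<le> f i z"
    "\<And>z. z \<in> {..<n} \<times> {..<n} \<Longrightarrow> (\<Sum>i\<in>I. f i z) \<le> 1"
  shows "\<exists>\<sigma>. bij_betw \<sigma> {..<n} {..<n} \<and> (\<forall>M l b. 0 < M \<and> M \<le> N \<and> n = b * 2 ^ l \<longrightarrow>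
    (\<forall>i\<in>I. cut_bounded {..<n} (\<lambda>z. f i (map_prod \<sigma> \<sigma> z) - avg2 {..<n} (\<lambda>u. u div b) (f i \<circ> map_prod \<sigma> \<sigma>) z)
       ((2 / sqrt M + 2 * 4 ^ M / 2 ^ l) * (real n)\<^sup>2)))"
proof -
  let ?V = "{..<n}"
  obtain K :: "nat \<Rightarrow> nat \<Rightarrow> nat" where K: "\<And>u. K 0 u = 0" "\<And>m u. K (Suc m) u div 4 = K m u"
    and reg: "\<And>M. M > 0 \<Longrightarrow> \<exists>m<M. \<forall>i\<in>I. cut_bounded ?V (\<lambda>z. f i z - avg2 ?V (K m) (f i) z) ((real n)\<^sup>2 / sqrt (real M))"
    using greedy_keys[of ?V I f, OF finite_lessThan _ I f, unfolded card_lessThan] n by blast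
  \<comment> \<open>Only the key of stage \<open>N\<close> is sorted; its prefixes are then sorted
    as well, so a single permutation serves all \<open>M \<le> N\<close> and all levels
    \<open>l\<close>.\<close>
  obtain \<sigma> where bij: "bij_betw \<sigma> ?V ?V" and sort: "\<And>u v. u \<le> v \<Longrightarrow> v < n \<Longrightarrow> K N (\<sigma> u) \<le> K N (\<sigma> v)"
    using sorting_bijection[of n "K N"] by blast
  have bij2: "bij_betw (map_prod \<sigma> \<sigma>) (?V \<times> ?V) (?V \<times> ?V)"
    by (rule bij_betw_map_prod) (use bij in auto)
  have "cut_bounded ?V (\<lambda>z. f i (map_prod \<sigma> \<sigma> z) - avg2 ?V (\<lambda>u. u div b) (f i \<circ> map_prod \<sigma> \<sigma>) z)
       ((2 / sqrt M + 2 * 4 ^ M / 2 ^ l) * (real n)\<^sup>2)"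
    if M: "0 < M" "M \<le> N" and nb: "n = b * 2 ^ l" and i: "i \<in> I" for M l b i
  proof -
    obtain m where m: "m < M" and
      cut: "cut_bounded ?V (\<lambda>z. f i z - avg2 ?V (K m) (f i) z) ((real n)\<^sup>2 / sqrt (real M))"
      using reg[OF M(1)] i by blast
    define \<kappa> where "\<kappa> = K m \<circ> \<sigma>"
    define g where "g = f i \<circ> map_prod \<sigma> \<sigma>"
    define P where "P = avg2 ?V \<kappa> g"
    let ?B = "avg2 ?V (\<lambda>u. u div b)"
    have P: "P z = avg2 ?V (K m) (f i) (map_prod \<sigma> \<sigma> z)" for z
      unfolding P_def g_def \<kappa>_def map_prod_compose by (rule fibre_avg_reindex[OF bij2])
    have 1: "cut_bounded ?V (\<lambda>z. g z - P z) ((real n)\<^sup>2 / sqrt (real M))"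
      using cut_bounded_reindex[OF bij cut] by (simp add: P g_def o_def)
    have 2: "cut_bounded ?V (\<lambda>z. - ?B (\<lambda>z. g z - P z) z) ((real n)\<^sup>2 / sqrt (real M))"
      by (intro cut_bounded_uminus cut_bounded_fibre_avg 1) auto
    have g01: "0 \<le> g z" "g z \<le> 1" if z: "z \<in> ?V \<times> ?V" for z
    proof -
      have z': "map_prod \<sigma> \<sigma> z \<in> ?V \<times> ?V" using bij2 z by (metis bij_betwE)
      show "0 \<le> g z" using f(1)[OF i z'] by (simp add: g_def)
      have "f i (map_prod \<sigma> \<sigma> z) \<le> (\<Sum>i\<in>I. f i (map_prod \<sigma> \<sigma> z))"
        using i I f(1) z' by (intro member_le_sum) auto
      then show "g z \<le> 1" using f(2)[OF z'] by (simp add: g_def)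
    qed
    have "(\<Sum>z\<in>?V \<times> ?V. \<bar>P z - ?B P z\<bar>) \<le> 2 * real (4 ^ m * b * n)"
    proof (rule interval_step_block_avg)
      show "b > 0" using n nb by (cases b) auto
      show "\<kappa> u < 4 ^ m" for u unfolding \<kappa>_def using key_less[of K m "\<sigma> u"] K by simp
      show "\<kappa> u \<le> \<kappa> v" if "u \<le> v" "v < n" for u v
        using key_prefix[of K m N] K m M(2) sort[OF that] by (simp add: \<kappa>_def div_le_mono)
      show "n = b * 2 ^ l" by (fact nb)
      show "P z = P z'" if "map_prod \<kappa> \<kappa> z = map_prod \<kappa> \<kappa> z'" for z z'
        unfolding P_def using that by (rule fibre_avg_eq)
      show "0 \<le> P z" "P z \<le> 1" if "z \<in> ?V \<times> ?V" for z
        unfolding P_def using that g01 by (auto intro!: fibre_avg_nonneg fibre_avg_le_1)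
    qed
    also have "\<dots> \<le> 2 * real (4 ^ M * b * n)"
      using m by (intro mult_left_mono of_nat_mono mult_le_mono1 power_increasing) auto
    also have "\<dots> = 2 * 4 ^ M / 2 ^ l * (real n)\<^sup>2"
      by (simp add: nb power2_eq_square)
    finally have 3: "cut_bounded ?V (\<lambda>z. P z - ?B P z) (2 * 4 ^ M / 2 ^ l * (real n)\<^sup>2)"
      by (rule cut_bounded_l1)
    \<comment> \<open>The error \<open>g - P\<close> enters twice, directly and after block
      averaging, hence \<open>2 / sqrt M\<close>. The middle term pays for the blocks meeting
      several intervals, with \<open>b = n / 2 ^ l\<close>.\<close>
    have "cut_bounded ?V (\<lambda>z. (g z - P z) + (P z - ?B P z) + (- ?B (\<lambda>z. g z - P z) z))
       ((real n)\<^sup>2 / sqrt (real M) + 2 * 4 ^ M / 2 ^ l * (real n)\<^sup>2 + (real n)\<^sup>2 / sqrt (real M))"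
      by (intro cut_bounded_add 1 2 3)
    then show ?thesis
      by (simp add: fibre_avg_diff g_def o_def algebra_simps)
  qed
  then show ?thesis using bij by blast
qed

section \<open>Entropy\<close>

text \<open>One summand of Gibbs' inequality, from \<open>ln x \<le> x - 1\<close> at
  \<open>x = q / p\<close>. The linear term replaces the assumption of equal totals; it cancels or
  is estimated after summation. The last premise excludes \<open>q = 0 < p\<close>, where the
  logarithm has a default value.\<close>

lemma neg_xlog_le:
  fixes b p q :: real
  assumes "1 < b" "0 \<le> p" "0 \<le> q" "q = 0 \<Longrightarrow> p = 0"
  shows "- (p * log b p) \<le> - (p * log b q) + (q - p) / ln b"
proof (cases "p = 0")
  case True
  then show ?thesis using assms by simp
next
  case False
  then have pq: "p > 0" "q > 0" using assms by (auto simp: less_le)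
  have lb: "ln b > 0" using assms by simp
  have "ln (q / p) \<le> q / p - 1" using pq by (intro ln_le_minus_one) simp
  then have "p * (ln q - ln p) \<le> q - p" using pq by (simp add: ln_div field_simps)
  then have "p * (ln q - ln p) / ln b \<le> (q - p) / ln b" using lb by (intro divide_right_mono) auto
  moreover have "p * (ln q - ln p) / ln b = p * log b q - p * log b p"
    by (simp add: log_def diff_divide_distrib right_diff_distrib)
  ultimately show ?thesis by linarith
qed

text \<open>Compare \<open>p\<close> with \<open>q = sqrt p\<close>: the logarithm on the right is
  half of that on the left and can be absorbed.\<close>

lemma neg_xlog_le_sqrt:
  fixes b p :: real
  assumes "1 < b" "0 \<le> p" "p \<le> \<epsilon>"
  shows "- (p * log b p) \<le> 2 * sqrt \<epsilon> / ln b"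
proof (cases "p = 0")
  case True
  then show ?thesis using assms by simp
next
  case False
  then have p: "p > 0" using assms by simp
  have "- (p * log b p) \<le> - (p * log b (sqrt p)) + (sqrt p - p) / ln b"
    using assms by (intro neg_xlog_le) auto
  moreover have "p * log b (sqrt p) = p * log b p / 2" using p by (simp add: log_def ln_sqrt)
  ultimately have "- (p * log b p) \<le> 2 * ((sqrt p - p) / ln b)" by linarith
  also have "\<dots> \<le> 2 * (sqrt \<epsilon> / ln b)"
  proof -
    have "sqrt p - p \<le> sqrt \<epsilon>" using assms real_sqrt_le_mono[of p \<epsilon>] by linarith
    then show ?thesis using assms(1) by (intro mult_left_mono divide_right_mono) auto
  qed
  finally show ?thesis by simp
qed

lemma entropy_fun_alt: "entropy_fun k p = (\<Sum>i=1..k. - (p i * log (real k) (p i)))"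
  by (simp add: entropy_fun_def sum_negf)

lemma entropy_fun_nonneg:
  assumes "k \<ge> 2" "\<And>i. i \<in> {1..k} \<Longrightarrow> 0 \<le> p i" "\<And>i. i \<in> {1..k} \<Longrightarrow> p i \<le> 1"
  shows "0 \<le> entropy_fun k p"
  unfolding entropy_fun_alt
proof (rule sum_nonneg)
  fix i assume i: "i \<in> {1..k}"
  show "0 \<le> - (p i * log (real k) (p i))"
  proof (cases "p i = 0")
    case False
    then have "log (real k) (p i) \<le> 0" using assms(1) assms(2,3)[OF i] by (simp add: less_le)
    then show ?thesis using assms(2)[OF i] by (simp add: mult_nonneg_nonpos)
  qed simp
qed

text \<open>Colours of weight at most \<open>\<epsilon>\<close> have total mass at most
  \<open>k * \<epsilon> < 1\<close>, so some colour survives. On the survivors the entropy is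
  compared with the uniform distribution. Up to the factor \<open>1 / ln k\<close>, the small
  weights cost \<open>2 * k * sqrt \<epsilon>\<close> and the mass missing from the survivors costs
  \<open>k * sqrt \<epsilon>\<close>.\<close>

lemma entropy_fun_le_log_card:
  assumes k: "k \<ge> 2" and p: "\<And>i. i \<in> {1..k} \<Longrightarrow> 0 \<le> p i" "(\<Sum>i=1..k. p i) = 1"
    and \<epsilon>: "0 \<le> \<epsilon>" "\<epsilon> < 1 / real k"
  shows "{i\<in>{1..k}. p i > \<epsilon>} \<noteq> {}"
    and "entropy_fun k p \<le> log (real k) (real (card {i\<in>{1..k}. p i > \<epsilon>})) + 3 * real k * sqrt \<epsilon> / ln (real k)"
proof -
  define S where "S = {i\<in>{1..k}. p i > \<epsilon>}"
  have S: "S \<subseteq> {1..k}" "finite S" by (auto simp: S_def)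
  let ?b = "real k"
  have b: "1 < ?b" "0 < ln ?b" using k by simp_all
  have eps1: "\<epsilon> \<le> 1" using \<epsilon> k by (smt (verit) divide_le_eq_1 of_nat_1 of_nat_le_iff one_le_numeral order_trans)
  have split: "(\<Sum>i=1..k. f i) = (\<Sum>i\<in>S. f i) + (\<Sum>i\<in>{1..k} - S. f i)" for f :: "nat \<Rightarrow> real"
    using S by (subst sum.subset_diff[of S "{1..k}"]) auto
  have small: "(\<Sum>i\<in>{1..k} - S. f i) \<le> ?b * c" if "\<And>i. i \<in> {1..k} - S \<Longrightarrow> f i \<le> c" "0 \<le> c" for f :: "nat \<Rightarrow> real" and c
  proof -
    have "(\<Sum>i\<in>{1..k} - S. f i) \<le> real (card ({1..k} - S)) * c"
      using that(1) by (rule sum_bounded_above)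
    also have "\<dots> \<le> ?b * c"
      using that(2) card_mono[of "{1..k}" "{1..k} - S"] by (intro mult_right_mono) auto
    finally show ?thesis .
  qed
  have rest: "(\<Sum>i\<in>{1..k} - S. p i) \<le> ?b * \<epsilon>" by (rule small) (use \<epsilon> in \<open>auto simp: S_def\<close>)
  have "?b * \<epsilon> < 1" using \<epsilon>(2) b(1) by (simp add: field_simps)
  have ne: "S \<noteq> {}"
  proof
    assume "S = {}"
    then have "(\<Sum>i\<in>S. p i) = 0" by simp
    then show False using rest split[of p] p(2) \<open>?b * \<epsilon> < 1\<close> by linarith
  qed
  then have s0: "0 < real (card S)" using S by (simp add: card_gt_0_iff)
  have S1: "(\<Sum>i\<in>S. p i) \<le> 1" "0 \<le> (\<Sum>i\<in>S. p i)"
    using p split[of p] sum_nonneg[of "{1..k} - S" p] S by (auto intro!: sum_nonneg)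
  have "(\<Sum>i\<in>S. - (p i * log ?b (p i))) \<le> (\<Sum>i\<in>S. - (p i * log ?b (1 / card S)) + (1 / card S - p i) / ln ?b)"
    using b p(1) s0 S by (intro sum_mono neg_xlog_le) auto
  also have "\<dots> = (\<Sum>i\<in>S. p i) * log ?b (card S) + (1 - (\<Sum>i\<in>S. p i)) / ln ?b"
  proof -
    have "log ?b (1 / card S) = - log ?b (card S)" using s0 b by (simp add: log_divide)
    moreover have "(\<Sum>i\<in>S. (1 / card S - p i) / ln ?b) = (1 - (\<Sum>i\<in>S. p i)) / ln ?b"
      unfolding sum_divide_distrib[symmetric] sum_subtractf using s0 by simp
    ultimately show ?thesis by (simp only: sum.distrib sum_distrib_right mult_minus_right minus_minus)
  qed
  also have "\<dots> \<le> 1 * log ?b (card S) + (?b * \<epsilon>) / ln ?b"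
    using S1 s0 b rest split[of p] p(2) by (intro add_mono mult_right_mono divide_right_mono) auto
  finally have large: "(\<Sum>i\<in>S. - (p i * log ?b (p i))) \<le> log ?b (card S) + ?b * \<epsilon> / ln ?b" by simp
  have "(\<Sum>i\<in>{1..k} - S. - (p i * log ?b (p i))) \<le> ?b * (2 * sqrt \<epsilon> / ln ?b)"
    using b p(1) \<epsilon>(1) by (intro small neg_xlog_le_sqrt) (auto simp: S_def)
  moreover have "?b * \<epsilon> / ln ?b \<le> ?b * sqrt \<epsilon> / ln ?b"
  proof -
    have "\<epsilon> = sqrt \<epsilon> * sqrt \<epsilon>" using \<epsilon>(1) by simp
    also have "\<dots> \<le> sqrt \<epsilon> * 1" using eps1 \<epsilon>(1) by (intro mult_left_mono) auto
    finally show ?thesis using b by (intro divide_right_mono mult_left_mono) auto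
  qed
  moreover have "3 * ?b * sqrt \<epsilon> / ln ?b = ?b * (2 * sqrt \<epsilon> / ln ?b) + ?b * sqrt \<epsilon> / ln ?b"
    by (simp add: field_simps)
  ultimately have "entropy_fun k p \<le> log ?b (real (card S)) + 3 * ?b * sqrt \<epsilon> / ln ?b"
    unfolding entropy_fun_alt using large split[of "\<lambda>i. - (p i * log ?b (p i))"] by linarith
  with ne show "{i\<in>{1..k}. p i > \<epsilon>} \<noteq> {}"
    and "entropy_fun k p \<le> log (real k) (real (card {i\<in>{1..k}. p i > \<epsilon>})) + 3 * real k * sqrt \<epsilon> / ln (real k)"
    by (simp_all add: S_def)
qed

text \<open>The threshold 0 in \<open>entropy_fun_le_log_card\<close>, with no error term.\<close>

lemma entropy_fun_le_1:
  assumes k: "k \<ge> 2" and p: "\<And>i. i \<in> {1..k} \<Longrightarrow> 0 \<le> p i" "(\<Sum>i=1..k. p i) = 1"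
  shows "entropy_fun k p \<le> 1"
proof -
  let ?S = "{i\<in>{1..k}. p i > 0}"
  have "entropy_fun k p \<le> log (real k) (real (card ?S))"
    using entropy_fun_le_log_card[OF k p, of 0] k by simp
  also have "\<dots> \<le> log (real k) (real k)"
  proof -
    have "card ?S \<le> card {1..k}" by (rule card_mono) auto
    moreover have "0 < card ?S" using entropy_fun_le_log_card(1)[OF k p, of 0] k by (simp add: card_gt_0_iff)
    ultimately show ?thesis using k by (intro log_mono) auto
  qed
  finally show ?thesis using k by simp
qed

text \<open>Concavity through Gibbs' inequality: each value is compared with its fibre average. The
  linear terms sum to zero because averaging keeps totals, and the logarithm of the average, being
  constant on fibres, lets \<open>f\<close> be replaced by its average.\<close>

lemma entropy_fun_fibre_avg:
  assumes A: "finite A" and k: "k \<ge> 2" and f: "\<And>i x. i \<in> {1..k} \<Longrightarrow> x \<in> A \<Longrightarrow> 0 \<le> f i x"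
  shows "(\<Sum>x\<in>A. entropy_fun k (\<lambda>i. f i x)) \<le> (\<Sum>x\<in>A. entropy_fun k (\<lambda>i. fibre_avg A \<kappa> (f i) x))"
proof -
  let ?b = "real k"
  have "(\<Sum>x\<in>A. - (f i x * log ?b (f i x))) \<le> (\<Sum>x\<in>A. - (fibre_avg A \<kappa> (f i) x * log ?b (fibre_avg A \<kappa> (f i) x)))"
    if i: "i \<in> {1..k}" for i
  proof -
    let ?E = "fibre_avg A \<kappa> (f i)"
    have E0: "0 \<le> ?E x" for x by (rule fibre_avg_nonneg) (use f i in auto)
    have zero: "f i x = 0" if "x \<in> A" "?E x = 0" for x
    proof -
      have "card {y \<in> A. \<kappa> y = \<kappa> x} \<noteq> 0" using that A by auto
      then have "(\<Sum>y\<in>{y \<in> A. \<kappa> y = \<kappa> x}. f i y) = 0" using that(2) by (simp add: fibre_avg_def)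
      then show ?thesis using that(1) A f[OF i] by (subst (asm) sum_nonneg_eq_0_iff) auto
    qed
    have "(\<Sum>x\<in>A. - (f i x * log ?b (f i x))) \<le> (\<Sum>x\<in>A. - (f i x * log ?b (?E x)) + (?E x - f i x) / ln ?b)"
      using k E0 zero f[OF i] by (intro sum_mono neg_xlog_le) auto
    also have "\<dots> = - (\<Sum>x\<in>A. f i x * log ?b (?E x))"
      using A by (simp add: sum.distrib sum_negf sum_subtractf sum_fibre_avg flip: sum_divide_distrib)
    also have "(\<Sum>x\<in>A. f i x * log ?b (?E x)) = (\<Sum>x\<in>A. f i x * fibre_avg A \<kappa> (\<lambda>x. log ?b (?E x)) x)"
    proof (intro sum.cong refl arg_cong2[of _ _ _ _ "(*)"] fibre_avg_measurable[symmetric] A)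
      fix x y assume "\<kappa> y = \<kappa> x"
      then show "log ?b (?E y) = log ?b (?E x)" by (simp only: fibre_avg_eq[of \<kappa> y x])
    qed
    also have "\<dots> = (\<Sum>x\<in>A. ?E x * log ?b (?E x))"
      using A by (rule fibre_avg_selfadjoint[symmetric])
    finally show ?thesis by (simp add: sum_negf)
  qed
  then have "(\<Sum>i=1..k. \<Sum>x\<in>A. - (f i x * log ?b (f i x))) \<le>
      (\<Sum>i=1..k. \<Sum>x\<in>A. - (fibre_avg A \<kappa> (f i) x * log ?b (fibre_avg A \<kappa> (f i) x)))"
    by (rule sum_mono)
  then show ?thesis unfolding entropy_fun_alt by (subst (1 2) sum.swap)
qed

section \<open>The counting lemma\<close>

lemma sum_PiE_insert:
  assumes "a \<notin> I"
  shows "(\<Sum>x\<in>PiE (insert a I) J. g x) = (\<Sum>u\<in>J a. \<Sum>y\<in>PiE I J. g (y(a := u)))"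
proof -
  have "inj_on (\<lambda>(u, y). y(a := u)) (J a \<times> PiE I J)" using inj_combinator[OF assms] .
  then have "(\<Sum>x\<in>PiE (insert a I) J. g x) = (\<Sum>(u, y)\<in>J a \<times> PiE I J. g (y(a := u)))"
    unfolding PiE_insert_eq by (subst sum.reindex) (auto simp: case_prod_beta)
  then show ?thesis by (simp add: sum.cartesian_product)
qed

lemma sum_PiE_two:
  assumes "a \<in> I" "b \<in> I" "a \<noteq> b"
  shows "(\<Sum>x\<in>PiE I J. g x) =
    (\<Sum>y\<in>PiE (I - {a, b}) J. \<Sum>u\<in>J a. \<Sum>v\<in>J b. g (y(b := v, a := u)))"
proof -
  let ?K = "I - {a, b}"
  have "I = insert a (insert b ?K)" using assms by auto
  then have "(\<Sum>x\<in>PiE I J. g x) = (\<Sum>x\<in>PiE (insert a (insert b ?K)) J. g x)" by simp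
  also have "\<dots> = (\<Sum>u\<in>J a. \<Sum>y\<in>PiE (insert b ?K) J. g (y(a := u)))"
    using assms by (intro sum_PiE_insert) auto
  also have "\<dots> = (\<Sum>u\<in>J a. \<Sum>v\<in>J b. \<Sum>y\<in>PiE ?K J. g (y(b := v, a := u)))"
    by (intro sum.cong refl sum_PiE_insert) auto
  also have "\<dots> = (\<Sum>y\<in>PiE ?K J. \<Sum>u\<in>J a. \<Sum>v\<in>J b. g (y(b := v, a := u)))"
    by (subst (2) sum.swap, subst sum.swap) simp
  finally show ?thesis .
qed

text \<open>Sums over \<open>PiE I J\<close> are unnormalised expectations over independent uniform
  samples \<open>x a\<close> from \<open>J a\<close>. The common size \<open>q\<close> makes the
  marginal of any two samples the same multiple of a sum over a rectangle.\<close>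

locale sampling =
  fixes V :: "'a set" and I :: "nat set" and J :: "nat \<Rightarrow> 'a set" and q :: nat
  assumes V: "finite V" and I: "finite I" and J: "\<And>a. a \<in> I \<Longrightarrow> J a \<subseteq> V" "\<And>a. a \<in> I \<Longrightarrow> card (J a) = q"
begin

abbreviation ends :: "(nat \<Rightarrow> 'a) \<Rightarrow> nat \<times> nat \<Rightarrow> 'a \<times> 'a" where
  "ends x e \<equiv> (x (fst e), x (snd e))"

lemma finite_J: "a \<in> I \<Longrightarrow> finite (J a)"
  using J V finite_subset by blast

lemma ends_mem: "x \<in> PiE I J \<Longrightarrow> fst e \<in> I \<Longrightarrow> snd e \<in> I \<Longrightarrow> ends x e \<in> V \<times> V"
  using J(1)[of "fst e"] J(1)[of "snd e"] by (auto dest: PiE_mem[of x I J "fst e"] PiE_mem[of x I J "snd e"])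

lemma card_PiE_J: "K \<subseteq> I \<Longrightarrow> card (PiE K J) = q ^ card K"
  using I J(2) finite_subset[of K I] by (simp add: card_PiE subset_iff)

lemma sum_one_pair:
  assumes "a \<in> I" "b \<in> I" "a \<noteq> b"
  shows "(\<Sum>x\<in>PiE I J. F (x a, x b)) = real (q ^ (card I - 2)) * (\<Sum>z\<in>J a \<times> J b. F z)"
proof -
  have "card (I - {a, b}) = card I - 2" using assms I by (subst card_Diff_subset) auto
  then have "card (PiE (I - {a, b}) J) = q ^ (card I - 2)" using card_PiE_J[of "I - {a, b}"] by auto
  then show ?thesis
    using assms by (subst sum_PiE_two[OF assms]) (simp add: sum.cartesian_product')
qed

text \<open>Fix all samples except those at \<open>a\<close> and \<open>b\<close>. As the pair
  itself is not in \<open>E\<close>, every other factor depends on at most one of the two, so the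
  product splits into weights \<open>s u * t v\<close> to which the cut bound applies.\<close>

lemma counting_one_edge:
  assumes ab: "a \<in> I" "b \<in> I" "a < b" and D: "cut_bounded V D B"
    and E: "finite E" "\<And>e. e \<in> E \<Longrightarrow> fst e \<in> I \<and> snd e \<in> I \<and> fst e < snd e" "(a, b) \<notin> E"
    and H: "\<And>e z. e \<in> E \<Longrightarrow> z \<in> V \<times> V \<Longrightarrow> 0 \<le> H e z \<and> H e z \<le> (1 :: real)"
  shows "\<bar>\<Sum>x\<in>PiE I J. D (x a, x b) * (\<Prod>e\<in>E. H e (ends x e))\<bar> \<le> real (q ^ (card I - 2)) * B"
proof -
  \<comment> \<open>The edges at \<open>a\<close> go into \<open>s\<close>; all others, whether they
    meet \<open>b\<close> or not, go into \<open>t\<close>.\<close>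
  define E1 where "E1 = {e\<in>E. fst e = a \<or> snd e = a}"
  let ?K = "I - {a, b}"
  have card_K: "card (PiE ?K J) = q ^ (card I - 2)"
  proof -
    have "card ?K = card I - 2" using ab I by (subst card_Diff_subset) auto
    then show ?thesis using card_PiE_J[of ?K] by auto
  qed
  have "\<bar>\<Sum>u\<in>J a. \<Sum>v\<in>J b. D (u, v) * (\<Prod>e\<in>E. H e (ends (y(b := v, a := u)) e))\<bar> \<le> B"
    if y: "y \<in> PiE ?K J" for y
  proof -
    \<comment> \<open>Extension by zero outside \<open>J a\<close> turns the sum over
      \<open>J a \<times> J b\<close> into one over the full square.\<close>
    define s where "s u = (if u \<in> J a then \<Prod>e\<in>E1. H e (ends (y(a := u)) e) else 0)" for u
    define t where "t v = (if v \<in> J b then \<Prod>e\<in>E - E1. H e (ends (y(b := v)) e) else 0)" for v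
    have yV: "y c \<in> V" if "c \<in> I" "c \<noteq> a" "c \<noteq> b" for c
      using PiE_mem[OF y, of c] that J(1)[of c] by auto
    \<comment> \<open>Pairs increase, so a pair meeting both \<open>a\<close> and \<open>b\<close>
      would be \<open>(a, b)\<close>, which is excluded.\<close>
    have nb: "fst e \<noteq> b" "snd e \<noteq> b" if "e \<in> E1" for e
      using that E ab by (cases e; force simp: E1_def)+
    have mem1: "ends (y(a := u)) e \<in> V \<times> V" if "u \<in> J a" "e \<in> E1" for u e
      using that nb[OF that(2)] E(2)[of e] J(1)[OF ab(1)] yV by (auto simp: E1_def)
    have mem2: "ends (y(b := v)) e \<in> V \<times> V" if "v \<in> J b" "e \<in> E - E1" for v e
      using that E(2)[of e] J(1)[OF ab(2)] yV by (auto simp: E1_def)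
    have s01: "0 \<le> s u \<and> s u \<le> 1" for u
    proof (cases "u \<in> J a")
      case True
      then have "0 \<le> H e (ends (y(a := u)) e) \<and> H e (ends (y(a := u)) e) \<le> 1" if "e \<in> E1" for e
        using H[OF _ mem1[OF True that]] that by (simp add: E1_def)
      then show ?thesis using True by (simp add: s_def prod_nonneg prod_le_1)
    qed (simp add: s_def)
    have t01: "0 \<le> t v \<and> t v \<le> 1" for v
    proof (cases "v \<in> J b")
      case True
      then have "0 \<le> H e (ends (y(b := v)) e) \<and> H e (ends (y(b := v)) e) \<le> 1" if "e \<in> E - E1" for e
        using H[OF _ mem2[OF True that]] that by simp
      then show ?thesis using True by (auto simp: t_def intro!: prod_nonneg prod_le_1)
    qed (simp add: t_def)
    have "(\<Prod>e\<in>E. H e (ends (y(b := v, a := u)) e)) = s u * t v" if "u \<in> J a" "v \<in> J b" for u v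
    proof -
      have "(\<Prod>e\<in>E. H e (ends (y(b := v, a := u)) e)) =
         (\<Prod>e\<in>E1. H e (ends (y(b := v, a := u)) e)) * (\<Prod>e\<in>E - E1. H e (ends (y(b := v, a := u)) e))"
        using E(1) by (subst prod.subset_diff[of E1 E]) (auto simp: E1_def)
      moreover have "(\<Prod>e\<in>E1. H e (ends (y(b := v, a := u)) e)) = s u"
        using that nb unfolding s_def by (auto intro!: prod.cong)
      moreover have "(\<Prod>e\<in>E - E1. H e (ends (y(b := v, a := u)) e)) = t v"
        using that unfolding t_def by (auto simp: E1_def intro!: prod.cong)
      ultimately show ?thesis by simp
    qed
    then have "(\<Sum>u\<in>J a. \<Sum>v\<in>J b. D (u, v) * (\<Prod>e\<in>E. H e (ends (y(b := v, a := u)) e))) =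
       (\<Sum>z\<in>J a \<times> J b. D z * (s (fst z) * t (snd z)))"
      unfolding sum.cartesian_product' by (intro sum.cong refl) simp
    also have "\<dots> = (\<Sum>z\<in>V \<times> V. D z * (s (fst z) * t (snd z)))"
      using V J(1)[OF ab(1)] J(1)[OF ab(2)] by (intro sum.mono_neutral_left) (auto simp: s_def t_def)
    also have "\<bar>\<dots>\<bar> \<le> B" by (rule cut_boundedD[OF D]) (use s01 t01 in auto)
    finally show ?thesis .
  qed
  then have "\<bar>\<Sum>y\<in>PiE ?K J. \<Sum>u\<in>J a. \<Sum>v\<in>J b. D (u, v) * (\<Prod>e\<in>E. H e (ends (y(b := v, a := u)) e))\<bar>
      \<le> (\<Sum>y\<in>PiE ?K J. B)"
    by (rule order_trans[OF sum_abs sum_mono])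
  then show ?thesis
    using ab by (subst sum_PiE_two[of a I b]) (simp_all add: card_K)
qed

text \<open>Replacing \<open>F\<close> by \<open>G\<close> one edge at a time costs one use of
  \<open>counting_one_edge\<close> each. The extra product over \<open>E\<close> strengthens the
  induction: it holds the factors of edges that are already treated.\<close>

lemma counting_hybrid:
  assumes E0: "finite E0" "\<And>e. e \<in> E0 \<Longrightarrow> fst e \<in> I \<and> snd e \<in> I \<and> fst e < snd e"
    and cut: "\<And>e. e \<in> E0 \<Longrightarrow> cut_bounded V (\<lambda>z. F e z - G e z) B"
    and F: "\<And>e z. e \<in> E0 \<Longrightarrow> z \<in> V \<times> V \<Longrightarrow> 0 \<le> F e z \<and> F e z \<le> (1 :: real)"
    and G: "\<And>e z. e \<in> E0 \<Longrightarrow> z \<in> V \<times> V \<Longrightarrow> 0 \<le> G e z \<and> G e z \<le> (1 :: real)"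
    and E: "finite E" "\<And>e. e \<in> E \<Longrightarrow> fst e \<in> I \<and> snd e \<in> I \<and> fst e < snd e" "E \<inter> E0 = {}"
    and H: "\<And>e z. e \<in> E \<Longrightarrow> z \<in> V \<times> V \<Longrightarrow> 0 \<le> H e z \<and> H e z \<le> (1 :: real)"
  shows "\<bar>\<Sum>x\<in>PiE I J. ((\<Prod>e\<in>E0. F e (ends x e)) - (\<Prod>e\<in>E0. G e (ends x e))) * (\<Prod>e\<in>E. H e (ends x e))\<bar>
    \<le> real (card E0) * (real (q ^ (card I - 2)) * B)"
  using assms
proof (induction E0 arbitrary: E H rule: finite_induct)
  case empty
  then show ?case by simp
next
  case (insert e0 E0)
  let ?Q = "real (q ^ (card I - 2)) * B"
  define H1 where "H1 e = (if e \<in> E0 then F e else H e)" for e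
  define H2 where "H2 e = (if e = e0 then G e0 else H e)" for e
  have e0: "e0 \<notin> E" "e0 \<notin> E0" "E \<inter> E0 = {}" using insert by auto
  have 1: "\<bar>\<Sum>x\<in>PiE I J. (F e0 (x (fst e0), x (snd e0)) - G e0 (x (fst e0), x (snd e0))) * (\<Prod>e\<in>E \<union> E0. H1 e (ends x e))\<bar> \<le> ?Q"
  proof (rule counting_one_edge)
    show "cut_bounded V (\<lambda>z. F e0 z - G e0 z) B" using insert.prems(2) by simp
    show "fst e0 \<in> I" "snd e0 \<in> I" "fst e0 < snd e0" using insert.prems(1) by auto
    show "finite (E \<union> E0)" using insert by simp
    show "(fst e0, snd e0) \<notin> E \<union> E0" using e0 by simp
    show "fst e \<in> I \<and> snd e \<in> I \<and> fst e < snd e" if "e \<in> E \<union> E0" for e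
      using that insert.prems(1,6) by blast
    show "0 \<le> H1 e z \<and> H1 e z \<le> 1" if "e \<in> E \<union> E0" "z \<in> V \<times> V" for e z
      using that insert.prems(3)[of e z] insert.prems(8)[of e z] unfolding H1_def by auto
  qed
  have 2: "\<bar>\<Sum>x\<in>PiE I J. ((\<Prod>e\<in>E0. F e (ends x e)) - (\<Prod>e\<in>E0. G e (ends x e))) * (\<Prod>e\<in>insert e0 E. H2 e (ends x e))\<bar>
    \<le> real (card E0) * ?Q"
  proof (rule insert.IH)
    show "0 \<le> H2 e z \<and> H2 e z \<le> 1" if "e \<in> insert e0 E" "z \<in> V \<times> V" for e z
      using that insert.prems(4)[of e0 z] insert.prems(8)[of e z] unfolding H2_def by auto
    show "fst e \<in> I \<and> snd e \<in> I \<and> fst e < snd e" if "e \<in> insert e0 E" for e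
      using that insert.prems(1,6) by blast
  qed (use insert.prems e0 in auto)
  \<comment> \<open>The telescoping identity
    \<open>x * X - y * Y = (x - y) * X + y * (X - Y)\<close> for the new factor and the product over
    the remaining edges.\<close>
  have eq: "((\<Prod>e\<in>insert e0 E0. F e (ends x e)) - (\<Prod>e\<in>insert e0 E0. G e (ends x e))) * (\<Prod>e\<in>E. H e (ends x e)) =
     (F e0 (ends x e0) - G e0 (ends x e0)) * (\<Prod>e\<in>E \<union> E0. H1 e (ends x e)) +
     ((\<Prod>e\<in>E0. F e (ends x e)) - (\<Prod>e\<in>E0. G e (ends x e))) * (\<Prod>e\<in>insert e0 E. H2 e (ends x e))" for x
  proof -
    have "(\<Prod>e\<in>E \<union> E0. H1 e (ends x e)) = (\<Prod>e\<in>E. H1 e (ends x e)) * (\<Prod>e\<in>E0. H1 e (ends x e))"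
      using insert e0 by (intro prod.union_disjoint) auto
    also have "(\<Prod>e\<in>E. H1 e (ends x e)) = (\<Prod>e\<in>E. H e (ends x e))"
      using e0 by (intro prod.cong) (auto simp: H1_def)
    also have "(\<Prod>e\<in>E0. H1 e (ends x e)) = (\<Prod>e\<in>E0. F e (ends x e))"
      by (intro prod.cong) (auto simp: H1_def)
    finally have p1: "(\<Prod>e\<in>E \<union> E0. H1 e (ends x e)) = (\<Prod>e\<in>E. H e (ends x e)) * (\<Prod>e\<in>E0. F e (ends x e))" .
    have "(\<Prod>e\<in>insert e0 E. H2 e (ends x e)) = G e0 (ends x e0) * (\<Prod>e\<in>E. H2 e (ends x e))"
      using insert e0 by (simp add: H2_def)
    also have "(\<Prod>e\<in>E. H2 e (ends x e)) = (\<Prod>e\<in>E. H e (ends x e))"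
      using e0 by (intro prod.cong) (auto simp: H2_def)
    finally have p2: "(\<Prod>e\<in>insert e0 E. H2 e (ends x e)) = G e0 (ends x e0) * (\<Prod>e\<in>E. H e (ends x e))" .
    show ?thesis unfolding p1 p2 using insert by (simp add: algebra_simps)
  qed
  have "\<bar>\<Sum>x\<in>PiE I J. ((\<Prod>e\<in>insert e0 E0. F e (ends x e)) - (\<Prod>e\<in>insert e0 E0. G e (ends x e))) * (\<Prod>e\<in>E. H e (ends x e))\<bar>
      \<le> ?Q + real (card E0) * ?Q"
    unfolding eq sum.distrib using 1 2 by linarith
  then show ?case using insert by (simp add: algebra_simps)
qed

lemma counting_lemma:
  assumes "finite E" "\<And>e. e \<in> E \<Longrightarrow> fst e \<in> I \<and> snd e \<in> I \<and> fst e < snd e"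
    and "\<And>e. e \<in> E \<Longrightarrow> cut_bounded V (\<lambda>z. F e z - G e z) B"
    and "\<And>e z. e \<in> E \<Longrightarrow> z \<in> V \<times> V \<Longrightarrow> 0 \<le> F e z \<and> F e z \<le> (1 :: real)"
    and "\<And>e z. e \<in> E \<Longrightarrow> z \<in> V \<times> V \<Longrightarrow> 0 \<le> G e z \<and> G e z \<le> (1 :: real)"
  shows "\<bar>(\<Sum>x\<in>PiE I J. \<Prod>e\<in>E. F e (ends x e)) - (\<Sum>x\<in>PiE I J. \<Prod>e\<in>E. G e (ends x e))\<bar>
    \<le> real (card E) * (real (q ^ (card I - 2)) * B)"
proof -
  have "\<bar>\<Sum>x\<in>PiE I J. ((\<Prod>e\<in>E. F e (ends x e)) - (\<Prod>e\<in>E. G e (ends x e))) * (\<Prod>e\<in>({} :: (nat \<times> nat) set). 1)\<bar>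
    \<le> real (card E) * (real (q ^ (card I - 2)) * B)"
    by (rule counting_hybrid[where H = "\<lambda>_ _. 1"]) (use assms in auto)
  then show ?thesis by (simp add: sum_subtractf)
qed

end

section \<open>Graphon entropy bounds the extremal entropy from below\<close>

text \<open>Matrix rows are counted from 0 and vertices from 1, hence \<open>Suc\<close>. The
  diagonal colour \<open>d\<close> agrees with the one in \<open>step_graphon\<close>.\<close>

definition colour_matrix :: "nat \<Rightarrow> (nat set \<Rightarrow> nat) \<Rightarrow> nat \<times> nat \<Rightarrow> nat" where
  "colour_matrix d c z = (if fst z = snd z then d else c {Suc (fst z), Suc (snd z)})"

section \<open>Edges as increasing pairs, templates and induced colourings\<close>

definition pairs :: "nat \<Rightarrow> (nat \<times> nat) set" where
  "pairs m = {p \<in> {1..m} \<times> {1..m}. fst p < snd p}"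

lemma pairsD: "e \<in> pairs m \<Longrightarrow> fst e \<in> {1..m} \<and> snd e \<in> {1..m} \<and> fst e < snd e"
  by (auto simp: pairs_def)

lemma finite_pairs [simp]: "finite (pairs m)"
  by (rule finite_subset[of _ "{1..m} \<times> {1..m}"]) (auto simp: pairs_def)

lemma finite_edges [simp]: "finite (edges n)"
  by (rule finite_subset[of _ "Pow {1..n}"]) (auto simp: edges_def)

lemma card_edges: "card (edges n) = n choose 2"
  unfolding edges_def using n_subsets[of "{1..n}" 2] by simp

lemma edge_pairE:
  assumes "e \<in> edges m"
  obtains a b where "(a, b) \<in> pairs m" "e = {a, b}"
proof -
  obtain x y where xy: "e = {x, y}" "x \<noteq> y" "x \<in> {1..m}" "y \<in> {1..m}"
    using assms unfolding edges_def card_2_iff by blast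
  show ?thesis
  proof (cases "x < y")
    case True
    then show ?thesis using xy by (intro that[of x y]) (auto simp: pairs_def)
  next
    case False
    then show ?thesis using xy by (intro that[of y x]) (auto simp: pairs_def)
  qed
qed

lemma pair_edge: "(a, b) \<in> pairs m \<Longrightarrow> {a, b} \<in> edges m"
  by (auto simp: pairs_def edges_def)

lemma bij_pairs_edges: "bij_betw (\<lambda>(a, b). {a, b}) (pairs m) (edges m)"
proof (rule bij_betw_imageI)
  show "inj_on (\<lambda>(a, b). {a, b}) (pairs m)"
    by (auto simp: inj_on_def pairs_def doubleton_eq_iff)
  show "(\<lambda>(a, b). {a, b}) ` pairs m = edges m"
  proof (intro equalityI subsetI)
    fix e assume "e \<in> edges m"
    then obtain a b where "(a, b) \<in> pairs m" "e = {a, b}" by (rule edge_pairE)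
    then show "e \<in> (\<lambda>(a, b). {a, b}) ` pairs m" by (intro image_eqI[of _ _ "(a, b)"]) auto
  qed (auto intro: pair_edge)
qed

lemma card_pairs: "card (pairs m) = m choose 2"
  using bij_betw_same_card[OF bij_pairs_edges] by (simp add: card_edges)

lemma ball_edges_iff: "(\<forall>e\<in>edges m. Q e) \<longleftrightarrow> (\<forall>(a, b)\<in>pairs m. Q {a, b})"
  by (blast intro: pair_edge elim: edge_pairE)

lemma sum_edges: "(\<Sum>e\<in>edges m. f e) = (\<Sum>(a, b)\<in>pairs m. f {a, b})"
  by (subst sum.reindex_bij_betw[OF bij_pairs_edges, symmetric]) (simp add: case_prod_beta)

lemma finite_colourings: "finite (colourings k n)"
  by (simp add: colourings_def finite_PiE)

lemma card_colourings: "card (colourings k n) = k ^ (n choose 2)"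
  by (simp add: colourings_def card_PiE card_edges)

lemma finite_templates: "finite (templates k n)"
  unfolding templates_def by (rule finite_PiE) (auto intro: finite_subset[of _ "Pow {1..k}"])

lemma template_entropy_le_extremal:
  assumes "t \<in> templates k m" "realisations k m t \<subseteq> P m"
  shows "template_entropy k m t \<le> extremal_entropy k m P"
  unfolding extremal_entropy_def using assms finite_templates[of k m]
  by (intro Max_ge) auto

lemma singleton_template:
  assumes "c \<in> colourings k n"
  shows "(\<lambda>e\<in>edges n. {c e}) \<in> templates k n" and "realisations k n (\<lambda>e\<in>edges n. {c e}) \<subseteq> {c}"
  using assms by (auto simp: templates_def realisations_def colourings_def intro!: PiE_ext[of _ "edges n"])

text \<open>An increasing \<open>x\<close> lists the vertex set it hits in sorted order, so
  \<open>H\<close> is exactly the colouring that \<open>c\<close> induces there.\<close>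

lemma induced_increasing:
  assumes c: "order_hereditary k P" "c \<in> P n"
    and x: "\<And>a b. 1 \<le> a \<Longrightarrow> a < b \<Longrightarrow> b \<le> m \<Longrightarrow> x a < x b" "\<And>a. a \<in> {1..m} \<Longrightarrow> x a < n"
    and H: "H \<in> colourings k m" "\<And>a b. (a, b) \<in> pairs m \<Longrightarrow> c {Suc (x a), Suc (x b)} = H {a, b}"
  shows "H \<in> P m"
proof -
  define xs where "xs = map (\<lambda>a. Suc (x a)) [1..<Suc m]"
  have nth: "xs ! (a - 1) = Suc (x a)" if "a \<in> {1..m}" for a
    using that by (auto simp: xs_def nth_append simp del: upt_Suc)
  have sorted: "sorted_wrt (<) xs"
    unfolding xs_def sorted_wrt_map
    by (rule sorted_wrt_mono_rel[OF _ sorted_wrt_upt]) (use x(1) in auto)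
  define A where "A = set xs"
  have sd: "sorted xs" "distinct xs" using sorted by (simp_all add: strict_sorted_iff)
  have "sorted_list_of_set A = xs"
    unfolding A_def by (rule sorted_list_of_set.idem_if_sorted_distinct[OF sd])
  moreover have "A \<subseteq> {1..n}"
    by (auto simp: A_def xs_def simp del: upt_Suc intro!: Suc_leI x(2))
  moreover have "card A = m"
    using sd by (simp add: A_def distinct_card) (simp add: xs_def)
  ultimately have mem: "(\<lambda>e\<in>edges m. c ((\<lambda>i. xs ! (i - 1)) ` e)) \<in> P m"
    using c unfolding order_hereditary_def induced_def by metis
  have "(\<lambda>e\<in>edges m. c ((\<lambda>i. xs ! (i - 1)) ` e)) = H"
  proof (rule extensionalityI[of _ "edges m"])
    show "H \<in> extensional (edges m)" using H(1) by (auto simp: colourings_def PiE_def)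
    have "\<forall>e\<in>edges m. c ((\<lambda>i. xs ! (i - 1)) ` e) = H e"
      unfolding ball_edges_iff
    proof (clarify)
      fix a b assume ab: "(a, b) \<in> pairs m"
      then have "xs ! (a - 1) = Suc (x a)" "xs ! (b - 1) = Suc (x b)" using pairsD[OF ab] nth[of a] nth[of b] by auto
      then show "c ((\<lambda>i. xs ! (i - 1)) ` {a, b}) = H {a, b}" using H(2)[OF ab] by simp
    qed
    then show "(\<lambda>e\<in>edges m. c ((\<lambda>i. xs ! (i - 1)) ` e)) e = H e" if "e \<in> edges m" for e
      using that by simp
  qed auto
  then show ?thesis using mem by simp
qed

text \<open>The samples are drawn from consecutive intervals of vertices, so that they automatically
  come in increasing order.\<close>

lemma extremal_entropy_lower_bound:
  fixes w :: "nat \<Rightarrow> nat \<times> nat \<Rightarrow> real"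
  assumes k: "k \<ge> 2" and P: "order_hereditary k P" and c: "c \<in> P n"
    and m: "m \<ge> 2" and n: "n \<ge> m" and eps: "0 < \<epsilon>" "\<epsilon> < 1 / real k" and \<delta>: "0 \<le> \<delta>"
    and w: "\<And>i z. i \<in> {1..k} \<Longrightarrow> z \<in> {..<n} \<times> {..<n} \<Longrightarrow> 0 \<le> w i z"
      "\<And>z. z \<in> {..<n} \<times> {..<n} \<Longrightarrow> (\<Sum>i=1..k. w i z) = 1"
      "\<And>i u v. i \<in> {1..k} \<Longrightarrow> u < n \<Longrightarrow> v < n \<Longrightarrow> w i (u, v) = w i (v, u)"
    and cut: "\<And>i. i \<in> {1..k} \<Longrightarrow>
      cut_bounded {..<n} (\<lambda>z. of_bool (colour_matrix d c z = i) - w i z) (\<delta> * (real n)\<^sup>2)"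
  defines "N \<equiv> m choose 2" and "q \<equiv> n div m"
  shows "(real m)\<^sup>2 / 2 * ((\<Sum>z\<in>{..<n} \<times> {..<n}. entropy_fun k (\<lambda>i. w i z)) / (real n)\<^sup>2)
      - real m / 2 - 2 * (real m)\<^sup>2 / real q - real N * (3 * real k * sqrt \<epsilon> / ln (real k))
      - 4 * (real m)\<^sup>2 * real k ^ N * (real N)\<^sup>2 * \<delta> / \<epsilon> ^ N \<le> extremal_entropy k m P"
proof -
  let ?V = "{..<n}" and ?I = "{1..m}"
  define J where "J a = {(a - 1) * q..<a * q}" for a
  define \<eta> where "\<eta> = 3 * real k * sqrt \<epsilon> / ln (real k)"
  have q: "q > 0" unfolding q_def using n m by (simp add: div_greater_zero_iff)
  have mq: "m * q \<le> n" unfolding q_def by simp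
  have n_le: "n < m * q + m"
  proof -
    have "n = m * q + n mod m" unfolding q_def by simp
    then show ?thesis using m by (metis add_less_cancel_left mod_less_divisor pos2 order_less_le_trans)
  qed
  interpret sampling ?V ?I J q
  proof
    show "J a \<subseteq> ?V" if "a \<in> ?I" for a
    proof -
      have "a * q \<le> m * q" using that by simp
      then have "a * q \<le> n" using mq by (rule order_trans)
      then show ?thesis by (auto simp: J_def)
    qed
    show "card (J a) = q" if "a \<in> ?I" for a
      using that by (cases a) (auto simp: J_def)
  qed auto
  let ?X = "PiE ?I J" and ?E = "pairs m"
  have card_X: "card ?X = q ^ m" using card_PiE_J[of ?I] by simp
  have finX: "finite ?X" using finite_J by (intro finite_PiE) auto
  have N: "card ?E = N" by (simp add: card_pairs N_def)
  have incr: "x a < x b" if "x \<in> ?X" "1 \<le> a" "a < b" "b \<le> m" for x a b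
  proof -
    have "x a < a * q" using PiE_mem[OF that(1), of a] that by (simp add: J_def)
    also have "\<dots> \<le> (b - 1) * q" using that by (intro mult_le_mono1) simp
    also have "\<dots> \<le> x b" using PiE_mem[OF that(1), of b] that by (simp add: J_def)
    finally show ?thesis .
  qed
  have ends_V: "ends x e \<in> ?V \<times> ?V" if "x \<in> ?X" "e \<in> ?E" for x e
    using that by (intro ends_mem) (auto dest: pairsD)
  have w1: "w i z \<le> 1" if "i \<in> {1..k}" "z \<in> ?V \<times> ?V" for i z
    using member_le_sum[of i "{1..k}" "\<lambda>i. w i z"] that w(1,2) by auto
  \<comment> \<open>\<open>Min\<close> and \<open>Max\<close> recover the increasing pair from an
    edge. Dropping the colours of density at most \<open>\<epsilon>\<close> costs entropy at most
    \<open>\<eta>\<close> per edge and leaves every realisation with weight at least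
    \<open>\<epsilon> ^ N\<close>.\<close>
  define t where "t x = (\<lambda>e\<in>edges m. {i\<in>{1..k}. w i (x (Min e), x (Max e)) > \<epsilon>})" for x
  have t_pair: "t x {fst e, snd e} = {i\<in>{1..k}. w i (ends x e) > \<epsilon>}" if "e \<in> ?E" for x e
  proof -
    have "{fst e, snd e} \<in> edges m" using that by (auto simp: pairs_def edges_def)
    moreover have "Min {fst e, snd e} = fst e" "Max {fst e, snd e} = snd e" using pairsD[OF that] by auto
    ultimately show ?thesis by (simp add: t_def)
  qed
  have t_entropy: "template_entropy k m (t x) = (\<Sum>e\<in>?E. log (real k) (real (card {i\<in>{1..k}. w i (ends x e) > \<epsilon>})))" for x
    unfolding template_entropy_def sum_edges by (intro sum.cong) (auto simp: t_pair[of "(_, _)", simplified])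
  have t_temp: "t x \<in> templates k m" if x: "x \<in> ?X" for x
  proof -
    have ne: "t x {fst e, snd e} \<noteq> {}" if "e \<in> ?E" for e
      unfolding t_pair[OF that] using entropy_fun_le_log_card(1)[OF k, of "\<lambda>i. w i (ends x e)" \<epsilon>] w(1,2) eps ends_V[OF x that] by simp
    have "\<forall>e\<in>edges m. t x e \<noteq> {}" unfolding ball_edges_iff using ne by auto
    moreover have "t x e \<subseteq> {1..k}" if "e \<in> edges m" for e using that by (auto simp: t_def)
    moreover have "t x e = undefined" if "e \<notin> edges m" for e using that by (simp add: t_def)
    ultimately show ?thesis unfolding templates_def by (intro PiE_I) auto
  qed
  \<comment> \<open>The samples whose template has \<open>H\<close> among its realisations.\<close>
  define bad where "bad H = {x \<in> ?X. \<forall>e\<in>?E. w (H {fst e, snd e}) (ends x e) > \<epsilon>}" for H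
  let ?B = "real N * (real (q ^ (m - 2)) * (\<delta> * (real n)\<^sup>2))"
  have bad_le: "real (card (bad H)) * \<epsilon> ^ N \<le> ?B" if H: "H \<in> colourings k m" "H \<notin> P m" for H
  proof -
    have Hk: "H {fst e, snd e} \<in> {1..k}" if "e \<in> ?E" for e
    proof -
      have "{fst e, snd e} \<in> edges m" using that by (auto simp: pairs_def edges_def)
      then show ?thesis using H(1) by (auto simp: colourings_def)
    qed
    \<comment> \<open>A sample showing \<open>H\<close> inside \<open>c\<close> would put
      \<open>H\<close> into \<open>P m\<close>. So a forbidden \<open>H\<close> has exact count 0,
      and the counting lemma bounds its weighted count by the error alone.\<close>
    have zero: "(\<Prod>e\<in>?E. of_bool (colour_matrix d c (ends x e) = H {fst e, snd e})) = (0 :: real)" if x: "x \<in> ?X" for x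
    proof (rule ccontr)
      assume "(\<Prod>e\<in>?E. of_bool (colour_matrix d c (ends x e) = H {fst e, snd e})) \<noteq> (0 :: real)"
      then have all: "colour_matrix d c (ends x e) = H {fst e, snd e}" if "e \<in> ?E" for e
        using that by (auto simp: prod_zero_iff)
      have "H \<in> P m"
      proof (rule induced_increasing[OF P c, where x = x])
        show "x a < x b" if "1 \<le> a" "a < b" "b \<le> m" for a b using incr[OF x that] .
        show "x a < n" if "a \<in> ?I" for a using PiE_mem[OF x that] J(1)[OF that] by auto
        show "c {Suc (x a), Suc (x b)} = H {a, b}" if "(a, b) \<in> pairs m" for a b
          using all[OF that] incr[OF x, of a b] pairsD[OF that] by (simp add: colour_matrix_def)
      qed (fact H(1))
      then show False using H(2) by contradiction
    qed
    have "\<bar>(\<Sum>x\<in>?X. \<Prod>e\<in>?E. of_bool (colour_matrix d c (ends x e) = H {fst e, snd e})) -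
        (\<Sum>x\<in>?X. \<Prod>e\<in>?E. w (H {fst e, snd e}) (ends x e))\<bar> \<le> real (card ?E) * (real (q ^ (card ?I - 2)) * (\<delta> * (real n)\<^sup>2))"
      by (rule counting_lemma[where F = "\<lambda>e z. of_bool (colour_matrix d c z = H {fst e, snd e})" and G = "\<lambda>e. w (H {fst e, snd e})"])
        (use Hk cut w1 w(1) in \<open>auto dest: pairsD\<close>)
    then have sum_le: "(\<Sum>x\<in>?X. \<Prod>e\<in>?E. w (H {fst e, snd e}) (ends x e)) \<le> ?B"
      using zero by (simp add: N)
    \<comment> \<open>Markov's inequality: each bad sample contributes at least
      \<open>\<epsilon> ^ N\<close> to the weighted count.\<close>
    have "real (card (bad H)) * \<epsilon> ^ N = (\<Sum>x\<in>bad H. \<Prod>e\<in>?E. \<epsilon>)" by (simp add: N)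
    also have "\<dots> \<le> (\<Sum>x\<in>bad H. \<Prod>e\<in>?E. w (H {fst e, snd e}) (ends x e))"
      using eps by (intro sum_mono prod_mono) (auto simp: bad_def intro: less_imp_le)
    also have "\<dots> \<le> (\<Sum>x\<in>?X. \<Prod>e\<in>?E. w (H {fst e, snd e}) (ends x e))"
      using finX Hk w(1) ends_V by (intro sum_mono2 prod_nonneg) (auto simp: bad_def)
    finally show ?thesis using sum_le by simp
  qed
  \<comment> \<open>A union bound over the forbidden colourings costs a factor \<open>k ^ N\<close>,
    which depends on \<open>m\<close> but not on \<open>n\<close>.\<close>
  define Bad where "Bad = (\<Union>H\<in>colourings k m - P m. bad H)"
  have "Bad \<subseteq> ?X" by (auto simp: Bad_def bad_def)
  have B0: "0 \<le> ?B" using \<delta> by simp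
  have card_Bad: "real (card Bad) \<le> real k ^ N * (?B / \<epsilon> ^ N)"
  proof -
    have "real (card Bad) \<le> (\<Sum>H\<in>colourings k m - P m. real (card (bad H)))"
      unfolding Bad_def of_nat_sum[symmetric] of_nat_le_iff by (rule card_UN_le) (simp add: finite_colourings)
    also have "\<dots> \<le> (\<Sum>H\<in>colourings k m - P m. ?B / \<epsilon> ^ N)"
      using bad_le eps by (intro sum_mono) (simp add: pos_le_divide_eq)
    also have "\<dots> = real (card (colourings k m - P m)) * (?B / \<epsilon> ^ N)" by simp
    also have "\<dots> \<le> real (k ^ N) * (?B / \<epsilon> ^ N)"
      using card_mono[OF finite_colourings[of k m], of "colourings k m - P m"] B0 eps
      by (intro mult_right_mono) (auto simp: card_colourings N_def)
    finally show ?thesis by simp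
  qed
  have good: "template_entropy k m (t x) \<le> extremal_entropy k m P" if "x \<in> ?X - Bad" for x
  proof (rule template_entropy_le_extremal)
    show "realisations k m (t x) \<subseteq> P m"
    proof
      fix H assume H: "H \<in> realisations k m (t x)"
      then have col: "H \<in> colourings k m" and all: "\<forall>e\<in>edges m. H e \<in> t x e" by (auto simp: realisations_def)
      have "H {fst e, snd e} \<in> t x {fst e, snd e}" if "e \<in> ?E" for e
        using all that by (auto simp: pairs_def edges_def)
      then have "w (H {fst e, snd e}) (ends x e) > \<epsilon>" if "e \<in> ?E" for e
        using that t_pair[OF that, of x] by auto
      then have "x \<in> bad H" using that by (simp add: bad_def)
      then show "H \<in> P m" using that col by (auto simp: Bad_def)
    qed
  qed (use that t_temp in auto)
  have t_le_N: "template_entropy k m (t x) \<le> N" if "x \<in> ?X" for x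
  proof -
    have "template_entropy k m (t x) \<le> (\<Sum>e\<in>edges m. 1)"
      unfolding template_entropy_def
    proof (rule sum_mono)
      fix e assume "e \<in> edges m"
      then have sub: "t x e \<subseteq> {1..k}" "t x e \<noteq> {}" using t_temp[OF that] by (auto simp: templates_def)
      then have "card (t x e) \<le> k" "0 < card (t x e)"
        using card_mono[of "{1..k}" "t x e"] finite_subset[of "t x e" "{1..k}"] by (auto simp: card_gt_0_iff)
      then have "log (real k) (real (card (t x e))) \<le> log (real k) (real k)" using k by (intro log_mono) auto
      then show "log (real k) (real (card (t x e))) \<le> 1" using k by simp
    qed
    then show ?thesis by (simp add: card_edges N_def)
  qed
  obtain c0 where c0: "c0 \<in> P m"
  proof -
    have "{1..m} \<subseteq> {1..n}" using n by auto
    then have "induced c {1..m} \<in> P (card {1..m})" using P c unfolding order_hereditary_def by blast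
    then show ?thesis using that by simp
  qed
  \<comment> \<open>The sign permits replacing the number of good samples by the number of all
    samples below.\<close>
  have ex0: "0 \<le> extremal_entropy k m P"
  proof -
    have "c0 \<in> colourings k m" using c0 P by (auto simp: order_hereditary_def)
    from singleton_template[OF this]
    have "template_entropy k m (\<lambda>e\<in>edges m. {c0 e}) \<le> extremal_entropy k m P"
      using c0 by (intro template_entropy_le_extremal) auto
    then show ?thesis by (simp add: template_entropy_def)
  qed
  have upper: "(\<Sum>x\<in>?X. template_entropy k m (t x)) \<le> real (q ^ m) * extremal_entropy k m P + real (card Bad) * N"
  proof -
    have "(\<Sum>x\<in>?X. template_entropy k m (t x)) = (\<Sum>x\<in>?X - Bad. template_entropy k m (t x)) + (\<Sum>x\<in>Bad. template_entropy k m (t x))"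
      using finX \<open>Bad \<subseteq> ?X\<close> by (rule sum.subset_diff[rotated])
    also have "\<dots> \<le> real (card (?X - Bad)) * extremal_entropy k m P + real (card Bad) * N"
      using good t_le_N \<open>Bad \<subseteq> ?X\<close> by (intro add_mono sum_bounded_above) auto
    also have "real (card (?X - Bad)) * extremal_entropy k m P \<le> real (card ?X) * extremal_entropy k m P"
      using finX ex0 by (intro mult_right_mono of_nat_mono card_mono) auto
    finally show ?thesis unfolding card_X by simp
  qed
  define h where "h z = entropy_fun k (\<lambda>i. w i z)" for z
  have h_le: "h z \<le> log (real k) (real (card {i\<in>{1..k}. w i z > \<epsilon>})) + \<eta>" if "z \<in> ?V \<times> ?V" for z
    unfolding h_def \<eta>_def using that w(1,2) eps by (intro entropy_fun_le_log_card(2)[OF k]) auto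
  have h1: "h z \<le> 1" if "z \<in> ?V \<times> ?V" for z
    unfolding h_def using that w(1,2) by (intro entropy_fun_le_1[OF k]) auto
  have h0: "0 \<le> h z" if "z \<in> ?V \<times> ?V" for z
    unfolding h_def using that w(1) w1 by (intro entropy_fun_nonneg[OF k]) auto
  let ?Q = "real (q ^ (m - 2))"
  let ?HE = "\<Sum>e\<in>?E. \<Sum>z\<in>J (fst e) \<times> J (snd e). h z"
  have JV: "J (fst e) \<times> J (snd e) \<subseteq> ?V \<times> ?V" if "e \<in> ?E" for e
    using pairsD[OF that] J(1) by blast
  \<comment> \<open>Linearity of expectation: the mean template entropy is a sum over edges, and an
    edge sees a uniform point of the rectangle spanned by its two intervals.\<close>
  have lower: "?Q * (?HE - N * (real q)\<^sup>2 * \<eta>) \<le> (\<Sum>x\<in>?X. template_entropy k m (t x))"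
  proof -
    have "?HE - N * (real q)\<^sup>2 * \<eta> = (\<Sum>e\<in>?E. \<Sum>z\<in>J (fst e) \<times> J (snd e). h z - \<eta>)"
    proof -
      have "real (card (J (fst e) \<times> J (snd e))) = (real q)\<^sup>2" if "e \<in> ?E" for e
        using pairsD[OF that] J(2) by (simp add: card_cartesian_product power2_eq_square)
      then have "(\<Sum>e\<in>?E. real (card (J (fst e) \<times> J (snd e))) * \<eta>) = N * (real q)\<^sup>2 * \<eta>" by (simp add: N)
      then show ?thesis by (simp add: sum_subtractf)
    qed
    also have "\<dots> \<le> (\<Sum>e\<in>?E. \<Sum>z\<in>J (fst e) \<times> J (snd e). log (real k) (real (card {i\<in>{1..k}. w i z > \<epsilon>})))"
    proof (intro sum_mono)
      fix e z assume "e \<in> ?E" "z \<in> J (fst e) \<times> J (snd e)"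
      then have "z \<in> ?V \<times> ?V" using JV by blast
      from h_le[OF this] show "h z - \<eta> \<le> log (real k) (real (card {i\<in>{1..k}. w i z > \<epsilon>}))" by simp
    qed
    finally have "?Q * (?HE - N * (real q)\<^sup>2 * \<eta>) \<le>
       (\<Sum>e\<in>?E. ?Q * (\<Sum>z\<in>J (fst e) \<times> J (snd e). log (real k) (real (card {i\<in>{1..k}. w i z > \<epsilon>}))))"
      unfolding sum_distrib_left[symmetric] by (intro mult_left_mono) auto
    also have "\<dots> = (\<Sum>e\<in>?E. \<Sum>x\<in>?X. log (real k) (real (card {i\<in>{1..k}. w i (ends x e) > \<epsilon>})))"
    proof (intro sum.cong refl)
      fix e assume "e \<in> ?E"
      from pairsD[OF this] sum_one_pair[of "fst e" "snd e" "\<lambda>z. log (real k) (real (card {i\<in>{1..k}. w i z > \<epsilon>}))"]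
      show "?Q * (\<Sum>z\<in>J (fst e) \<times> J (snd e). log (real k) (real (card {i\<in>{1..k}. w i z > \<epsilon>}))) =
        (\<Sum>x\<in>?X. log (real k) (real (card {i\<in>{1..k}. w i (ends x e) > \<epsilon>})))" by simp
    qed
    also have "\<dots> = (\<Sum>x\<in>?X. template_entropy k m (t x))" unfolding t_entropy by (rule sum.swap)
    finally show ?thesis .
  qed
  have Q: "?Q > 0" using q by simp
  have qm: "real (q ^ m) = ?Q * (real q)\<^sup>2"
  proof -
    have "m = (m - 2) + 2" using m by simp
    then have "q ^ m = q ^ ((m - 2) + 2)" by (rule arg_cong)
    then show ?thesis by (simp only: power_add of_nat_mult of_nat_power)
  qed
  have main: "?HE - N * (real q)\<^sup>2 * \<eta> \<le> (real q)\<^sup>2 * extremal_entropy k m P + real k ^ N * (real N)\<^sup>2 * \<delta> * (real n)\<^sup>2 / \<epsilon> ^ N"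
  proof -
    have "real (card Bad) * N \<le> real k ^ N * (?B / \<epsilon> ^ N) * N"
      using card_Bad by (intro mult_right_mono) auto
    also have "\<dots> = ?Q * (real k ^ N * (real N)\<^sup>2 * \<delta> * (real n)\<^sup>2 / \<epsilon> ^ N)"
      by (simp add: power2_eq_square)
    finally have "?Q * (?HE - N * (real q)\<^sup>2 * \<eta>) \<le> ?Q * ((real q)\<^sup>2 * extremal_entropy k m P + real k ^ N * (real N)\<^sup>2 * \<delta> * (real n)\<^sup>2 / \<epsilon> ^ N)"
      using lower upper unfolding qm by (simp add: distrib_left mult.assoc)
    then show ?thesis using Q by simp
  qed
  \<comment> \<open>By symmetry the off-diagonal rectangles give \<open>?HE\<close> twice. As
    entropy is at most 1, the \<open>m\<close> diagonal squares give at most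
    \<open>q\<^sup>2\<close> each, and the fewer than \<open>m\<close> vertices outside the
    intervals at most \<open>2 * n * m\<close> in total.\<close>
  have HE: "(\<Sum>z\<in>?V \<times> ?V. h z) \<le> 2 * ?HE + m * (real q)\<^sup>2 + 2 * real n * m"
  proof -
    let ?U = "{..<m * q}"
    have sub: "?U \<times> ?U \<subseteq> ?V \<times> ?V" using mq by auto
    have s1: "(\<Sum>z\<in>?V \<times> ?V. h z) = (\<Sum>z\<in>?V \<times> ?V - ?U \<times> ?U. h z) + (\<Sum>z\<in>?U \<times> ?U. h z)"
      by (rule sum.subset_diff[OF sub]) auto
    have "(\<Sum>z\<in>?V \<times> ?V - ?U \<times> ?U. h z) \<le> real (card (?V \<times> ?V - ?U \<times> ?U)) * 1"
      by (rule sum_bounded_above) (use h1 in auto)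
    also have "real (card (?V \<times> ?V - ?U \<times> ?U)) = (real n)\<^sup>2 - (real (m * q))\<^sup>2"
      using sub mq by (subst card_Diff_subset) (auto simp: card_cartesian_product power2_eq_square of_nat_diff mult_le_mono)
    also have "\<dots> \<le> 2 * real n * m"
    proof -
      have "(real n)\<^sup>2 - (real (m * q))\<^sup>2 = (real n + real (m * q)) * (real n - real (m * q))"
        by (simp add: power2_eq_square algebra_simps)
      also have "\<dots> \<le> (2 * real n) * real m"
        using mq n_le by (intro mult_mono) linarith+
      finally show ?thesis .
    qed
    finally have s2: "(\<Sum>z\<in>?V \<times> ?V - ?U \<times> ?U. h z) \<le> 2 * real n * m" by simp
    have "(\<Sum>z\<in>?U \<times> ?U. h z) = (\<Sum>a\<in>?I. \<Sum>b\<in>?I. \<Sum>z\<in>J a \<times> J b. h z)"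
    proof -
      have U: "?U = (\<Union>a\<in>?I. J a)"
      proof (intro equalityI subsetI)
        fix u assume "u \<in> ?U"
        then have "u div q + 1 \<in> ?I" using q by (auto simp: less_mult_imp_div_less Suc_le_eq)
        moreover have "u \<in> J (u div q + 1)"
        proof -
          have "u = u div q * q + u mod q" "u mod q < q" using q by simp_all
          then have "u div q * q \<le> u" "u < u div q * q + q" by linarith+
          then show ?thesis by (simp add: J_def)
        qed
        ultimately show "u \<in> (\<Union>a\<in>?I. J a)" by blast
      next
        fix u assume "u \<in> (\<Union>a\<in>?I. J a)"
        then obtain a where a: "a \<le> m" "u < a * q" by (auto simp: J_def)
        have "u < m * q" using a(2) mult_le_mono1[OF a(1)] by (rule less_le_trans)
        then show "u \<in> ?U" by simp
      qed
      have disj: "J a \<inter> J b = {}" if "a \<in> ?I" "b \<in> ?I" "a \<noteq> b" for a b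
      proof -
        have *: "J a \<inter> J b = {}" if "a < b" for a b
        proof -
          have "a * q \<le> (b - 1) * q" using that by (intro mult_le_mono1) simp
          then show ?thesis by (auto simp: J_def)
        qed
        show ?thesis using *[of a b] *[of b a] that by (cases "a < b") auto
      qed
      have one: "(\<Sum>u\<in>?U. f u) = (\<Sum>a\<in>?I. \<Sum>u\<in>J a. f u)" for f :: "nat \<Rightarrow> real"
        unfolding U using disj by (intro sum.UNION_disjoint) (auto simp: finite_J)
      have "(\<Sum>z\<in>?U \<times> ?U. h z) = (\<Sum>a\<in>?I. \<Sum>u\<in>J a. \<Sum>b\<in>?I. \<Sum>v\<in>J b. h (u, v))"
        unfolding sum.cartesian_product' one ..
      also have "\<dots> = (\<Sum>a\<in>?I. \<Sum>b\<in>?I. \<Sum>u\<in>J a. \<Sum>v\<in>J b. h (u, v))"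
        by (intro sum.cong refl sum.swap)
      finally show ?thesis unfolding sum.cartesian_product' .
    qed
    also have "\<dots> = (\<Sum>p\<in>?I \<times> ?I. \<Sum>z\<in>J (fst p) \<times> J (snd p). h z)"
      unfolding sum.cartesian_product'[of _ ?I] by simp
    also have "\<dots> = ?HE + (\<Sum>p\<in>{p\<in>?I \<times> ?I. snd p < fst p}. \<Sum>z\<in>J (fst p) \<times> J (snd p). h z)
        + (\<Sum>p\<in>{p\<in>?I \<times> ?I. fst p = snd p}. \<Sum>z\<in>J (fst p) \<times> J (snd p). h z)"
    proof -
      have "?I \<times> ?I = ?E \<union> {p\<in>?I \<times> ?I. snd p < fst p} \<union> {p\<in>?I \<times> ?I. fst p = snd p}"
        by (auto simp: pairs_def)
      then have "(\<Sum>p\<in>?I \<times> ?I. f p) = (\<Sum>p\<in>?E \<union> {p\<in>?I \<times> ?I. snd p < fst p} \<union> {p\<in>?I \<times> ?I. fst p = snd p}. f p)" for f :: "_ \<Rightarrow> real"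
        by simp
      moreover have "(\<Sum>p\<in>?E \<union> {p\<in>?I \<times> ?I. snd p < fst p} \<union> {p\<in>?I \<times> ?I. fst p = snd p}. f p) =
        (\<Sum>p\<in>?E. f p) + (\<Sum>p\<in>{p\<in>?I \<times> ?I. snd p < fst p}. f p) + (\<Sum>p\<in>{p\<in>?I \<times> ?I. fst p = snd p}. f p)" for f :: "_ \<Rightarrow> real"
        by (subst sum.union_disjoint; (subst sum.union_disjoint)?) (auto simp: pairs_def)
      ultimately show ?thesis by simp
    qed
    finally have s3: "(\<Sum>z\<in>?U \<times> ?U. h z) = ?HE + (\<Sum>p\<in>{p\<in>?I \<times> ?I. snd p < fst p}. \<Sum>z\<in>J (fst p) \<times> J (snd p). h z)
        + (\<Sum>p\<in>{p\<in>?I \<times> ?I. fst p = snd p}. \<Sum>z\<in>J (fst p) \<times> J (snd p). h z)" .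
    have s4: "(\<Sum>p\<in>{p\<in>?I \<times> ?I. snd p < fst p}. \<Sum>z\<in>J (fst p) \<times> J (snd p). h z) = ?HE"
    proof (rule sum.reindex_bij_witness[of _ "\<lambda>p. (snd p, fst p)" "\<lambda>p. (snd p, fst p)"])
      fix p assume p: "p \<in> {p\<in>?I \<times> ?I. snd p < fst p}"
      show "(\<Sum>z\<in>J (fst (snd p, fst p)) \<times> J (snd (snd p, fst p)). h z) = (\<Sum>z\<in>J (fst p) \<times> J (snd p). h z)"
      proof (rule sum.reindex_bij_witness[of _ "\<lambda>z. (snd z, fst z)" "\<lambda>z. (snd z, fst z)"])
        fix z assume "z \<in> J (fst (snd p, fst p)) \<times> J (snd (snd p, fst p))"
        then have "fst z < n" "snd z < n" using p J(1)[of "fst p"] J(1)[of "snd p"] by auto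
        then show "h (snd z, fst z) = h z"
          unfolding h_def entropy_fun_def using w(3)[of _ "fst z" "snd z"] by (cases z) (auto intro!: sum.cong)
      qed auto
    qed (auto simp: pairs_def)
    have s5: "(\<Sum>p\<in>{p\<in>?I \<times> ?I. fst p = snd p}. \<Sum>z\<in>J (fst p) \<times> J (snd p). h z) \<le> m * (real q)\<^sup>2"
    proof -
      have "(\<Sum>p\<in>{p\<in>?I \<times> ?I. fst p = snd p}. \<Sum>z\<in>J (fst p) \<times> J (snd p). h z) \<le> real (card {p\<in>?I \<times> ?I. fst p = snd p}) * (real q)\<^sup>2"
      proof (rule sum_bounded_above)
        fix p assume p: "p \<in> {p\<in>?I \<times> ?I. fst p = snd p}"
        have "(\<Sum>z\<in>J (fst p) \<times> J (snd p). h z) \<le> real (card (J (fst p) \<times> J (snd p))) * 1"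
          using p J(1)[of "fst p"] by (intro sum_bounded_above h1) auto
        then show "(\<Sum>z\<in>J (fst p) \<times> J (snd p). h z) \<le> (real q)\<^sup>2"
          using p J(2) by (auto simp: card_cartesian_product power2_eq_square)
      qed
      moreover have "{p\<in>?I \<times> ?I. fst p = snd p} = (\<lambda>a. (a, a)) ` ?I" by auto
      then have "card {p\<in>?I \<times> ?I. fst p = snd p} = card ?I" by (simp add: card_image inj_on_def)
      ultimately show ?thesis by simp
    qed
    show ?thesis using s1 s2 s3 s4 s5 by linarith
  qed
  define S where "S = (\<Sum>z\<in>?V \<times> ?V. h z) / (real n)\<^sup>2"
  have n0: "real n > 0" using n m by simp
  have S0: "0 \<le> S" unfolding S_def using h0 by (intro divide_nonneg_nonneg sum_nonneg) auto
  \<comment> \<open>Fewer than \<open>m \<le> m * q\<close> vertices are left over, so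
    \<open>n\<close> is at most twice \<open>m * q\<close>; its square is the source of the factor 4
    in the cut error.\<close>
  have ratio: "real n \<le> 2 * real m * real q"
  proof -
    have "m \<le> m * q" using q by simp
    then have "n \<le> 2 * (m * q)" using n_le by linarith
    then have "real n \<le> real (2 * (m * q))" by (rule of_nat_mono)
    then show ?thesis by simp
  qed
  have n2: "(real n)\<^sup>2 \<le> 4 * (real m)\<^sup>2 * (real q)\<^sup>2"
    using power_mono[OF ratio, of 2] n0 by (simp add: power_mult_distrib)
  have n3: "(real m * real q)\<^sup>2 \<le> (real n)\<^sup>2"
    using mq by (intro power_mono) (simp_all flip: of_nat_mult)
  let ?C = "real k ^ N * (real N)\<^sup>2 * \<delta> / \<epsilon> ^ N"
  have C0: "0 \<le> ?C" using \<delta> eps by simp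
  have "(real m * real q)\<^sup>2 * S \<le> (real n)\<^sup>2 * S" using n3 S0 by (rule mult_right_mono)
  also have "\<dots> = (\<Sum>z\<in>?V \<times> ?V. h z)" using n0 by (simp add: S_def)
  also have "\<dots> \<le> 2 * ((real q)\<^sup>2 * extremal_entropy k m P + ?C * (real n)\<^sup>2 + N * (real q)\<^sup>2 * \<eta>) + m * (real q)\<^sup>2 + 2 * real n * m"
  proof -
    have C: "real k ^ N * (real N)\<^sup>2 * \<delta> * (real n)\<^sup>2 / \<epsilon> ^ N = ?C * (real n)\<^sup>2" by simp
    have "A \<le> 2 * (E + C + D) + F + G" if "A \<le> 2 * B + F + G" "B - D \<le> E + C" for A B C D E F G :: real
    proof -
      have "2 * B \<le> 2 * (E + C + D)" using that(2) by simp
      then show ?thesis using that(1) by simp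
    qed
    from this[OF HE main[unfolded C]] show ?thesis .
  qed
  also have "\<dots> \<le> 2 * ((real q)\<^sup>2 * extremal_entropy k m P + ?C * (4 * (real m)\<^sup>2 * (real q)\<^sup>2) + N * (real q)\<^sup>2 * \<eta>) + m * (real q)\<^sup>2 + 2 * (2 * real m * real q) * m"
    using mult_left_mono[OF n2 C0] mult_right_mono[OF ratio, of "real m"] by simp
  also have "\<dots> = (real q)\<^sup>2 * (2 * (extremal_entropy k m P + ?C * 4 * (real m)\<^sup>2 + N * \<eta>) + m + 4 * (real m)\<^sup>2 / real q)"
    using q by (simp add: field_simps power2_eq_square)
  finally have "(real q)\<^sup>2 * ((real m)\<^sup>2 * S) \<le> (real q)\<^sup>2 * (2 * (extremal_entropy k m P + ?C * 4 * (real m)\<^sup>2 + N * \<eta>) + m + 4 * (real m)\<^sup>2 / real q)"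
    by (simp add: power_mult_distrib mult_ac)
  then have "(real m)\<^sup>2 * S \<le> 2 * (extremal_entropy k m P + ?C * 4 * (real m)\<^sup>2 + N * \<eta>) + m + 4 * (real m)\<^sup>2 / real q"
    using q by simp
  then have "(real m)\<^sup>2 / 2 * S - real m / 2 - 2 * (real m)\<^sup>2 / real q - N * \<eta> - ?C * 4 * (real m)\<^sup>2 \<le> extremal_entropy k m P"
    by simp
  then show ?thesis by (simp add: S_def h_def \<eta>_def mult_ac)
qed

section \<open>Measure-preserving maps of the unit square\<close>

abbreviation unit_square :: "(real \<times> real) set" where
  "unit_square \<equiv> {0..1} \<times> {0..1}"

abbreviation borel_on :: "'a::euclidean_space set \<Rightarrow> 'a measure" where
  "borel_on \<Omega> \<equiv> restrict_space lborel \<Omega>"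

lemma lborel_Times:
  fixes A :: "real set" and B :: "real set"
  assumes "A \<in> sets borel" "B \<in> sets borel"
  shows "A \<times> B \<in> sets (borel :: (real \<times> real) measure)"
    and "emeasure lborel (A \<times> B) = emeasure lborel A * emeasure lborel B"
proof -
  have "A \<times> B \<in> sets (lborel \<Otimes>\<^sub>M lborel)" using assms by (intro pair_measureI) auto
  then have "A \<times> B \<in> sets (lborel :: (real \<times> real) measure)" unfolding lborel_prod .
  then show "A \<times> B \<in> sets (borel :: (real \<times> real) measure)" by simp
  have "emeasure (lborel \<Otimes>\<^sub>M lborel) (A \<times> B) = emeasure lborel A * emeasure lborel B"
    using assms by (intro lborel.emeasure_pair_measure_Times) auto
  then show "emeasure lborel (A \<times> B) = emeasure lborel A * emeasure lborel B" by (simp add: lborel_prod)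
qed

text \<open>Lebesgue measure on the plane is the completion of the product, not the product of
  completions. So each factor is split into a Borel set and a part of a null set, and the difference
  of the rectangles lies in two null strips.\<close>

lemma lebesgue_Times:
  fixes S :: "real set" and T :: "real set"
  assumes "S \<in> sets lebesgue" "T \<in> sets lebesgue"
  shows "S \<times> T \<in> sets lebesgue" and "emeasure lebesgue (S \<times> T) = emeasure lebesgue S * emeasure lebesgue T"
proof -
  obtain S0 S1 N where S: "S = S0 \<union> S1" "S1 \<subseteq> N" "N \<in> null_sets lborel" "S0 \<in> sets lborel"
    using assms(1) by (rule sets_completionE)
  obtain T0 T1 N' where T: "T = T0 \<union> T1" "T1 \<subseteq> N'" "N' \<in> null_sets lborel" "T0 \<in> sets lborel"
    using assms(2) by (rule sets_completionE)
  let ?Z = "N \<times> (UNIV :: real set) \<union> (UNIV :: real set) \<times> N'"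
  have "N \<times> (UNIV :: real set) \<in> null_sets lborel" "(UNIV :: real set) \<times> N' \<in> null_sets lborel"
    using S T lborel_Times[of N UNIV] lborel_Times[of UNIV N'] by (auto simp: null_sets_def)
  then have Z: "?Z \<in> null_sets lborel" by (rule null_sets.Un)
  have eq: "S \<times> T = S0 \<times> T0 \<union> (S \<times> T - S0 \<times> T0)" using S T by auto
  have sub: "S \<times> T - S0 \<times> T0 \<subseteq> ?Z" using S T by auto
  have ST0: "S0 \<times> T0 \<in> sets lborel" using lborel_Times S T by simp
  show "S \<times> T \<in> sets lebesgue" by (rule sets_completionI[OF eq sub Z ST0])
  have "S \<times> T - S0 \<times> T0 \<in> null_sets lebesgue"
    using sub Z by (meson null_sets_completionI null_sets_completion_subset)
  then have "emeasure lebesgue (S \<times> T) = emeasure lebesgue (S0 \<times> T0)"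
    using ST0 by (subst eq) (intro emeasure_Un_null_set, auto)
  also have "\<dots> = emeasure lborel S0 * emeasure lborel T0"
    using lborel_Times[of S0 T0] S T by simp
  also have "emeasure lborel S0 = emeasure lebesgue S"
  proof -
    have "S1 \<in> null_sets lebesgue" using S by (meson null_sets_completionI null_sets_completion_subset)
    then have "emeasure lebesgue (S0 \<union> S1) = emeasure lebesgue S0" using S by (intro emeasure_Un_null_set) auto
    then show ?thesis using S by simp
  qed
  also have "emeasure lborel T0 = emeasure lebesgue T"
  proof -
    have "T1 \<in> null_sets lebesgue" using T by (meson null_sets_completionI null_sets_completion_subset)
    then have "emeasure lebesgue (T0 \<union> T1) = emeasure lebesgue T0" using T by (intro emeasure_Un_null_set) auto
    then show ?thesis using T by simp
  qed
  finally show "emeasure lebesgue (S \<times> T) = emeasure lebesgue S * emeasure lebesgue T" .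
qed

lemma square_in_sets [simp]: "unit_square \<in> sets borel" "unit_square \<in> sets lebesgue"
  using lborel_Times(1)[of "{0..1}" "{0..1}"] by auto

lemma space_square [simp]: "space (lebesgue_on unit_square) = unit_square"
  by (simp add: space_restrict_space)

lemma emeasure_square: "emeasure lebesgue unit_square = 1"
  by (subst lebesgue_Times) auto

lemma prob_space_square: "prob_space (lebesgue_on unit_square)"
  by (rule prob_spaceI) (simp add: emeasure_restrict_space emeasure_square)

interpretation square: prob_space "lebesgue_on unit_square"
  by (rule prob_space_square)

lemma sets_borel_on_pair:
  "sets (borel_on {0..1::real} \<Otimes>\<^sub>M borel_on {0..1::real}) = sets (borel_on unit_square)"
proof (intro equalityI subsetI)
  let ?B = "borel_on {0..1::real}"
  have "(\<lambda>z. (fst z, snd z)) \<in> measurable (borel_on unit_square) (?B \<Otimes>\<^sub>M ?B)"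
    by (intro measurable_Pair measurable_restrict_space2 measurable_restrict_space1)
      (auto simp: space_restrict_space borel_prod[symmetric])
  then have m: "(\<lambda>z. z) \<in> measurable (borel_on unit_square) (?B \<Otimes>\<^sub>M ?B)" by simp
  fix A assume A: "A \<in> sets (?B \<Otimes>\<^sub>M ?B)"
  have "A \<subseteq> space (borel_on unit_square)"
    using sets.sets_into_space[OF A] by (auto simp: space_pair_measure space_restrict_space)
  then show "A \<in> sets (borel_on unit_square)"
    using measurable_sets[OF m A] by (simp add: Int_absorb2)
next
  let ?B = "borel_on {0..1::real}"
  have id: "(\<lambda>x. x) \<in> measurable ?B lborel" by (intro measurable_restrict_space1) simp
  have "(\<lambda>z. (fst z, snd z)) \<in> measurable (?B \<Otimes>\<^sub>M ?B) (lborel \<Otimes>\<^sub>M lborel)"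
    by (intro measurable_Pair measurable_compose[OF measurable_fst id] measurable_compose[OF measurable_snd id])
  then have "(\<lambda>z. z) \<in> measurable (?B \<Otimes>\<^sub>M ?B) lborel" unfolding lborel_prod by simp
  then have m: "(\<lambda>z. z) \<in> measurable (?B \<Otimes>\<^sub>M ?B) (borel_on unit_square)"
    by (rule measurable_restrict_space2[rotated]) (auto simp: space_pair_measure space_restrict_space)
  fix A assume A: "A \<in> sets (borel_on unit_square)"
  have "A \<subseteq> space (?B \<Otimes>\<^sub>M ?B)"
    using sets.sets_into_space[OF A] by (auto simp: space_pair_measure space_restrict_space)
  then show "A \<in> sets (?B \<Otimes>\<^sub>M ?B)"
    using measurable_sets[OF m A] by (simp add: Int_absorb2)
qed

lemma borel_on_pair: "borel_on {0..1::real} \<Otimes>\<^sub>M borel_on {0..1::real} = borel_on unit_square"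
proof (rule pair_measure_eqI)
  have "emeasure (borel_on {0..1::real}) (space (borel_on {0..1})) \<noteq> \<infinity>"
    by (simp add: space_restrict_space emeasure_restrict_space)
  then show "sigma_finite_measure (borel_on {0..1::real})" "sigma_finite_measure (borel_on {0..1::real})"
    by (auto intro!: finite_measure.sigma_finite_measure finite_measureI)
  show "sets (borel_on {0..1::real} \<Otimes>\<^sub>M borel_on {0..1::real}) = sets (borel_on unit_square)"
    by (rule sets_borel_on_pair)
  fix A B assume "A \<in> sets (borel_on {0..1::real})" "B \<in> sets (borel_on {0..1::real})"
  then have AB: "A \<in> sets borel" "B \<in> sets borel" "A \<subseteq> {0..1}" "B \<subseteq> {0..1}"
    by (auto simp: sets_restrict_space_iff)
  then have "A \<times> B \<subseteq> unit_square" by auto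
  then show "emeasure (borel_on {0..1}) A * emeasure (borel_on {0..1}) B = emeasure (borel_on unit_square) (A \<times> B)"
    using AB by (simp add: emeasure_restrict_space lborel_Times)
qed

text \<open>Completeness: every subset of the exceptional null set is Lebesgue measurable, in
  particular the part where \<open>f\<close> hits a given target and differs from
  \<open>g\<close>.\<close>

lemma AE_square_measurable:
  fixes f g :: "real \<times> real \<Rightarrow> real"
  assumes "g \<in> borel_measurable (lebesgue_on unit_square)" and eq: "AE z in lebesgue_on unit_square. f z = g z"
  shows "f \<in> borel_measurable (lebesgue_on unit_square)"
proof -
  let ?f = "\<lambda>z. indicator unit_square z *\<^sub>R f z" and ?g = "\<lambda>z. indicator unit_square z *\<^sub>R g z"
  have g: "?g \<in> borel_measurable lebesgue"
    using assms(1) by (subst (asm) borel_measurable_restrict_space_iff) auto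
  have "AE z in lebesgue. z \<in> unit_square \<longrightarrow> f z = g z"
    using eq by (subst (asm) AE_restrict_space_iff) auto
  then have ae: "AE z in lborel. \<not> ?f z \<noteq> ?g z"
    unfolding AE_completion_iff by eventually_elim (auto simp: indicator_def)
  have "?f \<in> borel_measurable lebesgue"
  proof (rule measurableI)
    fix A :: "real set" assume "A \<in> sets borel"
    have 1: "{z \<in> space lebesgue. ?f z \<noteq> ?g z} \<in> sets lebesgue"
      using sets_completion_AE[OF ae] by (simp add: pred_def)
    have 2: "{z \<in> space lebesgue. ?f z \<noteq> ?g z \<and> ?f z \<in> A} \<in> sets lebesgue"
    proof -
      have "AE z in lborel. \<not> (?f z \<noteq> ?g z \<and> ?f z \<in> A)" using ae by eventually_elim auto
      from sets_completion_AE[OF this] show ?thesis by (simp add: pred_def)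
    qed
    have 3: "?g -` A \<inter> space lebesgue \<in> sets lebesgue" using g \<open>A \<in> sets borel\<close> by (rule measurable_sets)
    have eq: "?f -` A \<inter> space lebesgue =
       (?g -` A \<inter> space lebesgue - {z \<in> space lebesgue. ?f z \<noteq> ?g z}) \<union> {z \<in> space lebesgue. ?f z \<noteq> ?g z \<and> ?f z \<in> A}"
      by auto
    show "?f -` A \<inter> space lebesgue \<in> sets lebesgue" unfolding eq by (intro sets.Un sets.Diff 1 2 3)
  qed auto
  then show ?thesis by (subst borel_measurable_restrict_space_iff) auto
qed

lemma square_ex_borel:
  fixes f :: "real \<times> real \<Rightarrow> real"
  assumes "f \<in> borel_measurable (lebesgue_on unit_square)"
  obtains g where "g \<in> borel_measurable borel" "AE z in borel_on unit_square. f z = g z"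
proof -
  have "(\<lambda>z. indicator unit_square z *\<^sub>R f z) \<in> borel_measurable lebesgue"
    using assms by (subst (asm) borel_measurable_restrict_space_iff) auto
  from completion_ex_borel_measurable_real[OF this]
  obtain g where g: "g \<in> borel_measurable lborel"
      "AE z in lborel. indicator unit_square z *\<^sub>R f z = g z"
    by (rule bexE)
  have "AE z in lborel. z \<in> unit_square \<longrightarrow> f z = g z" using g(2) by eventually_elim auto
  then have "AE z in borel_on unit_square. f z = g z" by (subst AE_restrict_space_iff) auto
  then show ?thesis using g(1) that by simp
qed

text \<open>Lebesgue source, Borel target: with a Borel target the push-forward can be tested on
  rectangles, while Lebesgue measurable functions are reached through Borel representatives.\<close>

definition square_preserving :: "(real \<times> real \<Rightarrow> real \<times> real) \<Rightarrow> bool" where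
  "square_preserving T \<longleftrightarrow> T \<in> measurable (lebesgue_on unit_square) (borel_on unit_square) \<and>
     distr (lebesgue_on unit_square) (borel_on unit_square) T = borel_on unit_square"

text \<open>Uniqueness of the product measure reduces the push-forward to Borel rectangles.\<close>

lemma square_preservingI:
  assumes T: "T \<in> measurable (lebesgue_on unit_square) (borel_on unit_square)"
    and *: "\<And>A B. A \<in> sets borel \<Longrightarrow> B \<in> sets borel \<Longrightarrow> A \<subseteq> {0..1} \<Longrightarrow> B \<subseteq> {0..1} \<Longrightarrow>
      emeasure lebesgue (T -` (A \<times> B) \<inter> unit_square) = emeasure lborel A * emeasure lborel B"
  shows "square_preserving T"
proof -
  have "borel_on {0..1::real} \<Otimes>\<^sub>M borel_on {0..1::real} = distr (lebesgue_on unit_square) (borel_on unit_square) T"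
  proof (rule pair_measure_eqI)
    have "emeasure (borel_on {0..1::real}) (space (borel_on {0..1})) \<noteq> \<infinity>"
      by (simp add: space_restrict_space emeasure_restrict_space)
    then show "sigma_finite_measure (borel_on {0..1::real})" "sigma_finite_measure (borel_on {0..1::real})"
      by (auto intro!: finite_measure.sigma_finite_measure finite_measureI)
    show "sets (borel_on {0..1::real} \<Otimes>\<^sub>M borel_on {0..1::real}) = sets (distr (lebesgue_on unit_square) (borel_on unit_square) T)"
      by (simp add: sets_borel_on_pair)
    fix A B assume "A \<in> sets (borel_on {0..1::real})" "B \<in> sets (borel_on {0..1::real})"
    then have AB: "A \<in> sets borel" "B \<in> sets borel" "A \<subseteq> {0..1}" "B \<subseteq> {0..1}"
      by (auto simp: sets_restrict_space_iff)
    have sq: "A \<times> B \<in> sets (borel_on unit_square)"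
      using AB lborel_Times(1)[OF AB(1,2)] by (auto simp: sets_restrict_space_iff)
    have "emeasure (distr (lebesgue_on unit_square) (borel_on unit_square) T) (A \<times> B) = emeasure lebesgue (T -` (A \<times> B) \<inter> unit_square)"
      using sq T by (simp add: emeasure_distr emeasure_restrict_space)
    then show "emeasure (borel_on {0..1}) A * emeasure (borel_on {0..1}) B = emeasure (distr (lebesgue_on unit_square) (borel_on unit_square) T) (A \<times> B)"
      using AB * by (simp add: emeasure_restrict_space)
  qed
  then show ?thesis using T by (simp add: square_preserving_def borel_on_pair)
qed

lemma square_measurable_pair:
  assumes "f \<in> measurable (lebesgue_on unit_square) (borel_on {0..1})" "g \<in> measurable (lebesgue_on unit_square) (borel_on {0..1})"
  shows "(\<lambda>z. (f z, g z)) \<in> measurable (lebesgue_on unit_square) (borel_on unit_square)"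
  unfolding borel_on_pair[symmetric] using assms by (rule measurable_Pair)

lemma Times_sets_square:
  "S \<in> sets (lebesgue_on {0..1::real}) \<Longrightarrow> T \<in> sets (lebesgue_on {0..1::real}) \<Longrightarrow> S \<times> T \<in> sets (lebesgue_on unit_square)"
  by (auto simp: sets_restrict_space_iff intro: lebesgue_Times)

lemma measurable_fst_square: "fst \<in> measurable (lebesgue_on unit_square) (lebesgue_on {0..1})"
proof (rule measurableI)
  fix A :: "real set" assume A: "A \<in> sets (lebesgue_on {0..1})"
  then have "A \<subseteq> {0..1}" by (auto simp: sets_restrict_space_iff)
  then have "fst -` A \<inter> space (lebesgue_on unit_square) = A \<times> {0..1}" by auto
  then show "fst -` A \<inter> space (lebesgue_on unit_square) \<in> sets (lebesgue_on unit_square)"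
    using Times_sets_square[OF A, of "{0..1}"] by (simp add: sets_restrict_space_iff)
qed (auto simp: space_restrict_space)

lemma measurable_snd_square: "snd \<in> measurable (lebesgue_on unit_square) (lebesgue_on {0..1})"
proof (rule measurableI)
  fix A :: "real set" assume A: "A \<in> sets (lebesgue_on {0..1})"
  then have "A \<subseteq> {0..1}" by (auto simp: sets_restrict_space_iff)
  then have "snd -` A \<inter> space (lebesgue_on unit_square) = {0..1} \<times> A" by auto
  then show "snd -` A \<inter> space (lebesgue_on unit_square) \<in> sets (lebesgue_on unit_square)"
    using Times_sets_square[OF _ A, of "{0..1}"] by (simp add: sets_restrict_space_iff)
qed (auto simp: space_restrict_space)

lemma measurable_lebesgue_on_borel_on:
  "f \<in> measurable M (lebesgue_on {0..1::real}) \<Longrightarrow> f \<in> measurable M (borel_on {0..1})"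
proof (rule measurableI)
  assume f: "f \<in> measurable M (lebesgue_on {0..1::real})"
  show "f x \<in> space (borel_on {0..1})" if "x \<in> space M" for x
    using measurable_space[OF f that] by (simp add: space_restrict_space)
  show "f -` A \<inter> space M \<in> sets M" if "A \<in> sets (borel_on {0..1})" for A
    using that by (intro measurable_sets[OF f]) (auto simp: sets_restrict_space_iff)
qed

text \<open>The preimage of a rectangle is the rectangle of preimages. These are Lebesgue but
  possibly not Borel, hence the use of \<open>lebesgue_Times\<close>.\<close>

lemma measure_preserving_square:
  assumes "\<phi> \<in> measure_preserving_maps"
  shows "square_preserving (\<lambda>(x, y). (\<phi> x, \<phi> y))"
proof -
  have \<phi>: "\<phi> \<in> measurable (lebesgue_on {0..1}) (lebesgue_on {0..1})"
    and distr: "distr (lebesgue_on {0..1}) (lebesgue_on {0..1}) \<phi> = lebesgue_on {0..1}"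
    using assms by (auto simp: measure_preserving_maps_def)
  have pre: "\<phi> -` A \<inter> {0..1} \<in> sets lebesgue" "emeasure lebesgue (\<phi> -` A \<inter> {0..1}) = emeasure lborel A"
    if A: "A \<in> sets borel" "A \<subseteq> {0..1}" for A
  proof -
    have A': "A \<in> sets (lebesgue_on {0..1})" using A by (auto simp: sets_restrict_space_iff)
    have "\<phi> -` A \<inter> space (lebesgue_on {0..1}) \<in> sets (lebesgue_on {0..1})" by (rule measurable_sets[OF \<phi> A'])
    then show "\<phi> -` A \<inter> {0..1} \<in> sets lebesgue" by (simp add: space_restrict_space sets_restrict_space_iff)
    have "emeasure lborel A = emeasure (distr (lebesgue_on {0..1}) (lebesgue_on {0..1}) \<phi>) A"
      using A unfolding distr by (simp add: emeasure_restrict_space)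
    also have "\<dots> = emeasure lebesgue (\<phi> -` A \<inter> {0..1})"
      using A' by (simp add: emeasure_distr[OF \<phi>] space_restrict_space emeasure_restrict_space)
    finally show "emeasure lebesgue (\<phi> -` A \<inter> {0..1}) = emeasure lborel A" ..
  qed
  have m: "(\<lambda>z. (\<phi> (fst z), \<phi> (snd z))) \<in> measurable (lebesgue_on unit_square) (borel_on unit_square)"
    by (intro square_measurable_pair measurable_lebesgue_on_borel_on
        measurable_compose[OF measurable_fst_square \<phi>] measurable_compose[OF measurable_snd_square \<phi>])
  have "square_preserving (\<lambda>z. (\<phi> (fst z), \<phi> (snd z)))"
  proof (rule square_preservingI[OF m])
    fix A B :: "real set" assume AB: "A \<in> sets borel" "B \<in> sets borel" "A \<subseteq> {0..1}" "B \<subseteq> {0..1}"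
    have eq: "(\<lambda>z. (\<phi> (fst z), \<phi> (snd z))) -` (A \<times> B) \<inter> unit_square = (\<phi> -` A \<inter> {0..1}) \<times> (\<phi> -` B \<inter> {0..1})"
      by auto
    show "emeasure lebesgue ((\<lambda>z. (\<phi> (fst z), \<phi> (snd z))) -` (A \<times> B) \<inter> unit_square) = emeasure lborel A * emeasure lborel B"
      unfolding eq lebesgue_Times(2)[OF pre(1)[OF AB(1,3)] pre(1)[OF AB(2,4)]] pre(2)[OF AB(1,3)] pre(2)[OF AB(2,4)] ..
  qed
  then show ?thesis by (simp add: case_prod_beta')
qed

text \<open>Needed to carry the symmetry of a graphon over to its block averages.\<close>

lemma swap_square_preserving: "square_preserving (\<lambda>z. (snd z, fst z))"
proof (rule square_preservingI)
  show "(\<lambda>z. (snd z, fst z)) \<in> measurable (lebesgue_on unit_square) (borel_on unit_square)"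
    by (intro square_measurable_pair measurable_lebesgue_on_borel_on measurable_fst_square measurable_snd_square)
  fix A B :: "real set" assume AB: "A \<in> sets borel" "B \<in> sets borel" "A \<subseteq> {0..1}" "B \<subseteq> {0..1}"
  then have eq: "(\<lambda>z. (snd z, fst z)) -` (A \<times> B) \<inter> unit_square = B \<times> A" by auto
  have "A \<in> sets lebesgue" "B \<in> sets lebesgue" using AB by auto
  note Times = lebesgue_Times(2)[OF this(2,1)]
  show "emeasure lebesgue ((\<lambda>z. (snd z, fst z)) -` (A \<times> B) \<inter> unit_square) = emeasure lborel A * emeasure lborel B"
    unfolding eq Times using AB by (simp add: mult.commute)
qed

text \<open>Replace \<open>f\<close> by a Borel function \<open>g\<close> equal almost everywhere.
  The exceptional set stays null under preimages because \<open>T\<close> pushes the measure forward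
  to Lebesgue measure, so \<open>f\<close> and \<open>g\<close> may be exchanged also after
  composition.\<close>

lemma square_preserving_compose:
  fixes f :: "real \<times> real \<Rightarrow> real"
  assumes T: "square_preserving T" and f: "f \<in> borel_measurable (lebesgue_on unit_square)"
  shows "(\<lambda>z. f (T z)) \<in> borel_measurable (lebesgue_on unit_square)"
    and "(\<integral>z. f (T z) \<partial>lebesgue_on unit_square) = (\<integral>z. f z \<partial>lebesgue_on unit_square)"
proof -
  let ?M = "lebesgue_on unit_square" and ?B = "borel_on unit_square"
  obtain g where g: "g \<in> borel_measurable borel" and fg: "AE z in ?B. f z = g z"
    using square_ex_borel[OF f] .
  have gB: "g \<in> borel_measurable ?B" using g by (intro measurable_restrict_space1) simp
  have gM: "g \<in> borel_measurable ?M" using g by (intro measurable_restrict_space1) (simp add: measurable_completion)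
  have Tm: "T \<in> measurable ?M ?B" and Td: "distr ?M ?B T = ?B" using T by (auto simp: square_preserving_def)
  have fgT: "AE z in ?M. f (T z) = g (T z)"
  proof (rule AE_distrD[OF Tm])
    show "AE z in distr ?M ?B T. f z = g z" unfolding Td by (rule fg)
  qed
  have gT: "(\<lambda>z. g (T z)) \<in> borel_measurable ?M" by (rule measurable_compose[OF Tm gB])
  show fT: "(\<lambda>z. f (T z)) \<in> borel_measurable ?M" by (rule AE_square_measurable[OF gT fgT])
  have "AE z in lborel. z \<in> unit_square \<longrightarrow> f z = g z"
    using fg by (subst (asm) AE_restrict_space_iff) auto
  then have fgM: "AE z in ?M. f z = g z" by (subst AE_restrict_space_iff) (auto intro: AE_completion)
  have "(\<integral>z. f (T z) \<partial>?M) = (\<integral>z. g (T z) \<partial>?M)" by (rule integral_cong_AE[OF fT gT fgT])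
  also have "\<dots> = (\<integral>z. g z \<partial>?B)" using integral_distr[OF Tm gB] by (simp add: Td)
  also have "\<dots> = (\<integral>z. g z \<partial>?M)"
  proof -
    have "(\<lambda>z. indicator unit_square z *\<^sub>R g z) \<in> borel_measurable lborel"
      using g by (intro borel_measurable_scaleR borel_measurable_indicator) auto
    from integral_completion[OF this] show ?thesis by (simp add: integral_restrict_space)
  qed
  also have "\<dots> = (\<integral>z. f z \<partial>?M)" using integral_cong_AE[OF f gM fgM] by simp
  finally show "(\<integral>z. f (T z) \<partial>?M) = (\<integral>z. f z \<partial>?M)" .
qed

lemma square_integrable_bounded:
  fixes f :: "real \<times> real \<Rightarrow> real"
  assumes "f \<in> borel_measurable (lebesgue_on unit_square)" "\<And>z. z \<in> unit_square \<Longrightarrow> \<bar>f z\<bar> \<le> B"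
  shows "integrable (lebesgue_on unit_square) f"
  using assms by (intro square.integrable_const_bound[of f B]) (auto intro: AE_I2)

section \<open>Blocks\<close>

definition block :: "nat \<Rightarrow> nat \<Rightarrow> real set" where
  "block n u = {real u / real n..<real (Suc u) / real n}"

text \<open>For \<open>n > 0\<close>, the endpoint \<open>x = 1\<close> receives the index
  \<open>n\<close>, which is no block of the unit interval; statements are therefore made on the
  half-open square and extended by \<open>AE_half_open\<close>.\<close>

definition block_index :: "nat \<Rightarrow> real \<Rightarrow> nat" where
  "block_index n x = nat \<lfloor>real n * x\<rfloor>"

definition step :: "nat \<Rightarrow> (nat \<times> nat \<Rightarrow> 'a) \<Rightarrow> real \<times> real \<Rightarrow> 'a" where
  "step n F z = F (block_index n (fst z), block_index n (snd z))"

lemma block_index_eq_iff: "n > 0 \<Longrightarrow> 0 \<le> x \<Longrightarrow> block_index n x = u \<longleftrightarrow> x \<in> block n u"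
proof -
  assume n: "n > 0" "0 \<le> x"
  have "block_index n x = u \<longleftrightarrow> \<lfloor>real n * x\<rfloor> = int u" using n by (auto simp: block_index_def)
  also have "\<dots> \<longleftrightarrow> x \<in> block n u"
    using n by (auto simp: floor_eq_iff block_def field_simps)
  finally show ?thesis .
qed

lemma block_index_less: "n > 0 \<Longrightarrow> 0 \<le> x \<Longrightarrow> x < 1 \<Longrightarrow> block_index n x < n"
proof -
  assume n: "n > 0" "0 \<le> x" "x < 1"
  then have "real n * x < real n" by simp
  then have "\<lfloor>real n * x\<rfloor> < int n" by (simp add: floor_less_iff)
  then show ?thesis using n by (simp add: block_index_def nat_less_iff)
qed

lemma block_subset: "u < n \<Longrightarrow> block n u \<subseteq> {0..<1}"
proof
  fix x assume u: "u < n" "x \<in> block n u"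
  have "0 \<le> real u / real n" "real (Suc u) / real n \<le> 1" using u(1) by auto
  moreover have "real u / real n \<le> x" "x < real (Suc u) / real n" using u(2) by (simp_all add: block_def)
  ultimately have "0 \<le> x" "x < 1" by linarith+
  then show "x \<in> {0..<1}" by simp
qed

lemma block_subset_closed: "u < n \<Longrightarrow> block n u \<subseteq> {0..1}"
  by (rule order_trans[OF block_subset]) auto

lemma block_sets [simp]: "block n u \<in> sets lebesgue" "block n u \<in> sets borel"
  by (auto simp: block_def)

lemma measure_block: "n > 0 \<Longrightarrow> measure lebesgue (block n u) = 1 / real n"
proof -
  assume "n > 0"
  have "measure lebesgue (block n u) = measure lborel {real u / real n..<real (Suc u) / real n}"
    unfolding block_def by (rule measure_completion) simp
  also have "\<dots> = real (Suc u) / real n - real u / real n"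
    by (rule measure_lborel_Ico) (simp add: divide_right_mono)
  also have "\<dots> = 1 / real n" by (simp flip: diff_divide_distrib)
  finally show ?thesis .
qed

lemma AE_half_open: "AE z in lebesgue_on unit_square. z \<in> {0..<1} \<times> {0..<1}"
proof -
  have "{1::real} \<times> (UNIV :: real set) \<in> null_sets lborel" "(UNIV :: real set) \<times> {1::real} \<in> null_sets lborel"
    using lborel_Times[of "{1}" UNIV] lborel_Times[of UNIV "{1}"] by (auto simp: null_sets_def)
  then have "{1::real} \<times> (UNIV :: real set) \<union> (UNIV :: real set) \<times> {1::real} \<in> null_sets lebesgue"
    by (intro null_sets_completionI null_sets.Un)
  then have "AE z in lebesgue. z \<notin> {1::real} \<times> (UNIV :: real set) \<union> (UNIV :: real set) \<times> {1::real}" by (rule AE_not_in)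
  then have "AE z in lebesgue. z \<in> unit_square \<longrightarrow> z \<in> {0..<1} \<times> {0..<1}"
    by eventually_elim auto
  then show ?thesis by (subst AE_restrict_space_iff) auto
qed

lemma step_measurable: 
  fixes F :: "nat \<times> nat \<Rightarrow> real"
  shows "step n F \<in> borel_measurable (lebesgue_on unit_square)"
proof -
  have "(\<lambda>z. F (block_index n (fst z), block_index n (snd z))) \<in> borel_measurable (borel :: (real \<times> real) measure)"
    unfolding block_index_def borel_prod[symmetric] by measurable
  then have "step n F \<in> borel_measurable borel" by (simp add: step_def[abs_def])
  then show ?thesis by (intro measurable_restrict_space1) (simp add: measurable_completion)
qed

lemma indicator_Times_measurable:
  "S \<in> sets lebesgue \<Longrightarrow> T \<in> sets lebesgue \<Longrightarrow>
    (indicator (S \<times> T) :: _ \<Rightarrow> real) \<in> borel_measurable (lebesgue_on unit_square)"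
  by (intro measurable_restrict_space1 borel_measurable_indicator lebesgue_Times)

text \<open>The products of blocks tile the half-open square, which misses only a null set.\<close>

lemma integral_blocks:
  fixes f :: "real \<times> real \<Rightarrow> real"
  assumes n: "n > 0" and f: "f \<in> borel_measurable (lebesgue_on unit_square)" "\<And>z. z \<in> unit_square \<Longrightarrow> \<bar>f z\<bar> \<le> B"
  shows "(\<integral>z. f z \<partial>lebesgue_on unit_square) =
    (\<Sum>p\<in>{..<n} \<times> {..<n}. \<integral>z. indicator (block n (fst p) \<times> block n (snd p)) z * f z \<partial>lebesgue_on unit_square)"
proof -
  let ?M = "lebesgue_on unit_square" and ?V = "{..<n}"
  let ?ind = "\<lambda>p. indicator (block n (fst p) \<times> block n (snd p)) :: _ \<Rightarrow> real"
  have m: "(\<lambda>z. ?ind p z * f z) \<in> borel_measurable ?M" for p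
    by (intro borel_measurable_times indicator_Times_measurable f block_sets)
  have int: "integrable ?M (\<lambda>z. ?ind p z * f z)" for p
    using f(2) by (intro square_integrable_bounded[where B = B, OF m]) (fastforce simp: indicator_def)
  have "AE z in ?M. f z = (\<Sum>p\<in>?V \<times> ?V. ?ind p z * f z)"
    using AE_half_open
  proof eventually_elim
    fix z :: "real \<times> real" assume z: "z \<in> {0..<1} \<times> {0..<1}"
    let ?p = "(block_index n (fst z), block_index n (snd z))"
    have p: "?p \<in> ?V \<times> ?V" using z n block_index_less by (auto simp: mem_Times_iff)
    have "?ind p z = of_bool (p = ?p)" for p
      using z n block_index_eq_iff[of n "fst z" "fst p"] block_index_eq_iff[of n "snd z" "snd p"]
      by (cases p; cases z) (auto simp: indicator_def)
    then have "(\<Sum>p\<in>?V \<times> ?V. ?ind p z * f z) = (\<Sum>p\<in>?V \<times> ?V. if p = ?p then f z else 0)"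
      by (intro sum.cong) auto
    also have "\<dots> = f z" using p by (subst sum.delta) auto
    finally show "f z = (\<Sum>p\<in>?V \<times> ?V. ?ind p z * f z)" ..
  qed
  then have "(\<integral>z. f z \<partial>?M) = (\<integral>z. (\<Sum>p\<in>?V \<times> ?V. ?ind p z * f z) \<partial>?M)"
    by (intro integral_cong_AE f borel_measurable_sum m)
  also have "\<dots> = (\<Sum>p\<in>?V \<times> ?V. \<integral>z. ?ind p z * f z \<partial>?M)"
    by (intro Bochner_Integration.integral_sum int)
  finally show ?thesis .
qed

lemma integral_indicator_Times:
  assumes "S \<in> sets lebesgue" "T \<in> sets lebesgue" "S \<subseteq> {0..1}" "T \<subseteq> {0..1}"
  shows "(\<integral>z. indicator (S \<times> T) z \<partial>lebesgue_on unit_square) = measure lebesgue S * measure lebesgue T"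
proof -
  have sub: "S \<times> T \<subseteq> unit_square" using assms by auto
  have "(\<integral>z. indicator (S \<times> T) z \<partial>lebesgue_on unit_square) = measure (lebesgue_on unit_square) (S \<times> T)"
    using sub by (simp add: Int_absorb2)
  also have "\<dots> = measure lebesgue (S \<times> T)" using sub by (simp add: measure_restrict_space)
  also have "\<dots> = measure lebesgue S * measure lebesgue T"
    using lebesgue_Times(2)[OF assms(1,2)] by (simp add: measure_def enn2real_mult)
  finally show ?thesis .
qed

lemma set_integral_square:
  fixes f :: "real \<times> real \<Rightarrow> real"
  assumes "S \<subseteq> {0..1}" "T \<subseteq> {0..1}"
  shows "(LINT z : S \<times> T | lebesgue. f z) = (\<integral>z. indicator (S \<times> T) z * f z \<partial>lebesgue_on unit_square)"
proof -
  have eq: "indicator unit_square z * (indicator (S \<times> T) z * f z) = indicator (S \<times> T) z * f z" for z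
    using assms by (auto simp: indicator_def)
  have "(\<integral>z. indicator (S \<times> T) z * f z \<partial>lebesgue_on unit_square) =
      (\<integral>z. indicator unit_square z *\<^sub>R (indicator (S \<times> T) z * f z) \<partial>lebesgue)"
    by (rule integral_restrict_space) simp
  then show ?thesis
    unfolding set_lebesgue_integral_def real_scaleR_def eq by (rule sym)
qed

lemma step_bounded:
  fixes F :: "nat \<times> nat \<Rightarrow> real"
  shows "\<exists>B. \<forall>z\<in>unit_square. \<bar>step n F z\<bar> \<le> B"
proof (intro exI ballI)
  fix z assume z: "z \<in> unit_square"
  \<comment> \<open>The index can equal \<open>n\<close> at the endpoint, so the maximum is taken
    over the closed range.\<close>
  have idx: "block_index n x \<le> n" if "x \<in> {0..1}" for x
  proof -
    have "real n * x \<le> real n" using that by (simp add: mult_left_le)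
    then have "\<lfloor>real n * x\<rfloor> \<le> int n" by linarith
    then show ?thesis by (simp add: block_index_def)
  qed
  have "(block_index n (fst z), block_index n (snd z)) \<in> {..n} \<times> {..n}" using z idx by auto
  then show "\<bar>step n F z\<bar> \<le> Max ((\<lambda>p. \<bar>F p\<bar>) ` ({..n} \<times> {..n}))"
    unfolding step_def by (intro Max_ge imageI finite_imageI finite_cartesian_product finite_atMost)
qed

lemma integral_step:
  fixes F :: "nat \<times> nat \<Rightarrow> real"
  assumes n: "n > 0" and ST: "S \<in> sets lebesgue" "T \<in> sets lebesgue" "S \<subseteq> {0..1}" "T \<subseteq> {0..1}"
  shows "(\<integral>z. indicator (S \<times> T) z * step n F z \<partial>lebesgue_on unit_square) =
    (\<Sum>p\<in>{..<n} \<times> {..<n}. F p * (measure lebesgue (S \<inter> block n (fst p)) * measure lebesgue (T \<inter> block n (snd p))))"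
proof -
  let ?M = "lebesgue_on unit_square"
  obtain B where B: "\<forall>z\<in>unit_square. \<bar>step n F z\<bar> \<le> B" using step_bounded[of n F] by (rule exE)
  have bound: "\<bar>indicator (S \<times> T) z * step n F z\<bar> \<le> B" if "z \<in> unit_square" for z
    using B[rule_format, OF that] by (auto simp: indicator_def)
  have "(\<integral>z. indicator (S \<times> T) z * step n F z \<partial>?M) =
    (\<Sum>p\<in>{..<n} \<times> {..<n}. \<integral>z. indicator (block n (fst p) \<times> block n (snd p)) z * (indicator (S \<times> T) z * step n F z) \<partial>?M)"
    using bound by (intro integral_blocks[OF n] borel_measurable_times indicator_Times_measurable ST step_measurable)
  also have "\<dots> = (\<Sum>p\<in>{..<n} \<times> {..<n}. \<integral>z. F p * indicator ((S \<inter> block n (fst p)) \<times> (T \<inter> block n (snd p))) z \<partial>?M)"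
  proof (intro sum.cong refl Bochner_Integration.integral_cong)
    fix p z assume "z \<in> space ?M"
    then have "z \<in> unit_square" by simp
    then have z: "0 \<le> fst z" "0 \<le> snd z" by auto
    have "step n F z = F p" if "z \<in> block n (fst p) \<times> block n (snd p)"
      using that block_index_eq_iff[OF n z(1), of "fst p"] block_index_eq_iff[OF n z(2), of "snd p"]
      by (simp add: step_def mem_Times_iff)
    then show "indicator (block n (fst p) \<times> block n (snd p)) z * (indicator (S \<times> T) z * step n F z) =
      F p * indicator ((S \<inter> block n (fst p)) \<times> (T \<inter> block n (snd p))) z"
      by (auto simp: indicator_def)
  qed
  also have "\<dots> = (\<Sum>p\<in>{..<n} \<times> {..<n}. F p * (measure lebesgue (S \<inter> block n (fst p)) * measure lebesgue (T \<inter> block n (snd p))))"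
    using ST by (intro sum.cong refl, subst integral_mult_right_zero, subst integral_indicator_Times) auto
  finally show ?thesis .
qed

section \<open>Graphons, their entropy and the cut distance\<close>

lemma kgraphonD:
  assumes "kgraphon k W" "x \<in> {0..1}" "y \<in> {0..1}"
  shows "set_pmf (W (x, y)) \<subseteq> {1..k}" "W (x, y) = W (y, x)" "(\<Sum>i=1..k. pmf (W (x, y)) i) = 1"
proof -
  show sub: "set_pmf (W (x, y)) \<subseteq> {1..k}" and "W (x, y) = W (y, x)"
    using assms unfolding kgraphon_def by blast+
  show "(\<Sum>i=1..k. pmf (W (x, y)) i) = 1" by (rule sum_pmf_eq_1[OF _ sub]) simp
qed

lemma abs_indicator_mult_le: "0 \<le> x \<Longrightarrow> x \<le> c \<Longrightarrow> \<bar>indicator A z * x\<bar> \<le> (c :: real)"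
  by (simp add: indicator_def)

lemma measure_lborel_block: "n > 0 \<Longrightarrow> measure lborel (block n u) = 1 / real n"
  using measure_block[of n u] by simp

lemma kgraphon_measurable:
  "kgraphon k W \<Longrightarrow> i \<in> {1..k} \<Longrightarrow> (\<lambda>z. pmf (W z) i) \<in> borel_measurable (lebesgue_on unit_square)"
  by (simp add: kgraphon_def)

lemma entropy_measurable:
  assumes "\<And>i. i \<in> {1..k} \<Longrightarrow> p i \<in> borel_measurable M"
  shows "(\<lambda>z. entropy_fun k (\<lambda>i. p i z)) \<in> borel_measurable M"
  unfolding entropy_fun_alt using assms
  by (intro borel_measurable_sum borel_measurable_uminus borel_measurable_times borel_measurable_log) auto

lemma graphon_entropy_alt:
  "graphon_entropy k W = (\<integral>z. entropy_fun k (pmf (W z)) \<partial>lebesgue_on unit_square)"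
proof -
  have "(\<integral>z. entropy_fun k (pmf (W z)) \<partial>lebesgue_on unit_square) =
      (\<integral>z. indicator unit_square z *\<^sub>R entropy_fun k (pmf (W z)) \<partial>lebesgue)"
    by (rule integral_restrict_space) simp
  then show ?thesis unfolding graphon_entropy_def set_lebesgue_integral_def by (rule sym)
qed

text \<open>A non-integrable integrand has integral 0 by convention, so the bound covers arbitrary
  \<open>U\<close> and \<open>W\<close> and makes the supremum in \<open>cut_diff\<close> finite for
  all arguments.\<close>

lemma abs_set_integral_pmf_le:
  fixes U W :: "real \<times> real \<Rightarrow> nat pmf"
  assumes "S \<subseteq> {0..1}" "T \<subseteq> {0..1}"
  shows "\<bar>LINT z : S \<times> T | lebesgue. pmf (U z) i - pmf (W z) i\<bar> \<le> 1"
proof (cases "integrable (lebesgue_on unit_square) (\<lambda>z. indicator (S \<times> T) z * (pmf (U z) i - pmf (W z) i))")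
  case True
  let ?f = "\<lambda>z. indicator (S \<times> T) z * (pmf (U z) i - pmf (W z) i)"
  have "\<bar>pmf (U z) i - pmf (W z) i\<bar> \<le> 1" for z
    using pmf_nonneg[of "U z" i] pmf_nonneg[of "W z" i] pmf_le_1[of "U z" i] pmf_le_1[of "W z" i] by linarith
  then have "\<bar>?f z\<bar> \<le> 1" for z by (simp add: indicator_def)
  then have "(\<integral>z. \<bar>?f z\<bar> \<partial>lebesgue_on unit_square) \<le> 1"
    using True by (intro square.integral_le_const integrable_abs) auto
  then show ?thesis
    unfolding set_integral_square[OF assms] using integral_abs_bound[of "lebesgue_on unit_square" ?f] by linarith
next
  case False
  then show ?thesis unfolding set_integral_square[OF assms] not_integrable_integral_eq[OF False] by simp
qed

lemma cut_diff_upper: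
  assumes "S \<in> sets lebesgue" "T \<in> sets lebesgue" "S \<subseteq> {0..1}" "T \<subseteq> {0..1}"
  shows "(\<Sum>i=1..k. \<bar>LINT z : S \<times> T | lebesgue. pmf (U z) i - pmf (W z) i\<bar>) \<le> cut_diff k U W"
proof -
  let ?g = "\<lambda>(S, T). \<Sum>i=1..k. \<bar>LINT z : S \<times> T | lebesgue. pmf (U z) i - pmf (W z) i\<bar>"
  let ?X = "{S \<in> sets lebesgue. S \<subseteq> {0..1::real}} \<times> {T \<in> sets lebesgue. T \<subseteq> {0..1::real}}"
  have "bdd_above (?g ` ?X)"
  proof (rule bdd_aboveI2)
    fix p assume "p \<in> ?X"
    then obtain S T where p: "p = (S, T)" "S \<subseteq> {0..1}" "T \<subseteq> {0..1}" by (cases p) auto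
    have "?g p \<le> (\<Sum>i=1..k. 1)"
      unfolding p(1) prod.case by (intro sum_mono abs_set_integral_pmf_le p)
    then show "?g p \<le> real k" by simp
  qed
  then have "?g (S, T) \<le> (SUP p\<in>?X. ?g p)" using assms by (intro cSUP_upper) auto
  then show ?thesis unfolding cut_diff_def by simp
qed

lemma cut_diff_nonneg: "0 \<le> cut_diff k U W"
  by (rule order_trans[OF _ cut_diff_upper[of "{}" "{}"]]) (auto intro: sum_nonneg)

lemma cut_dist_le:
  assumes "\<phi> \<in> measure_preserving_maps"
  shows "cut_dist k U W \<le> cut_diff k U (\<lambda>(x, y). W (\<phi> x, \<phi> y))"
  unfolding cut_dist_def using assms
  by (intro cINF_lower bdd_belowI2[where m = 0] cut_diff_nonneg)

lemma id_measure_preserving: "(\<lambda>x. x) \<in> measure_preserving_maps"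
  by (simp add: measure_preserving_maps_def distr_id)

lemma cut_dist_nonneg: "0 \<le> cut_dist k U W"
  unfolding cut_dist_def using id_measure_preserving
  by (intro cINF_greatest cut_diff_nonneg) auto

lemma pmf_step_graphon:
  assumes n: "n > 0" and z: "z \<in> {0..<1} \<times> {0..<1}"
  shows "pmf (step_graphon d n c z) i = step n (\<lambda>p. of_bool (colour_matrix d c p = i)) z"
proof -
  obtain x y where xy: "z = (x, y)" by (cases z)
  have "nat \<lfloor>real n * x\<rfloor> < n" "nat \<lfloor>real n * y\<rfloor> < n"
    using z xy n block_index_less[of n x] block_index_less[of n y] by (auto simp: block_index_def)
  then show ?thesis
    by (auto simp: xy step_graphon_def step_def colour_matrix_def block_index_def Let_def pmf_return indicator_def)
qed

lemma step_graphon_measurable: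
  assumes n: "n > 0"
  shows "(\<lambda>z. pmf (step_graphon d n c z) i) \<in> borel_measurable (lebesgue_on unit_square)"
proof (rule AE_square_measurable[OF step_measurable])
  show "AE z in lebesgue_on unit_square. pmf (step_graphon d n c z) i = step n (\<lambda>p. of_bool (colour_matrix d c p = i)) z"
    using AE_half_open by eventually_elim (rule pmf_step_graphon[OF n])
qed

lemma Union_block_Int:
  assumes n: "n > 0" and A: "A \<subseteq> {..<n}" "u < n"
  shows "(\<Union>v\<in>A. block n v) \<inter> block n u = (if u \<in> A then block n u else {})"
proof -
  have "v = u" if "x \<in> block n v" "x \<in> block n u" "v \<in> A" for x v
  proof -
    have "0 \<le> x" using block_subset[OF A(2)] that(2) by auto
    then show ?thesis using block_index_eq_iff[OF n] that by metis
  qed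
  then show ?thesis by auto
qed

text \<open>Jensen on one block: Gibbs' inequality holds pointwise against the block average
  \<open>q\<close>, and its linear term integrates to zero because \<open>q\<close> is the
  average.\<close>

lemma block_jensen:
  fixes p :: "real \<times> real \<Rightarrow> real"
  assumes n: "n > 0" "u < n" "v < n" and b: "1 < b"
    and p: "p \<in> borel_measurable (lebesgue_on unit_square)"
      "\<And>z. z \<in> unit_square \<Longrightarrow> 0 \<le> p z" "\<And>z. z \<in> unit_square \<Longrightarrow> p z \<le> 1"
  defines "q \<equiv> (real n)\<^sup>2 * (\<integral>z. indicator (block n u \<times> block n v) z * p z \<partial>lebesgue_on unit_square)"
  shows "0 \<le> q"
    and "(\<integral>z. indicator (block n u \<times> block n v) z * - (p z * log b (p z)) \<partial>lebesgue_on unit_square)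
      \<le> - (q * log b q) / (real n)\<^sup>2"
proof -
  let ?M = "lebesgue_on unit_square"
  let ?I = "indicator (block n u \<times> block n v) :: _ \<Rightarrow> real"
  have I: "?I \<in> borel_measurable ?M" by (intro indicator_Times_measurable) auto
  have Ip: "integrable ?M (\<lambda>z. ?I z * p z)"
    using p(2,3) by (intro square_integrable_bounded[where B = 1] borel_measurable_times I p(1)) (auto simp: indicator_def)
  have II: "integrable ?M ?I"
    by (intro square_integrable_bounded[where B = 1] I) (auto simp: indicator_def)
  have Ip0: "0 \<le> (\<integral>z. ?I z * p z \<partial>?M)"
    using p(2) by (intro integral_nonneg_AE AE_I2) (simp add: indicator_def)
  then show q0: "0 \<le> q" by (simp add: q_def)
  have I_int: "(\<integral>z. ?I z \<partial>?M) = 1 / (real n)\<^sup>2"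
    using n by (subst integral_indicator_Times) (auto simp: measure_lborel_block power2_eq_square block_subset_closed dest: subsetD)
  have eta: "0 \<le> - (x * log b x) \<and> - (x * log b x) \<le> 2 / ln b" if "0 \<le> x" "x \<le> 1" for x
  proof
    have "x \<noteq> 0 \<Longrightarrow> log b x \<le> 0" using that b by simp
    then show "0 \<le> - (x * log b x)" using that by (cases "x = 0") (auto simp: mult_nonneg_nonpos)
    show "- (x * log b x) \<le> 2 / ln b" using neg_xlog_le_sqrt[of b x 1] that b by simp
  qed
  have int1: "integrable ?M (\<lambda>z. ?I z * - (p z * log b (p z)))"
  proof (rule square_integrable_bounded[where B = "2 / ln b"])
    show "(\<lambda>z. ?I z * - (p z * log b (p z))) \<in> borel_measurable ?M"
      by (intro borel_measurable_times I borel_measurable_uminus borel_measurable_log p(1)) auto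
    show "\<bar>?I z * - (p z * log b (p z))\<bar> \<le> 2 / ln b" if "z \<in> unit_square" for z
      using eta[OF p(2)[OF that] p(3)[OF that]] by (intro abs_indicator_mult_le) auto
  qed
  have int2: "integrable ?M (\<lambda>z. - log b q * (?I z * p z) + (q * ?I z - ?I z * p z) / ln b)"
    using Ip II by auto
  \<comment> \<open>When the average vanishes, \<open>p\<close> vanishes almost everywhere on the
    block; this supplies the premise of \<open>neg_xlog_le\<close>.\<close>
  have ae: "AE z in ?M. q = 0 \<longrightarrow> ?I z * p z = 0"
  proof (cases "q = 0")
    case True
    then have "(\<integral>z. ?I z * p z \<partial>?M) = 0" using n by (simp add: q_def)
    moreover have "AE z in ?M. 0 \<le> ?I z * p z" using p(2) by (intro AE_I2) (simp add: indicator_def)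
    ultimately show ?thesis using integral_nonneg_eq_0_iff_AE[OF Ip] by auto
  qed simp
  have "AE z in ?M. ?I z * - (p z * log b (p z)) \<le> - log b q * (?I z * p z) + (q * ?I z - ?I z * p z) / ln b"
    using ae AE_space
  proof eventually_elim
    fix z assume z: "q = 0 \<longrightarrow> ?I z * p z = 0" "z \<in> space ?M"
    show "?I z * - (p z * log b (p z)) \<le> - log b q * (?I z * p z) + (q * ?I z - ?I z * p z) / ln b"
    proof (cases "z \<in> block n u \<times> block n v")
      case True
      then show ?thesis using neg_xlog_le[of b "p z" q] b p(2)[of z] q0 z by (simp add: mult.commute)
    qed simp
  qed
  then have "(\<integral>z. ?I z * - (p z * log b (p z)) \<partial>?M) \<le> (\<integral>z. - log b q * (?I z * p z) + (q * ?I z - ?I z * p z) / ln b \<partial>?M)"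
    by (rule integral_mono_AE[OF int1 int2])
  also have "\<dots> = - log b q * (\<integral>z. ?I z * p z \<partial>?M) + (q * (\<integral>z. ?I z \<partial>?M) - (\<integral>z. ?I z * p z \<partial>?M)) / ln b"
    using Ip II by (subst Bochner_Integration.integral_add) auto
  also have "\<dots> = - (q * log b q) / (real n)\<^sup>2"
  proof -
    have "(\<integral>z. ?I z * p z \<partial>?M) = q / (real n)\<^sup>2" using n by (simp add: q_def)
    then show ?thesis unfolding I_int by simp
  qed
  finally show "(\<integral>z. ?I z * - (p z * log b (p z)) \<partial>?M) \<le> - (q * log b q) / (real n)\<^sup>2" .
qed

text \<open>\<open>w\<close> is the block average of \<open>U\<close> after the map
  \<open>\<phi>\<close>. Rectangles of vertices become rectangles of unions of blocks, so the cut
  bound survives; by Jensen the entropy can only increase.\<close>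

lemma discretise_graphon:
  assumes k: "k \<ge> 2" and U: "kgraphon k U" and n: "n > 0" and \<phi>: "\<phi> \<in> measure_preserving_maps"
    and cut: "cut_diff k (step_graphon d n c) (\<lambda>(x, y). U (\<phi> x, \<phi> y)) \<le> \<delta>"
  shows "\<exists>w :: nat \<Rightarrow> nat \<times> nat \<Rightarrow> real.
    (\<forall>i\<in>{1..k}. \<forall>z\<in>{..<n} \<times> {..<n}. 0 \<le> w i z) \<and>
    (\<forall>z\<in>{..<n} \<times> {..<n}. (\<Sum>i=1..k. w i z) = 1) \<and>
    (\<forall>i\<in>{1..k}. \<forall>u<n. \<forall>v<n. w i (u, v) = w i (v, u)) \<and>
    (\<forall>i\<in>{1..k}. cut_bounded {..<n} (\<lambda>z. of_bool (colour_matrix d c z = i) - w i z) (\<delta> * (real n)\<^sup>2)) \<and>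
    graphon_entropy k U \<le> (\<Sum>z\<in>{..<n} \<times> {..<n}. entropy_fun k (\<lambda>i. w i z)) / (real n)\<^sup>2"
proof -
  let ?M = "lebesgue_on unit_square" and ?V = "{..<n}"
  define \<Phi> where "\<Phi> = (\<lambda>(x, y). (\<phi> x, \<phi> y))"
  define p where "p i z = pmf (U (\<Phi> z)) i" for i z
  let ?I = "\<lambda>z. indicator (block n (fst z) \<times> block n (snd z)) :: _ \<Rightarrow> real"
  define w where "w i z = (real n)\<^sup>2 * (\<integral>y. ?I z y * p i y \<partial>?M)" for i z
  have pres: "square_preserving \<Phi>" unfolding \<Phi>_def by (rule measure_preserving_square[OF \<phi>])
  have \<phi>_in: "\<phi> x \<in> {0..1}" if "x \<in> {0..1}" for x
    using \<phi> that measurable_space[of \<phi> "lebesgue_on {0..1}" "lebesgue_on {0..1}" x]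
    by (auto simp: measure_preserving_maps_def space_restrict_space)
  have \<Phi>_in: "\<Phi> z \<in> unit_square" if "z \<in> unit_square" for z
    using that \<phi>_in by (cases z) (auto simp: \<Phi>_def)
  have pm: "p i \<in> borel_measurable ?M" if "i \<in> {1..k}" for i
    unfolding p_def by (rule square_preserving_compose(1)[OF pres kgraphon_measurable[OF U that]])
  have p0: "0 \<le> p i z" and p1: "p i z \<le> 1" for i z by (auto simp: p_def pmf_le_1)
  have psum: "(\<Sum>i=1..k. p i z) = 1" if "z \<in> unit_square" for z
    using kgraphonD(3)[OF U] \<Phi>_in[OF that] by (cases "\<Phi> z") (auto simp: p_def)
  have Im: "?I z \<in> borel_measurable ?M" for z by (intro indicator_Times_measurable) auto
  have Ip: "integrable ?M (\<lambda>y. ?I z y * p i y)" if "i \<in> {1..k}" for i z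
    using p0 p1 by (intro square_integrable_bounded[where B = 1] borel_measurable_times Im pm that) (auto simp: indicator_def)
  have I_int: "(\<integral>y. ?I z y \<partial>?M) = 1 / (real n)\<^sup>2" if "z \<in> ?V \<times> ?V" for z
  proof -
    have "block n (fst z) \<subseteq> {0..1}" "block n (snd z) \<subseteq> {0..1}" using that by (auto intro!: block_subset_closed)
    then show ?thesis using n by (subst integral_indicator_Times) (auto simp: measure_lborel_block power2_eq_square)
  qed
  have w0: "0 \<le> w i z" for i z
    unfolding w_def using p0 by (intro mult_nonneg_nonneg integral_nonneg_AE AE_I2) auto
  have wsum: "(\<Sum>i=1..k. w i z) = 1" if z: "z \<in> ?V \<times> ?V" for z
  proof -
    have "(\<Sum>i=1..k. \<integral>y. ?I z y * p i y \<partial>?M) = (\<integral>y. (\<Sum>i=1..k. ?I z y * p i y) \<partial>?M)"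
      by (rule Bochner_Integration.integral_sum[symmetric]) (rule Ip)
    also have "\<dots> = (\<integral>y. ?I z y \<partial>?M)"
    proof (intro Bochner_Integration.integral_cong refl)
      fix y assume "y \<in> space ?M"
      then have "y \<in> unit_square" by simp
      from psum[OF this] show "(\<Sum>i=1..k. ?I z y * p i y) = ?I z y" by (simp only: sum_distrib_left[symmetric] mult_1_right)
    qed
    finally show ?thesis using n I_int[OF z] by (simp add: w_def flip: sum_distrib_left)
  qed
  have wsym: "w i (u, v) = w i (v, u)" if i: "i \<in> {1..k}" for i u v
  proof -
    \<comment> \<open>Exchanging the two coordinates preserves the integral and turns the block
      \<open>(u, v)\<close> into \<open>(v, u)\<close>, while \<open>p\<close> is symmetric.\<close>
    have "(\<integral>y. ?I (u, v) y * p i y \<partial>?M) = (\<integral>y. ?I (u, v) (snd y, fst y) * p i (snd y, fst y) \<partial>?M)"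
      by (rule square_preserving_compose(2)[OF swap_square_preserving, symmetric])
        (intro borel_measurable_times Im pm i)
    also have "\<dots> = (\<integral>y. ?I (v, u) y * p i y \<partial>?M)"
    proof (intro Bochner_Integration.integral_cong refl)
      fix y assume "y \<in> space ?M"
      then have y: "fst y \<in> {0..1}" "snd y \<in> {0..1}" by auto
      have "U (\<phi> (snd y), \<phi> (fst y)) = U (\<phi> (fst y), \<phi> (snd y))"
        by (rule kgraphonD(2)[OF U \<phi>_in[OF y(2)] \<phi>_in[OF y(1)]])
      then have "p i (snd y, fst y) = p i y" by (simp add: p_def \<Phi>_def case_prod_beta)
      then show "?I (u, v) (snd y, fst y) * p i (snd y, fst y) = ?I (v, u) y * p i y"
        by (cases y) (auto simp: indicator_def)
    qed
    finally show ?thesis by (simp add: w_def)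
  qed
  have wcut: "cut_bounded ?V (\<lambda>z. of_bool (colour_matrix d c z = i) - w i z) (\<delta> * (real n)\<^sup>2)" if i: "i \<in> {1..k}" for i
  proof (rule cut_bounded_rectangles)
    fix A B assume AB: "A \<subseteq> ?V" "B \<subseteq> ?V"
    \<comment> \<open>On these test sets the step graphon and \<open>U\<close> composed with
      \<open>\<Phi>\<close> integrate to sums over \<open>A \<times> B\<close>, each cell having
      area \<open>1 / n\<^sup>2\<close>.\<close>
    define S T where "S = (\<Union>u\<in>A. block n u)" and "T = (\<Union>u\<in>B. block n u)"
    let ?F = "\<lambda>z. of_bool (colour_matrix d c z = i) :: real"
    have fin: "finite A" "finite B" using AB finite_subset by auto
    have ST: "S \<in> sets lebesgue" "T \<in> sets lebesgue" unfolding S_def T_def using fin by (auto intro!: sets.finite_UN)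
    have ST1: "S \<subseteq> {0..1}" "T \<subseteq> {0..1}"
      unfolding S_def T_def using AB block_subset_closed by (auto simp: subset_iff)
    let ?J = "indicator (S \<times> T) :: _ \<Rightarrow> real"
    have Jm: "?J \<in> borel_measurable ?M" by (intro indicator_Times_measurable ST)
    have SI: "S \<inter> block n u = (if u \<in> A then block n u else {})" "T \<inter> block n u = (if u \<in> B then block n u else {})" if "u \<in> ?V" for u
      unfolding S_def T_def using Union_block_Int[OF n AB(1), of u] Union_block_Int[OF n AB(2), of u] that by auto
    have sub: "A \<times> B \<subseteq> ?V \<times> ?V" using AB by auto
    have s1: "(\<integral>z. ?J z * step n ?F z \<partial>?M) = (\<Sum>z\<in>A \<times> B. ?F z) / (real n)\<^sup>2"
    proof -
      have "(\<integral>z. ?J z * step n ?F z \<partial>?M) = (\<Sum>z\<in>?V \<times> ?V. ?F z * (measure lebesgue (S \<inter> block n (fst z)) * measure lebesgue (T \<inter> block n (snd z))))"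
        by (rule integral_step[OF n ST ST1])
      also have "\<dots> = (\<Sum>z\<in>?V \<times> ?V. if z \<in> A \<times> B then ?F z / (real n)\<^sup>2 else 0)"
        using n by (intro sum.cong refl) (auto simp: SI measure_lborel_block power2_eq_square mem_Times_iff)
      also have "\<dots> = (\<Sum>z\<in>A \<times> B. ?F z / (real n)\<^sup>2)"
        using sub by (subst sum.inter_restrict[symmetric]) (auto simp: Int_absorb1)
      finally show ?thesis by (simp add: sum_divide_distrib)
    qed
    have s2: "(\<integral>z. ?J z * p i z \<partial>?M) = (\<Sum>z\<in>A \<times> B. w i z) / (real n)\<^sup>2"
    proof -
      have "(\<integral>z. ?J z * p i z \<partial>?M) = (\<Sum>z\<in>?V \<times> ?V. \<integral>y. ?I z y * (?J y * p i y) \<partial>?M)"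
        using p0 p1 by (intro integral_blocks[OF n, where B = 1] borel_measurable_times Jm pm i) (auto simp: indicator_def)
      also have "\<dots> = (\<Sum>z\<in>?V \<times> ?V. if z \<in> A \<times> B then w i z / (real n)\<^sup>2 else 0)"
      proof (intro sum.cong refl)
        fix z assume z: "z \<in> ?V \<times> ?V"
        have eq: "?I z y * (?J y * p i y) = (if z \<in> A \<times> B then ?I z y * p i y else 0)" for y
        proof -
          have "?I z y * ?J y = indicator ((S \<inter> block n (fst z)) \<times> (T \<inter> block n (snd z))) y"
            by (auto simp: indicator_def)
          also have "\<dots> = (if z \<in> A \<times> B then ?I z y else 0)" using z SI by (auto simp: mem_Times_iff)
          finally show ?thesis by (simp add: mult.assoc[symmetric])
        qed
        show "(\<integral>y. ?I z y * (?J y * p i y) \<partial>?M) = (if z \<in> A \<times> B then w i z / (real n)\<^sup>2 else 0)"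
          unfolding eq using n by (simp add: w_def)
      qed
      also have "\<dots> = (\<Sum>z\<in>A \<times> B. w i z / (real n)\<^sup>2)"
        using sub by (subst sum.inter_restrict[symmetric]) (auto simp: Int_absorb1)
      finally show ?thesis by (simp add: sum_divide_distrib)
    qed
    have Js: "integrable ?M (\<lambda>z. ?J z * step n ?F z)" "integrable ?M (\<lambda>z. ?J z * p i z)"
    proof -
      show "integrable ?M (\<lambda>z. ?J z * step n ?F z)"
        by (rule square_integrable_bounded[where B = 1])
          (intro borel_measurable_times Jm step_measurable abs_indicator_mult_le; simp add: step_def)+
      show "integrable ?M (\<lambda>z. ?J z * p i z)"
        using p0 p1 by (intro square_integrable_bounded[where B = 1] borel_measurable_times Jm pm i abs_indicator_mult_le)
    qed
    have "(LINT z : S \<times> T | lebesgue. pmf (step_graphon d n c z) i - pmf (case z of (x, y) \<Rightarrow> U (\<phi> x, \<phi> y)) i) =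
      (\<integral>z. ?J z * (pmf (step_graphon d n c z) i - p i z) \<partial>?M)"
      unfolding set_integral_square[OF ST1] by (simp add: p_def \<Phi>_def case_prod_beta)
    also have "\<dots> = (\<integral>z. ?J z * step n ?F z - ?J z * p i z \<partial>?M)"
    proof (rule integral_cong_AE)
      show "AE z in ?M. ?J z * (pmf (step_graphon d n c z) i - p i z) = ?J z * step n ?F z - ?J z * p i z"
        using AE_half_open by eventually_elim (simp add: pmf_step_graphon[OF n] right_diff_distrib)
    qed (intro borel_measurable_times borel_measurable_diff Jm pm i step_measurable step_graphon_measurable n)+
    also have "\<dots> = (\<Sum>z\<in>A \<times> B. ?F z - w i z) / (real n)\<^sup>2"
      using Js by (simp add: s1 s2 sum_subtractf diff_divide_distrib)
    finally have eq: "\<bar>\<Sum>z\<in>A \<times> B. ?F z - w i z\<bar> =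
      (real n)\<^sup>2 * \<bar>LINT z : S \<times> T | lebesgue. pmf (step_graphon d n c z) i - pmf (case z of (x, y) \<Rightarrow> U (\<phi> x, \<phi> y)) i\<bar>"
      using n by (simp add: abs_divide)
    have "\<bar>LINT z : S \<times> T | lebesgue. pmf (step_graphon d n c z) i - pmf (case z of (x, y) \<Rightarrow> U (\<phi> x, \<phi> y)) i\<bar> \<le>
      (\<Sum>i=1..k. \<bar>LINT z : S \<times> T | lebesgue. pmf (step_graphon d n c z) i - pmf (case z of (x, y) \<Rightarrow> U (\<phi> x, \<phi> y)) i\<bar>)"
      using i by (intro member_le_sum) auto
    also have "\<dots> \<le> \<delta>" using cut_diff_upper[OF ST ST1] cut by (rule order_trans)
    finally show "\<bar>\<Sum>z\<in>A \<times> B. ?F z - w i z\<bar> \<le> \<delta> * (real n)\<^sup>2"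
      unfolding eq by (subst mult.commute) (intro mult_right_mono, auto)
  qed simp
  have went: "graphon_entropy k U \<le> (\<Sum>z\<in>?V \<times> ?V. entropy_fun k (\<lambda>i. w i z)) / (real n)\<^sup>2"
  proof -
    have em: "(\<lambda>z. entropy_fun k (pmf (U z))) \<in> borel_measurable ?M"
      using entropy_measurable[of k "\<lambda>i z. pmf (U z) i"] kgraphon_measurable[OF U] by simp
    have eb: "\<bar>entropy_fun k (\<lambda>i. p i z)\<bar> \<le> 1" if "z \<in> unit_square" for z
      using entropy_fun_le_1[OF k, of "\<lambda>i. p i z"] entropy_fun_nonneg[OF k, of "\<lambda>i. p i z"] p0 p1 psum[OF that] by simp
    \<comment> \<open>The map \<open>\<Phi>\<close> preserves the measure, so rearranging
      \<open>U\<close> does not change its entropy.\<close>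
    have "graphon_entropy k U = (\<integral>z. entropy_fun k (\<lambda>i. p i z) \<partial>?M)"
      unfolding graphon_entropy_alt p_def using square_preserving_compose(2)[OF pres em] by simp
    also have "\<dots> = (\<Sum>z\<in>?V \<times> ?V. \<integral>y. ?I z y * entropy_fun k (\<lambda>i. p i y) \<partial>?M)"
      by (rule integral_blocks[OF n entropy_measurable eb]) (rule pm)
    also have "\<dots> \<le> (\<Sum>z\<in>?V \<times> ?V. entropy_fun k (\<lambda>i. w i z) / (real n)\<^sup>2)"
    proof (rule sum_mono)
      fix z assume z: "z \<in> ?V \<times> ?V"
      have jen: "(\<integral>y. ?I z y * - (p i y * log (real k) (p i y)) \<partial>?M) \<le> - (w i z * log (real k) (w i z)) / (real n)\<^sup>2"
        if "i \<in> {1..k}" for i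
        unfolding w_def using z k by (intro block_jensen(2) n pm that p0 p1) auto
      have int: "integrable ?M (\<lambda>y. ?I z y * - (p i y * log (real k) (p i y)))" if "i \<in> {1..k}" for i
      proof (rule square_integrable_bounded[where B = "2 / ln (real k)"])
        show "(\<lambda>y. ?I z y * - (p i y * log (real k) (p i y))) \<in> borel_measurable ?M"
          by (intro borel_measurable_times Im borel_measurable_uminus borel_measurable_log pm that) auto
        show "\<bar>?I z y * - (p i y * log (real k) (p i y))\<bar> \<le> 2 / ln (real k)" if "y \<in> unit_square" for y
        proof -
          have "- (p i y * log (real k) (p i y)) \<le> 2 / ln (real k)"
            using neg_xlog_le_sqrt[of "real k" "p i y" 1] p0 p1 k by simp
          moreover have "0 \<le> - (p i y * log (real k) (p i y))"
          proof (cases "p i y = 0")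
            case False
            then have "log (real k) (p i y) \<le> 0" using p0[of i y] p1[of i y] k by (simp add: less_le)
            then show ?thesis using p0 by (simp add: mult_nonneg_nonpos)
          qed simp
          ultimately show ?thesis by (intro abs_indicator_mult_le)
        qed
      qed
      have "(\<integral>y. ?I z y * entropy_fun k (\<lambda>i. p i y) \<partial>?M) = (\<Sum>i=1..k. \<integral>y. ?I z y * - (p i y * log (real k) (p i y)) \<partial>?M)"
        unfolding entropy_fun_alt sum_distrib_left by (rule Bochner_Integration.integral_sum) (rule int)
      also have "\<dots> \<le> (\<Sum>i=1..k. - (w i z * log (real k) (w i z)) / (real n)\<^sup>2)"
        by (rule sum_mono) (rule jen)
      finally show "(\<integral>y. ?I z y * entropy_fun k (\<lambda>i. p i y) \<partial>?M) \<le> entropy_fun k (\<lambda>i. w i z) / (real n)\<^sup>2"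
        unfolding entropy_fun_alt by (simp only: sum_divide_distrib)
    qed
    finally show ?thesis by (simp only: sum_divide_distrib)
  qed
  show ?thesis using w0 wsum wsym wcut went by (intro exI[of _ w] conjI ballI allI impI) auto
qed

text \<open>Order of limits: \<open>m\<close> and \<open>\<epsilon>\<close> stay fixed while
  \<open>j\<close> grows, so that the cut error vanishes in spite of its factor
  \<open>1 / \<epsilon> ^ N\<close>; only then does \<open>\<epsilon>\<close> tend to 0. The
  remaining loss \<open>m / 2\<close> comes from the diagonal squares.\<close>

theorem graphon_entropy_le_extremal:
  assumes k: "k \<ge> 2" and P: "order_hereditary k P" and U: "U \<in> limit_graphons k d P" and m: "m \<ge> 2"
  shows "(real m)\<^sup>2 / 2 * graphon_entropy k U - real m / 2 \<le> extremal_entropy k m P"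
proof -
  obtain n c where kU: "kgraphon k U" and c: "\<And>j. c j \<in> P (n j)" and n: "filterlim n at_top sequentially"
    and lim: "(\<lambda>j::nat. cut_dist k (step_graphon d (n j) (c j)) U) \<longlonglongrightarrow> 0"
    using U unfolding limit_graphons_def by blast
  define N where "N = m choose 2"
  \<comment> \<open>The positive summand puts \<open>\<delta> j\<close> strictly above the infimum,
    so some measure-preserving map achieves less.\<close>
  define \<delta> where "\<delta> j = cut_dist k (step_graphon d (n j) (c j)) U + 1 / real (Suc j)" for j
  have \<delta>: "\<delta> \<longlonglongrightarrow> 0 + 0" unfolding \<delta>_def by (intro tendsto_add lim LIMSEQ_Suc lim_1_over_n)
  have \<delta>0: "0 \<le> \<delta> j" for j unfolding \<delta>_def using cut_dist_nonneg[of k] by simp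
  have q: "filterlim (\<lambda>j. real (n j div m)) at_top sequentially"
  proof -
    have "filterlim (\<lambda>x. x div m) at_top at_top"
      unfolding filterlim_at_top
    proof
      fix Z :: nat
      show "\<forall>\<^sub>F x in at_top. Z \<le> x div m"
        using eventually_ge_at_top[of "Z * m"]
        by eventually_elim (use m in \<open>simp add: less_eq_div_iff_mult_less_eq\<close>)
    qed
    from filterlim_compose[OF this n] show ?thesis by (rule filterlim_compose[OF filterlim_real_sequentially])
  qed
  have bound: "(real m)\<^sup>2 / 2 * graphon_entropy k U - real m / 2 - real N * (3 * real k * sqrt \<epsilon> / ln (real k)) \<le> extremal_entropy k m P"
    if \<epsilon>: "0 < \<epsilon>" "\<epsilon> < 1 / real k" for \<epsilon>
  proof -
    define L where "L j = (real m)\<^sup>2 / 2 * graphon_entropy k U - real m / 2 - 2 * (real m)\<^sup>2 / real (n j div m)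
      - real N * (3 * real k * sqrt \<epsilon> / ln (real k)) - 4 * (real m)\<^sup>2 * real k ^ N * (real N)\<^sup>2 * \<delta> j / \<epsilon> ^ N" for j
    have "L \<longlonglongrightarrow> (real m)\<^sup>2 / 2 * graphon_entropy k U - real m / 2 - 0
      - real N * (3 * real k * sqrt \<epsilon> / ln (real k)) - 4 * (real m)\<^sup>2 * real k ^ N * (real N)\<^sup>2 * (0 + 0) / \<epsilon> ^ N"
      unfolding L_def by (intro tendsto_intros real_tendsto_divide_at_top[OF tendsto_const q] \<delta>) (use \<epsilon> in auto)
    moreover have "eventually (\<lambda>j. L j \<le> extremal_entropy k m P) sequentially"
      using filterlim_at_top[THEN iffD1, OF n, rule_format, of m]
    proof eventually_elim
      fix j assume nj: "m \<le> n j"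
      have "cut_dist k (step_graphon d (n j) (c j)) U < \<delta> j" by (simp add: \<delta>_def)
      then obtain \<phi> where \<phi>: "\<phi> \<in> measure_preserving_maps"
        "cut_diff k (step_graphon d (n j) (c j)) (\<lambda>(x, y). U (\<phi> x, \<phi> y)) < \<delta> j"
        unfolding cut_dist_def using id_measure_preserving
        by (subst (asm) cINF_less_iff) (auto intro!: bdd_belowI2[where m = 0] cut_diff_nonneg)
      have n0: "n j > 0" using nj m by simp
      from discretise_graphon[OF k kU n0 \<phi>(1) less_imp_le[OF \<phi>(2)]]
      obtain w where w: "\<forall>i\<in>{1..k}. \<forall>z\<in>{..<n j} \<times> {..<n j}. 0 \<le> w i z"
        "\<forall>z\<in>{..<n j} \<times> {..<n j}. (\<Sum>i=1..k. w i z) = 1"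
        "\<forall>i\<in>{1..k}. \<forall>u<n j. \<forall>v<n j. w i (u, v) = w i (v, u)"
        "\<forall>i\<in>{1..k}. cut_bounded {..<n j} (\<lambda>z. of_bool (colour_matrix d (c j) z = i) - w i z) (\<delta> j * (real (n j))\<^sup>2)"
        "graphon_entropy k U \<le> (\<Sum>z\<in>{..<n j} \<times> {..<n j}. entropy_fun k (\<lambda>i. w i z)) / (real (n j))\<^sup>2"
        by (elim exE conjE)
      let ?S = "(\<Sum>z\<in>{..<n j} \<times> {..<n j}. entropy_fun k (\<lambda>i. w i z)) / (real (n j))\<^sup>2"
      have "(real m)\<^sup>2 / 2 * graphon_entropy k U \<le> (real m)\<^sup>2 / 2 * ?S"
        by (intro mult_left_mono w(5)) simp
      moreover have "(real m)\<^sup>2 / 2 * ?S - real m / 2 - 2 * (real m)\<^sup>2 / real (n j div m)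
        - real N * (3 * real k * sqrt \<epsilon> / ln (real k)) - 4 * (real m)\<^sup>2 * real k ^ N * (real N)\<^sup>2 * \<delta> j / \<epsilon> ^ N
        \<le> extremal_entropy k m P"
        unfolding N_def using w by (intro extremal_entropy_lower_bound[OF k P c m nj \<epsilon> \<delta>0]) auto
      ultimately show "L j \<le> extremal_entropy k m P" unfolding L_def by linarith
    qed
    ultimately have "(real m)\<^sup>2 / 2 * graphon_entropy k U - real m / 2 - 0
      - real N * (3 * real k * sqrt \<epsilon> / ln (real k)) - 4 * (real m)\<^sup>2 * real k ^ N * (real N)\<^sup>2 * (0 + 0) / \<epsilon> ^ N \<le> extremal_entropy k m P"
      by (rule tendsto_upperbound) simp
    then show ?thesis by simp
  qed
  \<comment> \<open>The threshold is \<open>1 / (r + 1)\<close>, admissible once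
    \<open>r \<ge> k\<close>.\<close>
  define e where "e r = (real m)\<^sup>2 / 2 * graphon_entropy k U - real m / 2 - real N * (3 * real k * sqrt (1 / real (Suc r)) / ln (real k))" for r
  have "e \<longlonglongrightarrow> (real m)\<^sup>2 / 2 * graphon_entropy k U - real m / 2 - real N * (3 * real k * sqrt 0 / ln (real k))"
    unfolding e_def using k by (intro tendsto_intros LIMSEQ_Suc[OF lim_1_over_n]) auto
  moreover have "eventually (\<lambda>r. e r \<le> extremal_entropy k m P) sequentially"
    using eventually_ge_at_top[of k]
  proof eventually_elim
    fix r assume "k \<le> r"
    then have "1 / real (Suc r) < 1 / real k" using k by (intro divide_strict_left_mono) auto
    then show "e r \<le> extremal_entropy k m P" unfolding e_def by (intro bound) auto
  qed
  ultimately have "(real m)\<^sup>2 / 2 * graphon_entropy k U - real m / 2 - real N * (3 * real k * sqrt 0 / ln (real k)) \<le> extremal_entropy k m P"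
    by (rule tendsto_upperbound) simp
  then show ?thesis by simp
qed

section \<open>Many colourings with the same block densities\<close>

text \<open>Gibbs' inequality between the uniform distribution on \<open>Q\<close> and the product
  of its edge marginals. The product distribution has total mass 1 on all colourings, hence at most
  1 on \<open>Q\<close>.\<close>

lemma entropy_subadditive:
  assumes k: "k \<ge> 2" and Q: "Q \<subseteq> colourings k n" "Q \<noteq> {}"
  defines "p \<equiv> \<lambda>e i. real (card {c\<in>Q. c e = i}) / real (card Q)"
  shows "log (real k) (real (card Q)) \<le> (\<Sum>e\<in>edges n. entropy_fun k (p e))"
proof -
  have fin: "finite Q" using Q finite_colourings finite_subset by blast
  define N where "N = real (card Q)"
  have N: "N > 0" using fin Q by (simp add: N_def card_gt_0_iff)
  have lk: "ln (real k) > 0" using k by simp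
  have col: "c e \<in> {1..k}" if "c \<in> Q" "e \<in> edges n" for c e
  proof -
    have "c \<in> edges n \<rightarrow>\<^sub>E {1..k}" using Q(1) that(1) unfolding colourings_def by (rule subsetD)
    then show ?thesis using that(2) by (rule PiE_mem)
  qed
  have p0: "0 \<le> p e i" for e i by (simp add: p_def)
  have ppos: "0 < p e (c e)" if "c \<in> Q" for c e
  proof -
    have "c \<in> {c'\<in>Q. c' e = c e}" using that by simp
    then have "card {c'\<in>Q. c' e = c e} > 0" using fin by (auto simp: card_gt_0_iff)
    then show ?thesis using N by (simp add: p_def N_def)
  qed
  have count: "(\<Sum>c\<in>Q. g (c e)) = (\<Sum>i=1..k. N * p e i * g i)" if e: "e \<in> edges n" for e and g :: "nat \<Rightarrow> real"
  proof -
    have "(\<Sum>c\<in>Q. g (c e)) = (\<Sum>i=1..k. \<Sum>c\<in>{c\<in>Q. c e = i}. g (c e))"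
      using fin col e by (intro sum.group[symmetric]) auto
    also have "\<dots> = (\<Sum>i=1..k. real (card {c\<in>Q. c e = i}) * g i)" by simp
    also have "\<dots> = (\<Sum>i=1..k. N * p e i * g i)" using N by (simp add: p_def N_def)
    finally show ?thesis .
  qed
  have psum: "(\<Sum>i=1..k. p e i) = 1" if e: "e \<in> edges n" for e
  proof -
    have "N = N * (\<Sum>i=1..k. p e i)"
      using count[OF e, of "\<lambda>_. 1"] by (simp add: N_def sum_distrib_left)
    then show ?thesis using N by simp
  qed
  define \<pi> where "\<pi> c = (\<Prod>e\<in>edges n. p e (c e))" for c
  have \<pi>pos: "0 < \<pi> c" if "c \<in> Q" for c unfolding \<pi>_def using ppos[OF that] by (intro prod_pos) auto
  have "(\<Sum>c\<in>Q. \<pi> c) \<le> (\<Sum>c\<in>colourings k n. \<pi> c)"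
    unfolding \<pi>_def using Q(1) p0 by (intro sum_mono2 prod_nonneg finite_colourings) auto
  also have "\<dots> = (\<Prod>e\<in>edges n. \<Sum>i=1..k. p e i)"
    unfolding \<pi>_def colourings_def by (rule prod_sum_PiE[symmetric]) auto
  also have "\<dots> = 1" using psum by simp
  finally have \<pi>sum: "(\<Sum>c\<in>Q. \<pi> c) \<le> 1" .
  \<comment> \<open>Here \<open>N * \<pi> c\<close> is the likelihood ratio of the product measure
    to the uniform one, so \<open>ln x \<le> x - 1\<close> makes the sum nonpositive.\<close>
  have "(\<Sum>c\<in>Q. ln (N * \<pi> c)) \<le> (\<Sum>c\<in>Q. N * \<pi> c - 1)"
    using N \<pi>pos by (intro sum_mono ln_le_minus_one) simp
  also have "\<dots> = N * (\<Sum>c\<in>Q. \<pi> c) - N" by (simp add: sum_subtractf sum_distrib_left N_def)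
  also have "\<dots> \<le> 0" using \<pi>sum N by simp
  finally have "(\<Sum>c\<in>Q. ln (N * \<pi> c)) \<le> 0" .
  moreover have "(\<Sum>c\<in>Q. ln (N * \<pi> c)) = N * ln N + (\<Sum>c\<in>Q. \<Sum>e\<in>edges n. ln (p e (c e)))"
  proof -
    have "ln (N * \<pi> c) = ln N + (\<Sum>e\<in>edges n. ln (p e (c e)))" if "c \<in> Q" for c
    proof -
      have "ln (\<pi> c) = (\<Sum>e\<in>edges n. ln (p e (c e)))"
        unfolding \<pi>_def
      proof (rule ln_prod)
        show "p e (c e) \<noteq> 0" for e using ppos[OF that, of e] by simp
      qed simp
      then show ?thesis using N \<pi>pos[OF that] by (simp add: ln_mult)
    qed
    then show ?thesis by (simp add: sum.distrib N_def)
  qed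
  moreover have "(\<Sum>c\<in>Q. \<Sum>e\<in>edges n. ln (p e (c e))) = - (N * ln (real k) * (\<Sum>e\<in>edges n. entropy_fun k (p e)))"
  proof -
    have "(\<Sum>c\<in>Q. ln (p e (c e))) = - (N * ln (real k) * entropy_fun k (p e))" if e: "e \<in> edges n" for e
    proof -
      have "(\<Sum>c\<in>Q. ln (p e (c e))) = (\<Sum>i=1..k. N * p e i * ln (p e i))" by (rule count[OF e])
      also have "\<dots> = - (N * ln (real k) * entropy_fun k (p e))"
      proof -
        have "N * p e i * ln (p e i) = N * ln (real k) * (p e i * log (real k) (p e i))" for i
          using k by (simp add: log_def)
        then show ?thesis
          unfolding entropy_fun_def by (simp only: sum_distrib_left mult_minus_right minus_minus)
      qed
      finally show ?thesis .
    qed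
    then show ?thesis by (subst sum.swap) (simp add: sum_negf sum_distrib_left)
  qed
  ultimately have "N * ln N \<le> N * (ln (real k) * (\<Sum>e\<in>edges n. entropy_fun k (p e)))"
    by (simp add: mult.assoc)
  then have "ln N \<le> ln (real k) * (\<Sum>e\<in>edges n. entropy_fun k (p e))" using N by simp
  then have "ln N / ln (real k) \<le> (\<Sum>e\<in>edges n. entropy_fun k (p e))"
    using lk by (simp add: pos_divide_le_eq mult.commute)
  then show ?thesis by (simp add: log_def N_def)
qed

definition colour_indicator :: "nat \<Rightarrow> (nat set \<Rightarrow> nat) \<Rightarrow> nat \<Rightarrow> nat \<times> nat \<Rightarrow> real" where
  "colour_indicator d c i z = of_bool (colour_matrix d c z = i)"

lemma colour_matrix_mem:
  assumes "c \<in> colourings k n" "d \<in> {1..k}" "z \<in> {..<n} \<times> {..<n}"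
  shows "colour_matrix d c z \<in> {1..k}"
proof (cases "fst z = snd z")
  case True
  then show ?thesis using assms(2) by (simp only: colour_matrix_def if_True simp_thms)
next
  case False
  then have "{Suc (fst z), Suc (snd z)} \<in> edges n" using assms(3) by (auto simp: edges_def)
  moreover have "c \<in> edges n \<rightarrow>\<^sub>E {1..k}" using assms(1) by (simp only: colourings_def)
  ultimately have "c {Suc (fst z), Suc (snd z)} \<in> {1..k}" by (rule PiE_mem[rotated])
  then show ?thesis using False by (simp only: colour_matrix_def if_False simp_thms)
qed

lemma sum_colour_indicator:
  assumes "c \<in> colourings k n" "d \<in> {1..k}" "z \<in> {..<n} \<times> {..<n}"
  shows "(\<Sum>i=1..k. colour_indicator d c i z) = 1"
proof -
  have "(\<Sum>i=1..k. colour_indicator d c i z) = (\<Sum>i=1..k. if colour_matrix d c z = i then 1 else 0)"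
    by (intro sum.cong refl) (simp add: colour_indicator_def)
  also have "\<dots> = 1" using colour_matrix_mem[OF assms] by (subst sum.delta') auto
  finally show ?thesis .
qed

text \<open>Off the diagonal the mean indicators are the edge marginals of the uniform distribution
  on \<open>Q\<close>. The factor 2 arises because an edge is met in both orders; diagonal entries
  contribute nonnegatively.\<close>

lemma entropy_mean_colour_indicator:
  assumes k: "k \<ge> 2" and d: "d \<in> {1..k}" and Q: "Q \<subseteq> colourings k n" "Q \<noteq> {}"
  shows "2 * log (real k) (real (card Q)) \<le>
    (\<Sum>z\<in>{..<n} \<times> {..<n}. entropy_fun k (\<lambda>i. (\<Sum>c\<in>Q. colour_indicator d c i z) / real (card Q)))"
proof -
  have fin: "finite Q" using Q finite_colourings finite_subset by blast
  define p where "p e i = real (card {c\<in>Q. c e = i}) / real (card Q)" for e i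
  define h where "h z = entropy_fun k (\<lambda>i. (\<Sum>c\<in>Q. colour_indicator d c i z) / real (card Q))" for z
  let ?V = "{..<n} \<times> {..<n}"
  have h0: "0 \<le> h z" for z
  proof -
    have "(\<Sum>c\<in>Q. colour_indicator d c i z) \<le> (\<Sum>c\<in>Q. 1)" for i by (intro sum_mono) (simp add: colour_indicator_def)
    then show ?thesis unfolding h_def using fin Q(2)
      by (intro entropy_fun_nonneg[OF k] divide_nonneg_nonneg sum_nonneg)
        (auto simp: colour_indicator_def divide_le_eq card_gt_0_iff)
  qed
  have h_edge: "h (u, v) = entropy_fun k (p {Suc u, Suc v})" if "u \<noteq> v" for u v
  proof -
    have "(\<Sum>c\<in>Q. colour_indicator d c i (u, v)) = real (card {c\<in>Q. c {Suc u, Suc v} = i})" for i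
      using that fin by (simp add: colour_indicator_def colour_matrix_def of_bool_def flip: sum.inter_filter)
    then show ?thesis by (simp add: h_def p_def[abs_def])
  qed
  have up: "(\<Sum>z\<in>{z\<in>?V. fst z < snd z}. h z) = (\<Sum>e\<in>edges n. entropy_fun k (p e))"
    unfolding sum_edges
    by (rule sum.reindex_bij_witness[of _ "\<lambda>(a, b). (a - 1, b - 1)" "\<lambda>(u, v). (Suc u, Suc v)"])
      (auto simp: pairs_def h_edge)
  have down: "(\<Sum>z\<in>{z\<in>?V. snd z < fst z}. h z) = (\<Sum>e\<in>edges n. entropy_fun k (p e))"
    unfolding sum_edges
    by (rule sum.reindex_bij_witness[of _ "\<lambda>(a, b). (b - 1, a - 1)" "\<lambda>(u, v). (Suc v, Suc u)"])
      (auto simp: pairs_def h_edge insert_commute)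
  have "(\<Sum>z\<in>{z\<in>?V. fst z < snd z}. h z) + (\<Sum>z\<in>{z\<in>?V. snd z < fst z}. h z) =
      (\<Sum>z\<in>{z\<in>?V. fst z < snd z} \<union> {z\<in>?V. snd z < fst z}. h z)"
    by (rule sum.union_disjoint[symmetric]) auto
  also have "\<dots> \<le> (\<Sum>z\<in>?V. h z)" using h0 by (intro sum_mono2) auto
  finally have "2 * (\<Sum>e\<in>edges n. entropy_fun k (p e)) \<le> (\<Sum>z\<in>?V. h z)" unfolding up down by simp
  moreover have "log (real k) (real (card Q)) \<le> (\<Sum>e\<in>edges n. entropy_fun k (p e))"
    using entropy_subadditive[OF k Q] by (simp add: p_def[abs_def])
  ultimately show ?thesis unfolding h_def by linarith
qed

text \<open>Members of one class \<open>Q\<close> share the regularising permutation and all block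
  counts, so the mean colouring of the class has the block densities of each member. Its entropy is
  at least twice the logarithm of the class size, and averaging over blocks only raises it. The two
  subtracted terms bound the logarithm of the number of classes.\<close>

lemma regular_colouring_of_large_entropy:
  assumes k: "k \<ge> 2" and d: "d \<in> {1..k}" and P: "P \<subseteq> colourings k n" "P \<noteq> {}" and n: "n > 0"
  shows "\<exists>c\<in>P. \<exists>\<sigma>. bij_betw \<sigma> {..<n} {..<n} \<and>
    (\<forall>M l b i. 0 < M \<and> M \<le> j \<and> n = b * 2 ^ l \<and> i \<in> {1..k} \<longrightarrow>
      cut_bounded {..<n} (\<lambda>z. colour_indicator d c i (map_prod \<sigma> \<sigma> z) -
          avg2 {..<n} (\<lambda>u. u div b) (colour_indicator d c i \<circ> map_prod \<sigma> \<sigma>) z)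
        ((2 / sqrt M + 2 * 4 ^ M / 2 ^ l) * (real n)\<^sup>2)) \<and>
    (\<forall>l b. l \<le> j \<and> n = b * 2 ^ l \<longrightarrow>
      2 * (log (real k) (real (card P)) - n * log (real k) n - (Suc j * k * 4 ^ j) * log (real k) (real (n\<^sup>2 + 1))) \<le>
      (\<Sum>z\<in>{..<n} \<times> {..<n}. entropy_fun k (\<lambda>i. avg2 {..<n} (\<lambda>u. u div b) (colour_indicator d c i \<circ> map_prod \<sigma> \<sigma>) z)))"
proof -
  let ?V = "{..<n}"
  define reg where "reg c \<sigma> \<longleftrightarrow> (\<forall>M l b i. 0 < M \<and> M \<le> j \<and> n = b * 2 ^ l \<and> i \<in> {1..k} \<longrightarrow>
      cut_bounded ?V (\<lambda>z. colour_indicator d c i (map_prod \<sigma> \<sigma> z) -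
          avg2 ?V (\<lambda>u. u div b) (colour_indicator d c i \<circ> map_prod \<sigma> \<sigma>) z)
        ((2 / sqrt M + 2 * 4 ^ M / 2 ^ l) * (real n)\<^sup>2))" for c \<sigma>
  have ex: "\<exists>\<sigma>. bij_betw \<sigma> ?V ?V \<and> reg c \<sigma>" if c: "c \<in> P" for c
  proof -
    have cc: "c \<in> colourings k n" using P(1) c by blast
    have "\<exists>\<sigma>. bij_betw \<sigma> ?V ?V \<and> (\<forall>M l b. 0 < M \<and> M \<le> j \<and> n = b * 2 ^ l \<longrightarrow>
      (\<forall>i\<in>{1..k}. cut_bounded ?V (\<lambda>z. colour_indicator d c i (map_prod \<sigma> \<sigma> z) -
          avg2 ?V (\<lambda>u. u div b) (colour_indicator d c i \<circ> map_prod \<sigma> \<sigma>) z)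
        ((2 / sqrt M + 2 * 4 ^ M / 2 ^ l) * (real n)\<^sup>2)))"
    proof (rule sorted_regularity[OF n])
      show "(\<Sum>i=1..k. colour_indicator d c i z) \<le> 1" if "z \<in> ?V \<times> ?V" for z
        using sum_colour_indicator[OF cc d that] by simp
    qed (use k in \<open>auto simp: colour_indicator_def\<close>)
    then show ?thesis unfolding reg_def by blast
  qed
  define s where "s c = (SOME \<sigma>. bij_betw \<sigma> ?V ?V \<and> reg c \<sigma>)" for c
  have s: "bij_betw (s c) ?V ?V" "reg c (s c)" if "c \<in> P" for c
    using someI_ex[OF ex[OF that]] by (simp_all add: s_def)
  define D where "D = {..j} \<times> {1..k} \<times> {..<(2::nat) ^ j} \<times> {..<(2::nat) ^ j}"
  define cnt where "cnt c = (\<lambda>(l, i, z)\<in>D. card {y \<in> ?V \<times> ?V. map_prod (\<lambda>u. u div (n div 2 ^ l)) (\<lambda>u. u div (n div 2 ^ l)) y = z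
      \<and> colour_matrix d c (map_prod (s c) (s c) y) = i})" for c
  define key where "key c = (restrict (s c) ?V, cnt c)" for c
  define B where "B = (?V \<rightarrow>\<^sub>E ?V) \<times> (D \<rightarrow>\<^sub>E {..n * n})"
  have finD: "finite D" by (simp add: D_def)
  have finB: "finite B" unfolding B_def using finD by (intro finite_cartesian_product finite_PiE) auto
  have card_D: "card D = Suc j * k * 4 ^ j"
  proof -
    have "(2::nat) ^ j * 2 ^ j = 4 ^ j" by (simp flip: power_mult_distrib)
    then show ?thesis by (simp add: D_def card_cartesian_product algebra_simps)
  qed
  have card_B: "card B = n ^ n * (n * n + 1) ^ card D"
    using finD by (simp add: B_def card_cartesian_product card_PiE)
  have keyB: "key \<in> P \<rightarrow> B"
  proof
    fix c assume c: "c \<in> P"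
    have "restrict (s c) ?V \<in> ?V \<rightarrow>\<^sub>E ?V" using s(1)[OF c] by (auto simp: bij_betw_def)
    moreover have "cnt c \<in> D \<rightarrow>\<^sub>E {..n * n}"
    proof (rule PiE_I)
      fix x assume x: "x \<in> D"
      obtain l i z where x_eq: "x = (l, i, z)" by (cases x)
      have "card {y \<in> ?V \<times> ?V. R y} \<le> card (?V \<times> ?V)" for R by (rule card_mono) auto
      then show "cnt c x \<in> {..n * n}" using x by (simp add: cnt_def x_eq card_cartesian_product)
    qed (auto simp: cnt_def)
    ultimately show "key c \<in> B" by (simp add: key_def B_def)
  qed
  have finP: "finite P" using P finite_colourings finite_subset by blast
  have "B \<noteq> {}" using keyB P(2) by auto
  from pigeonhole_card[OF keyB finP finB this]
  obtain y where y: "card P \<le> card (key -` {y} \<inter> P) * card B" by auto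
  define Q where "Q = key -` {y} \<inter> P"
  have QP: "Q \<subseteq> P" by (auto simp: Q_def)
  have "card P > 0" using finP P(2) by (simp add: card_gt_0_iff)
  then have "0 < card Q * card B" using y unfolding Q_def by (rule less_le_trans)
  then have Q0: "card Q > 0" "card B > 0" by simp_all
  then have Qne: "Q \<noteq> {}" by auto
  then obtain c where c: "c \<in> Q" by blast
  let ?b = "real k"
  have logP: "log ?b (card P) \<le> log ?b (card Q) + n * log ?b n + (Suc j * k * 4 ^ j) * log ?b (real (n\<^sup>2 + 1))"
  proof -
    have "real (card P) \<le> real (card Q) * real (card B)" using y unfolding Q_def by (simp flip: of_nat_mult)
    then have "log ?b (card P) \<le> log ?b (real (card Q) * real (card B))"
      using \<open>card P > 0\<close> Q0 k by (intro log_mono) auto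
    also have "\<dots> = log ?b (card Q) + log ?b (card B)" using Q0 by (simp add: log_mult)
    also have "real (card B) = real n ^ n * real (n\<^sup>2 + 1) ^ (Suc j * k * 4 ^ j)"
      by (simp add: card_B card_D power2_eq_square)
    also have "log ?b (real n ^ n * real (n\<^sup>2 + 1) ^ (Suc j * k * 4 ^ j)) = n * log ?b n + (Suc j * k * 4 ^ j) * log ?b (real (n\<^sup>2 + 1))"
    proof -
      have "0 < real (n\<^sup>2 + 1)" by (simp add: add_pos_nonneg)
      then show ?thesis using n by (simp add: log_mult log_nat_power del: of_nat_add of_nat_power)
    qed
    finally show ?thesis by simp
  qed
  have same_s: "s c' u = s c u" if "c' \<in> Q" "u \<in> ?V" for c' u
  proof -
    have "key c' = key c" using that c by (simp add: Q_def)
    then have "restrict (s c') ?V u = restrict (s c) ?V u" by (simp add: key_def)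
    then show ?thesis using that(2) by simp
  qed
  let ?\<sigma> = "map_prod (s c) (s c)"
  have bij: "bij_betw (s c) ?V ?V" using s(1) c QP by blast
  have bij2: "bij_betw ?\<sigma> (?V \<times> ?V) (?V \<times> ?V)" by (rule bij_betw_map_prod) (use bij in auto)
  have ent: "2 * log ?b (card Q) \<le> (\<Sum>z\<in>?V \<times> ?V. entropy_fun k (\<lambda>i. avg2 ?V (\<lambda>u. u div b) (colour_indicator d c i \<circ> ?\<sigma>) z))"
    if l: "l \<le> j" and nb: "n = b * 2 ^ l" for l b
  proof -
    have b: "b > 0" using n nb by (cases b) auto
    have ndiv: "n div 2 ^ l = b" using nb by simp
    let ?B = "map_prod (\<lambda>u. u div b) (\<lambda>u. u div b)"
    have same: "avg2 ?V (\<lambda>u. u div b) (colour_indicator d c' i \<circ> ?\<sigma>) z = avg2 ?V (\<lambda>u. u div b) (colour_indicator d c i \<circ> ?\<sigma>) z"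
      if c': "c' \<in> Q" and i: "i \<in> {1..k}" and z: "z \<in> ?V \<times> ?V" for c' i z
    proof -
      have "?B z \<in> {..<2 ^ l} \<times> {..<2 ^ l}"
        using z nb b by (cases z) (auto simp: less_mult_imp_div_less mult.commute)
      moreover have "{..<(2::nat) ^ l} \<times> {..<(2::nat) ^ l} \<subseteq> {..<2 ^ j} \<times> {..<2 ^ j}"
        using power_increasing[OF l, of "2::nat"] by (intro Sigma_mono) auto
      ultimately have "?B z \<in> {..<2 ^ j} \<times> {..<2 ^ j}" by (rule subsetD[rotated])
      then have D: "(l, i, ?B z) \<in> D" using l i by (auto simp: D_def)
      have count: "(\<Sum>y\<in>{y \<in> ?V \<times> ?V. ?B y = ?B z}. (colour_indicator d c'' i \<circ> ?\<sigma>) y) = real (cnt c'' (l, i, ?B z))" if c'': "c'' \<in> Q" for c''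
      proof -
        have "(\<Sum>y\<in>{y \<in> ?V \<times> ?V. ?B y = ?B z}. (colour_indicator d c'' i \<circ> ?\<sigma>) y) =
          (\<Sum>y\<in>{y \<in> ?V \<times> ?V. ?B y = ?B z}. if colour_matrix d c'' (map_prod (s c'') (s c'') y) = i then 1 else 0)"
          by (intro sum.cong refl) (auto simp: colour_indicator_def same_s[OF c''])
        also have "\<dots> = real (card {y \<in> {y \<in> ?V \<times> ?V. ?B y = ?B z}. colour_matrix d c'' (map_prod (s c'') (s c'') y) = i})"
          by (subst sum.inter_filter[symmetric]) auto
        also have "{y \<in> {y \<in> ?V \<times> ?V. ?B y = ?B z}. colour_matrix d c'' (map_prod (s c'') (s c'') y) = i} =
          {y \<in> ?V \<times> ?V. ?B y = ?B z \<and> colour_matrix d c'' (map_prod (s c'') (s c'') y) = i}" by auto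
        finally show ?thesis using D by (simp add: cnt_def ndiv)
      qed
      have "key c' = key c" using c' c by (simp add: Q_def)
      then have "cnt c' = cnt c" by (simp add: key_def)
      then show ?thesis unfolding fibre_avg_def using count[OF c'] count[OF c] by simp
    qed
    define g where "g i z = (\<Sum>c\<in>Q. colour_indicator d c i z) / real (card Q)" for i z
    have g0: "0 \<le> g i z" for i z by (auto simp: g_def colour_indicator_def intro!: divide_nonneg_nonneg sum_nonneg)
    have "2 * log ?b (card Q) \<le> (\<Sum>z\<in>?V \<times> ?V. entropy_fun k (\<lambda>i. g i z))"
      unfolding g_def using QP P(1) Qne by (intro entropy_mean_colour_indicator k d) auto
    also have "\<dots> = (\<Sum>z\<in>?V \<times> ?V. entropy_fun k (\<lambda>i. (g i \<circ> ?\<sigma>) z))"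
      by (subst sum.reindex_bij_betw[OF bij2, symmetric]) simp
    also have "\<dots> \<le> (\<Sum>z\<in>?V \<times> ?V. entropy_fun k (\<lambda>i. avg2 ?V (\<lambda>u. u div b) (g i \<circ> ?\<sigma>) z))"
      using g0 by (intro entropy_fun_fibre_avg k) auto
    also have "\<dots> = (\<Sum>z\<in>?V \<times> ?V. entropy_fun k (\<lambda>i. avg2 ?V (\<lambda>u. u div b) (colour_indicator d c i \<circ> ?\<sigma>) z))"
    proof (rule sum.cong[OF refl])
      fix z assume z: "z \<in> ?V \<times> ?V"
      \<comment> \<open>Averages over the class and over a block commute, and every member of the
        class contributes the same block average.\<close>
      have "avg2 ?V (\<lambda>u. u div b) (g i \<circ> ?\<sigma>) z = avg2 ?V (\<lambda>u. u div b) (colour_indicator d c i \<circ> ?\<sigma>) z" if i: "i \<in> {1..k}" for i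
      proof -
        have "avg2 ?V (\<lambda>u. u div b) (g i \<circ> ?\<sigma>) z =
          (\<Sum>c'\<in>Q. avg2 ?V (\<lambda>u. u div b) (colour_indicator d c' i \<circ> ?\<sigma>) z) / real (card Q)"
          unfolding fibre_avg_sum[symmetric] by (simp add: fibre_avg_def g_def o_def flip: sum_divide_distrib)
        also have "\<dots> = avg2 ?V (\<lambda>u. u div b) (colour_indicator d c i \<circ> ?\<sigma>) z"
          using same[OF _ i z] Q0 by simp
        finally show ?thesis .
      qed
      then show "entropy_fun k (\<lambda>i. avg2 ?V (\<lambda>u. u div b) (g i \<circ> ?\<sigma>) z) =
        entropy_fun k (\<lambda>i. avg2 ?V (\<lambda>u. u div b) (colour_indicator d c i \<circ> ?\<sigma>) z)"
        unfolding entropy_fun_def by (intro arg_cong[of _ _ uminus] sum.cong) auto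
    qed
    finally show ?thesis .
  qed
  have "reg c (s c)" using s(2) c QP by blast
  moreover have "\<forall>l b. l \<le> j \<and> n = b * 2 ^ l \<longrightarrow>
      2 * (log ?b (real (card P)) - n * log ?b n - (Suc j * k * 4 ^ j) * log ?b (real (n\<^sup>2 + 1))) \<le>
      (\<Sum>z\<in>?V \<times> ?V. entropy_fun k (\<lambda>i. avg2 ?V (\<lambda>u. u div b) (colour_indicator d c i \<circ> ?\<sigma>) z))"
  proof (intro allI impI)
    fix l b assume "l \<le> j \<and> n = b * 2 ^ l"
    then have "2 * log ?b (card Q) \<le> (\<Sum>z\<in>?V \<times> ?V. entropy_fun k (\<lambda>i. avg2 ?V (\<lambda>u. u div b) (colour_indicator d c i \<circ> ?\<sigma>) z))"
      using ent by blast
    moreover have "log ?b (real (card P)) - n * log ?b n - (Suc j * k * 4 ^ j) * log ?b (real (n\<^sup>2 + 1)) \<le> log ?b (card Q)"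
      unfolding diff_le_eq using logP by (simp only: add_ac)
    then have "2 * (log ?b (real (card P)) - n * log ?b n - (Suc j * k * 4 ^ j) * log ?b (real (n\<^sup>2 + 1))) \<le> 2 * log ?b (card Q)"
      by (rule mult_left_mono) simp
    ultimately show "2 * (log ?b (real (card P)) - n * log ?b n - (Suc j * k * 4 ^ j) * log ?b (real (n\<^sup>2 + 1))) \<le>
      (\<Sum>z\<in>?V \<times> ?V. entropy_fun k (\<lambda>i. avg2 ?V (\<lambda>u. u div b) (colour_indicator d c i \<circ> ?\<sigma>) z))"
      by (rule order_trans[rotated])
  qed
  moreover have "c \<in> P" using c QP by blast
  ultimately show ?thesis unfolding reg_def using bij by (intro bexI[of _ c] exI[of _ "s c"] conjI)
qed

section \<open>Limits of block densities\<close>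

lemma tendsto_xlog:
  fixes p :: "nat \<Rightarrow> real"
  assumes b: "1 < b" and p: "p \<longlonglongrightarrow> q" "\<And>r. 0 \<le> p r" "\<And>r. p r \<le> 1"
  shows "(\<lambda>r. p r * log b (p r)) \<longlonglongrightarrow> q * log b q"
proof (cases "q = 0")
  case False
  have "0 \<le> q" by (rule LIMSEQ_le_const[OF p(1)]) (intro exI allI impI p(2))
  then have q: "0 < q" using False by simp
  have "(\<lambda>r. log b (p r)) \<longlonglongrightarrow> log b q"
    unfolding log_def by (intro tendsto_divide tendsto_ln p(1) tendsto_const) (use q b in simp_all)
  then show ?thesis by (rule tendsto_mult[OF p(1)])
next
  case True
  have "\<bar>p r * log b (p r)\<bar> \<le> 2 * sqrt (p r) / ln b" for r
  proof -
    have "0 \<le> - (p r * log b (p r))"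
    proof (cases "p r = 0")
      case False
      then have "log b (p r) \<le> 0" using p(2)[of r] p(3)[of r] b by simp
      then show ?thesis using p(2)[of r] by (simp add: mult_nonneg_nonpos)
    qed simp
    then have "\<bar>p r * log b (p r)\<bar> = - (p r * log b (p r))" by (intro abs_of_nonpos) linarith
    also have "\<dots> \<le> 2 * sqrt (p r) / ln b" by (rule neg_xlog_le_sqrt[OF b p(2) order_refl])
    finally show ?thesis .
  qed
  moreover have "(\<lambda>r. 2 * sqrt (p r) / ln b) \<longlonglongrightarrow> 2 * sqrt 0 / ln b"
  proof (intro tendsto_divide tendsto_mult tendsto_const tendsto_real_sqrt)
    show "p \<longlonglongrightarrow> 0" using p(1) True by simp
    show "ln b \<noteq> 0" using b by simp
  qed
  then have "(\<lambda>r. 2 * sqrt (p r) / ln b) \<longlonglongrightarrow> 0" by simp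
  moreover note Lim_null_comparison[where f = "\<lambda>r. p r * log b (p r)" and g = "\<lambda>r. 2 * sqrt (p r) / ln b" and net = sequentially]
  ultimately have "(\<lambda>r. p r * log b (p r)) \<longlonglongrightarrow> 0" by simp
  then show ?thesis using True by simp
qed

lemma tendsto_entropy_fun:
  assumes k: "k \<ge> 2" and p: "\<And>i. i \<in> {1..k} \<Longrightarrow> (\<lambda>r. p r i) \<longlonglongrightarrow> q i"
    "\<And>i r. i \<in> {1..k} \<Longrightarrow> 0 \<le> p r i" "\<And>i r. i \<in> {1..k} \<Longrightarrow> p r i \<le> 1"
  shows "(\<lambda>r. entropy_fun k (p r)) \<longlonglongrightarrow> entropy_fun k q"
  unfolding entropy_fun_def
proof (intro tendsto_minus tendsto_sum)
  fix i assume i: "i \<in> {1..k}"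
  show "(\<lambda>r. p r i * log (real k) (p r i)) \<longlonglongrightarrow> q i * log (real k) (q i)"
    by (rule tendsto_xlog) (use k p(1)[OF i] p(2)[OF i] p(3)[OF i] in simp_all)
qed

text \<open>By monotone convergence the integral of the sum is at most the sum of \<open>a\<close>,
  hence finite, and so the sum is finite almost everywhere.\<close>

lemma AE_summable:
  fixes f :: "nat \<Rightarrow> 'a \<Rightarrow> real"
  assumes f: "\<And>r. integrable M (f r)" "\<And>r x. 0 \<le> f r x" and a: "\<And>r. integral\<^sup>L M (f r) \<le> a r" "summable a"
  shows "AE x in M. summable (\<lambda>r. f r x)"
proof -
  have [measurable]: "f r \<in> borel_measurable M" for r using f(1) by auto
  have a0: "0 \<le> a r" for r
    by (rule order_trans[OF Bochner_Integration.integral_nonneg a(1)]) (rule f(2))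
  have "(\<integral>\<^sup>+x. (\<Sum>r. ennreal (f r x)) \<partial>M) = (\<Sum>r. \<integral>\<^sup>+x. ennreal (f r x) \<partial>M)"
    by (rule nn_integral_suminf) measurable
  also have "\<dots> = (\<Sum>r. ennreal (integral\<^sup>L M (f r)))"
    using f by (intro suminf_cong nn_integral_eq_integral) auto
  also have "\<dots> \<le> (\<Sum>r. ennreal (a r))"
    using a(1) by (intro suminf_le ennreal_leI) auto
  also have "\<dots> = ennreal (\<Sum>r. a r)" using a0 a(2) by (intro suminf_ennreal2) auto
  finally have "(\<integral>\<^sup>+x. (\<Sum>r. ennreal (f r x)) \<partial>M) \<noteq> \<infinity>"
    by (auto simp: top_unique)
  then have "AE x in M. (\<Sum>r. ennreal (f r x)) \<noteq> \<infinity>"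
    by (intro nn_integral_noteq_infinite) measurable
  then show ?thesis by eventually_elim (use f(2) in \<open>auto intro!: summable_suminf_not_top\<close>)
qed

lemma convergent_of_summable_diff:
  fixes x :: "nat \<Rightarrow> real"
  assumes "summable (\<lambda>r. \<bar>x (Suc r) - x r\<bar>)"
  shows "convergent x"
proof -
  have "summable (\<lambda>r. x (Suc r) - x r)" by (rule summable_rabs_cancel[OF assms])
  then have "(\<lambda>n. \<Sum>r<n. x (Suc r) - x r) \<longlonglongrightarrow> (\<Sum>r. x (Suc r) - x r)" by (rule summable_LIMSEQ)
  then have "(\<lambda>n. (x n - x 0) + x 0) \<longlonglongrightarrow> (\<Sum>r. x (Suc r) - x r) + x 0"
    unfolding sum_lessThan_telescope by (intro tendsto_add tendsto_const)
  then show ?thesis by (auto simp: convergent_def)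
qed

lemma block_index_coarsen:
  assumes x: "0 \<le> x" and b: "b > 0"
  shows "block_index N x = block_index (b * N) x div b"
proof -
  have "\<lfloor>real (b * N) * x / real_of_int (int b)\<rfloor> = \<lfloor>real (b * N) * x\<rfloor> div int b"
    by (rule floor_divide_real_eq_div) simp
  moreover have "real (b * N) * x / real_of_int (int b) = real N * x" using b by simp
  ultimately have "\<lfloor>real N * x\<rfloor> = \<lfloor>real (b * N) * x\<rfloor> div int b" by simp
  then show ?thesis using x by (simp add: block_index_def nat_div_distrib)
qed

lemma integral_step_all:
  fixes F :: "nat \<times> nat \<Rightarrow> real"
  assumes n: "n > 0"
  shows "(\<integral>z. step n F z \<partial>lebesgue_on unit_square) = (\<Sum>p\<in>{..<n} \<times> {..<n}. F p) / (real n)\<^sup>2"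
proof -
  have "(\<integral>z. step n F z \<partial>lebesgue_on unit_square) = (\<integral>z. indicator unit_square z * step n F z \<partial>lebesgue_on unit_square)"
    by (intro Bochner_Integration.integral_cong) auto
  also have "\<dots> = (\<Sum>p\<in>{..<n} \<times> {..<n}. F p * (measure lebesgue ({0..1} \<inter> block n (fst p)) * measure lebesgue ({0..1} \<inter> block n (snd p))))"
    by (rule integral_step[OF n]) auto
  also have "\<dots> = (\<Sum>p\<in>{..<n} \<times> {..<n}. F p / (real n)\<^sup>2)"
  proof (intro sum.cong refl)
    fix p assume "p \<in> {..<n} \<times> {..<n}"
    then have "{0..1} \<inter> block n (fst p) = block n (fst p)" "{0..1} \<inter> block n (snd p) = block n (snd p)"
      by (auto intro!: Int_absorb1 block_subset_closed)
    then show "F p * (measure lebesgue ({0..1} \<inter> block n (fst p)) * measure lebesgue ({0..1} \<inter> block n (snd p))) = F p / (real n)\<^sup>2"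
      using n by (simp add: measure_lborel_block power2_eq_square)
  qed
  finally show ?thesis by (simp add: sum_divide_distrib)
qed

lemma pmf_embed_finite:
  fixes f :: "nat \<Rightarrow> real"
  assumes f: "\<And>i. i \<in> {1..k} \<Longrightarrow> 0 \<le> f i" "(\<Sum>i=1..k. f i) = (1 :: real)"
  defines "g \<equiv> \<lambda>i. if i \<in> {1..k} then f i else 0"
  shows "pmf (embed_pmf g) i = g i" and "set_pmf (embed_pmf g) \<subseteq> {1..k}"
proof -
  have g0: "0 \<le> g i" for i using f(1) by (simp add: g_def del: atLeastAtMost_iff)
  have "(\<integral>\<^sup>+i. ennreal (g i) \<partial>count_space UNIV) = (\<Sum>i\<in>{1..k}. ennreal (g i))"
    by (rule nn_integral_count_space') (auto simp: g_def)
  also have "\<dots> = ennreal (\<Sum>i\<in>{1..k}. g i)" using g0 by (intro sum_ennreal)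
  also have "(\<Sum>i\<in>{1..k}. g i) = (\<Sum>i\<in>{1..k}. f i)" by (rule sum.cong) (auto simp: g_def)
  also have "\<dots> = 1" by (rule f(2))
  finally have g1: "(\<integral>\<^sup>+i. ennreal (g i) \<partial>count_space UNIV) = 1" by simp
  show eq: "pmf (embed_pmf g) i = g i" for i by (rule pmf_embed_pmf[OF g0 g1])
  show "set_pmf (embed_pmf g) \<subseteq> {1..k}"
  proof
    fix i assume "i \<in> set_pmf (embed_pmf g)"
    then have "g i \<noteq> 0" using eq by (simp add: set_pmf_iff)
    then show "i \<in> {1..k}" by (simp add: g_def split: if_splits)
  qed
qed

text \<open>Nonnegativity, total mass and symmetry pass to pointwise limits, and everything is
  bounded by 1. Dominated convergence then gives both the \<open>L1\<close> limit and, by continuity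
  of the entropy function, the limit of entropies.\<close>

lemma AE_convergent_entropy_limit:
  fixes X :: "nat \<Rightarrow> nat \<Rightarrow> real \<times> real \<Rightarrow> real"
  assumes k: "k \<ge> 2" and d: "d \<in> {1..k}"
    and Xm: "\<And>r i. i \<in> {1..k} \<Longrightarrow> X r i \<in> borel_measurable (lebesgue_on unit_square)"
    and X0: "\<And>r i z. i \<in> {1..k} \<Longrightarrow> z \<in> {0..<1} \<times> {0..<1} \<Longrightarrow> 0 \<le> X r i z"
    and X1: "\<And>r z. z \<in> {0..<1} \<times> {0..<1} \<Longrightarrow> (\<Sum>i=1..k. X r i z) = 1"
    and Xsym: "\<And>r i x y. i \<in> {1..k} \<Longrightarrow> x \<in> {0..<1} \<Longrightarrow> y \<in> {0..<1} \<Longrightarrow> X r i (x, y) = X r i (y, x)"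
    and conv: "\<And>i. i \<in> {1..k} \<Longrightarrow> AE z in lebesgue_on unit_square. convergent (\<lambda>r. X r i z)"
    and ent: "\<And>r. L \<le> (\<integral>z. entropy_fun k (\<lambda>i. X r i z) \<partial>lebesgue_on unit_square)"
  shows "\<exists>W. kgraphon k W \<and> L \<le> graphon_entropy k W \<and>
    (\<forall>i\<in>{1..k}. (\<lambda>r. \<integral>z. \<bar>X r i z - pmf (W z) i\<bar> \<partial>lebesgue_on unit_square) \<longlonglongrightarrow> 0)"
proof -
  let ?M = "lebesgue_on unit_square"
  define good where "good z \<longleftrightarrow> z \<in> {0..<1} \<times> {0..<1} \<and> (\<forall>i\<in>{1..k}. convergent (\<lambda>r. X r i z))" for z
  \<comment> \<open>Where convergence fails a point mass is used, so \<open>W\<close> takes values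
    in measures on \<open>{1..k}\<close> everywhere; goodness is symmetric in the two coordinates,
    so \<open>W\<close> is too.\<close>
  define W where "W z = (if good z then embed_pmf (\<lambda>i. if i \<in> {1..k} then lim (\<lambda>r. X r i z) else 0) else return_pmf d)" for z
  have tolim: "(\<lambda>r. X r i z) \<longlonglongrightarrow> lim (\<lambda>r. X r i z)" if "good z" "i \<in> {1..k}" for z i
    using that by (auto simp: good_def convergent_LIMSEQ_iff)
  have lim0: "0 \<le> lim (\<lambda>r. X r i z)" if "good z" "i \<in> {1..k}" for z i
  proof (rule LIMSEQ_le_const[OF tolim[OF that]])
    show "\<exists>N. \<forall>r\<ge>N. 0 \<le> X r i z" using X0[OF that(2)] that(1) by (auto simp: good_def)
  qed
  have lim1: "(\<Sum>i=1..k. lim (\<lambda>r. X r i z)) = 1" if "good z" for z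
  proof -
    have "(\<lambda>r. \<Sum>i=1..k. X r i z) \<longlonglongrightarrow> (\<Sum>i=1..k. lim (\<lambda>r. X r i z))"
      by (intro tendsto_sum tolim that)
    moreover have "(\<lambda>r. \<Sum>i=1..k. X r i z) = (\<lambda>r. 1)" using X1[of z] that by (simp add: good_def)
    ultimately show ?thesis using LIMSEQ_unique tendsto_const by metis
  qed
  have pmfW: "pmf (W z) i = lim (\<lambda>r. X r i z)" if "good z" "i \<in> {1..k}" for z i
  proof -
    have "pmf (embed_pmf (\<lambda>i. if i \<in> {1..k} then lim (\<lambda>r. X r i z) else 0)) i = (if i \<in> {1..k} then lim (\<lambda>r. X r i z) else 0)"
      by (rule pmf_embed_finite(1)[OF lim0[OF that(1)] lim1[OF that(1)]])
    then show ?thesis using that by (simp only: W_def if_True)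
  qed
  have AEgood: "AE z in ?M. good z"
  proof -
    have "AE z in ?M. \<forall>i\<in>{1..k}. convergent (\<lambda>r. X r i z)"
      using conv by (subst AE_finite_all) auto
    then show ?thesis using AE_half_open by eventually_elim (simp add: good_def)
  qed
  have Wset: "set_pmf (W z) \<subseteq> {1..k}" for z
  proof (cases "good z")
    case True
    then show ?thesis using pmf_embed_finite(2)[OF lim0[OF True] lim1[OF True]] by (simp add: W_def)
  next
    case False
    then show ?thesis using d by (simp add: W_def)
  qed
  have Wsym: "W (x, y) = W (y, x)" for x y
  proof -
    have eq: "(\<lambda>r. X r i (x, y)) = (\<lambda>r. X r i (y, x))" if "x \<in> {0..<1}" "y \<in> {0..<1}" "i \<in> {1..k}" for i
      using Xsym[OF that(3,1,2)] by simp
    show ?thesis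
    proof (cases "x \<in> {0..<1} \<and> y \<in> {0..<1}")
      case True
      then have g: "good (x, y) \<longleftrightarrow> good (y, x)" using eq by (simp add: good_def del: atLeastAtMost_iff atLeastLessThan_iff cong: ball_cong)
      have "(\<lambda>i. if i \<in> {1..k} then lim (\<lambda>r. X r i (x, y)) else 0) = (\<lambda>i. if i \<in> {1..k} then lim (\<lambda>r. X r i (y, x)) else 0)"
        using eq True by (intro ext) (simp del: atLeastAtMost_iff)
      then show ?thesis unfolding W_def g by simp
    next
      case False
      then have "\<not> good (x, y)" "\<not> good (y, x)" by (auto simp: good_def)
      then show ?thesis by (simp add: W_def)
    qed
  qed
  have Wm: "(\<lambda>z. pmf (W z) i) \<in> borel_measurable ?M" if i: "i \<in> {1..k}" for i
  proof (rule AE_square_measurable)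
    show "(\<lambda>z. lim (\<lambda>r. X r i z)) \<in> borel_measurable ?M" by (rule borel_measurable_lim_metric) (rule Xm[OF i])
    show "AE z in ?M. pmf (W z) i = lim (\<lambda>r. X r i z)" using AEgood by eventually_elim (rule pmfW[OF _ i])
  qed
  have kW: "kgraphon k W" unfolding kgraphon_def using Wset Wsym Wm by blast
  have AElim: "AE z in ?M. (\<lambda>r. X r i z) \<longlonglongrightarrow> pmf (W z) i" if i: "i \<in> {1..k}" for i
    using AEgood by eventually_elim (use tolim pmfW i in simp)
  have X_le: "X r i z \<le> 1" if "i \<in> {1..k}" "z \<in> {0..<1} \<times> {0..<1}" for r i z
    using member_le_sum[of i "{1..k}" "\<lambda>i. X r i z"] X0[OF _ that(2)] X1[OF that(2)] that(1) by auto
  have l1: "(\<lambda>r. \<integral>z. \<bar>X r i z - pmf (W z) i\<bar> \<partial>?M) \<longlonglongrightarrow> 0" if i: "i \<in> {1..k}" for i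
  proof -
    have "(\<lambda>r. \<integral>z. \<bar>X r i z - pmf (W z) i\<bar> \<partial>?M) \<longlonglongrightarrow> (\<integral>z. 0 \<partial>?M)"
    proof (rule integral_dominated_convergence[where w = "\<lambda>_. 1"])
      show "(\<lambda>z. \<bar>X r i z - pmf (W z) i\<bar>) \<in> borel_measurable ?M" for r
        by (intro borel_measurable_abs borel_measurable_diff Xm Wm i)
      show "AE z in ?M. (\<lambda>r. \<bar>X r i z - pmf (W z) i\<bar>) \<longlonglongrightarrow> 0"
        using AElim[OF i] by eventually_elim (auto intro!: tendsto_rabs_zero simp: LIM_zero)
      show "AE z in ?M. norm \<bar>X r i z - pmf (W z) i\<bar> \<le> 1" for r
        using AE_half_open
      proof eventually_elim
        fix z :: "real \<times> real" assume z: "z \<in> {0..<1} \<times> {0..<1}"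
        show "norm \<bar>X r i z - pmf (W z) i\<bar> \<le> 1"
          using X0[OF i z, of r] X_le[OF i z, of r] pmf_nonneg[of "W z" i] pmf_le_1[of "W z" i]
          unfolding real_norm_def abs_idempotent by linarith
      qed
    qed auto
    then show ?thesis by simp
  qed
  have "(\<lambda>r. \<integral>z. entropy_fun k (\<lambda>i. X r i z) \<partial>?M) \<longlonglongrightarrow> (\<integral>z. entropy_fun k (pmf (W z)) \<partial>?M)"
  proof (rule integral_dominated_convergence[where w = "\<lambda>_. 1"])
    show "(\<lambda>z. entropy_fun k (\<lambda>i. X r i z)) \<in> borel_measurable ?M" for r by (rule entropy_measurable) (rule Xm)
    show "(\<lambda>z. entropy_fun k (pmf (W z))) \<in> borel_measurable ?M"
      using entropy_measurable[of k "\<lambda>i z. pmf (W z) i"] Wm by simp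
    show "AE z in ?M. (\<lambda>r. entropy_fun k (\<lambda>i. X r i z)) \<longlonglongrightarrow> entropy_fun k (pmf (W z))"
      using AEgood
    proof eventually_elim
      fix z assume z: "good z"
      then have z1: "z \<in> {0..<1} \<times> {0..<1}" by (simp add: good_def)
      show "(\<lambda>r. entropy_fun k (\<lambda>i. X r i z)) \<longlonglongrightarrow> entropy_fun k (pmf (W z))"
        using tolim[OF z] pmfW[OF z] X0[OF _ z1] X_le[OF _ z1] by (intro tendsto_entropy_fun k) auto
    qed
    show "AE z in ?M. norm (entropy_fun k (\<lambda>i. X r i z)) \<le> 1" for r
      using AE_half_open
    proof eventually_elim
      fix z :: "real \<times> real" assume z: "z \<in> {0..<1} \<times> {0..<1}"
      have "0 \<le> entropy_fun k (\<lambda>i. X r i z)" using X0[OF _ z] X_le[OF _ z] by (intro entropy_fun_nonneg k) auto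
      moreover have "entropy_fun k (\<lambda>i. X r i z) \<le> 1" using X0[OF _ z] X1[OF z] by (intro entropy_fun_le_1 k) auto
      ultimately show "norm (entropy_fun k (\<lambda>i. X r i z)) \<le> 1" by simp
    qed
  qed auto
  then have "L \<le> graphon_entropy k W"
    unfolding graphon_entropy_alt using ent by (intro LIMSEQ_le_const) auto
  then show ?thesis using kW l1 by blast
qed

text \<open>A bounded martingale treated by hand: the squared increments are differences of the
  bounded energies \<open>E\<close>, so along a sparse sequence of levels the \<open>L1\<close>
  increments are summable, which forces convergence almost everywhere.\<close>

lemma limit_of_block_densities:
  fixes V :: "nat \<Rightarrow> nat \<Rightarrow> nat \<times> nat \<Rightarrow> real"
  defines "K \<equiv> \<lambda>l. {..<(2::nat) ^ l} \<times> {..<(2::nat) ^ l}"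
  assumes k: "k \<ge> 2" and d: "d \<in> {1..k}"
    and V0: "\<And>l i z. i \<in> {1..k} \<Longrightarrow> z \<in> K l \<Longrightarrow> 0 \<le> V l i z"
    and V1: "\<And>l z. z \<in> K l \<Longrightarrow> (\<Sum>i=1..k. V l i z) = 1"
    and Vsym: "\<And>l i a b. i \<in> {1..k} \<Longrightarrow> (a, b) \<in> K l \<Longrightarrow> V l i (a, b) = V l i (b, a)"
    and mart: "\<And>l l' i z. l \<le> l' \<Longrightarrow> i \<in> {1..k} \<Longrightarrow> z \<in> K l' \<Longrightarrow>
      V l i (map_prod (\<lambda>a. a div 2 ^ (l' - l)) (\<lambda>a. a div 2 ^ (l' - l)) z) =
      fibre_avg (K l') (map_prod (\<lambda>a. a div 2 ^ (l' - l)) (\<lambda>a. a div 2 ^ (l' - l))) (V l' i) z"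
    and ent: "\<And>l. L \<le> (\<Sum>z\<in>K l. entropy_fun k (\<lambda>i. V l i z)) / 4 ^ l"
  shows "\<exists>W \<rho>. kgraphon k W \<and> L \<le> graphon_entropy k W \<and> strict_mono \<rho> \<and>
    (\<forall>i\<in>{1..k}. (\<lambda>r. \<integral>z. \<bar>step (2 ^ \<rho> r) (V (\<rho> r) i) z - pmf (W z) i\<bar> \<partial>lebesgue_on unit_square) \<longlonglongrightarrow> 0)"
proof -
  let ?M = "lebesgue_on unit_square"
  define X where "X l i = step (2 ^ l) (V l i)" for l i
  have idx: "(block_index (2 ^ l) (fst z), block_index (2 ^ l) (snd z)) \<in> K l" if "z \<in> {0..<1} \<times> {0..<1}" for l z
    using that block_index_less[of "2 ^ l" "fst z"] block_index_less[of "2 ^ l" "snd z"] by (auto simp: K_def)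
  have V_le: "V l i z \<le> 1" if "i \<in> {1..k}" "z \<in> K l" for l i z
    using member_le_sum[of i "{1..k}" "\<lambda>i. V l i z"] V0[OF _ that(2)] V1[OF that(2)] that(1) by auto
  have Xm: "X l i \<in> borel_measurable ?M" for l i unfolding X_def by (rule step_measurable)
  have four: "(real (2 ^ l))\<^sup>2 = 4 ^ l" for l
  proof -
    have "(2::real) ^ l * 2 ^ l = 4 ^ l" by (simp flip: power_mult_distrib)
    then show ?thesis by (simp add: power2_eq_square)
  qed
  define E where "E l = (\<Sum>i=1..k. (\<Sum>z\<in>K l. (V l i z)\<^sup>2) / 4 ^ l)" for l
  have sqdiff: "(\<Sum>i=1..k. \<integral>z. (X l' i z - X l i z)\<^sup>2 \<partial>?M) = E l' - E l" if l: "l \<le> l'" for l l'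
  proof -
    let ?t = "2 ^ (l' - l) :: nat"
    let ?B = "map_prod (\<lambda>a. a div ?t) (\<lambda>a. a div ?t)"
    \<comment> \<open>A step function of the coarse level is one of the fine level too, which allows
      comparison on a single grid.\<close>
    have Xl: "step (2 ^ l) F z = step (2 ^ l') (F \<circ> ?B) z" if "z \<in> unit_square" for z and F :: "nat \<times> nat \<Rightarrow> real"
    proof -
      have "2 ^ l' = ?t * 2 ^ l" using l by (simp flip: power_add)
      then have "block_index (2 ^ l) x = block_index (2 ^ l') x div ?t" if "0 \<le> x" for x
        using block_index_coarsen[OF that, of ?t "2 ^ l"] by simp
      then show ?thesis using that by (cases z) (auto simp: step_def)
    qed
    have "(\<integral>z. (X l' i z - X l i z)\<^sup>2 \<partial>?M) = (\<Sum>z\<in>K l'. (V l' i z)\<^sup>2) / 4 ^ l' - (\<Sum>z\<in>K l. (V l i z)\<^sup>2) / 4 ^ l"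
      if i: "i \<in> {1..k}" for i
    proof -
      have "(\<integral>z. (X l' i z - X l i z)\<^sup>2 \<partial>?M) = (\<integral>z. step (2 ^ l') (\<lambda>p. (V l' i p - V l i (?B p))\<^sup>2) z \<partial>?M)"
        using Xl[of _ "V l i"] by (intro Bochner_Integration.integral_cong refl) (auto simp: X_def step_def)
      also have "\<dots> = (\<Sum>p\<in>K l'. (V l' i p - V l i (?B p))\<^sup>2) / 4 ^ l'"
        by (subst integral_step_all) (simp_all add: K_def four del: of_nat_power)
      \<comment> \<open>\<open>V l'\<close> is its own average for the key \<open>id\<close>, and
        \<open>V l\<close> is its coarse average by the consistency hypothesis; so Pythagoras
        applies.\<close>
      also have "(\<Sum>p\<in>K l'. (V l' i p - V l i (?B p))\<^sup>2) =
        (\<Sum>p\<in>K l'. (fibre_avg (K l') id (V l' i) p - fibre_avg (K l') ?B (V l' i) p)\<^sup>2)"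
      proof (rule sum.cong[OF refl])
        fix p assume p: "p \<in> K l'"
        have "fibre_avg (K l') id (V l' i) p = V l' i p"
          by (rule fibre_avg_measurable) (use p in \<open>auto simp: K_def\<close>)
        then show "(V l' i p - V l i (?B p))\<^sup>2 = (fibre_avg (K l') id (V l' i) p - fibre_avg (K l') ?B (V l' i) p)\<^sup>2"
          using mart[OF l i p] by simp
      qed
      also have "\<dots> = (\<Sum>p\<in>K l'. (fibre_avg (K l') id (V l' i) p)\<^sup>2) - (\<Sum>p\<in>K l'. (fibre_avg (K l') ?B (V l' i) p)\<^sup>2)"
        by (rule fibre_avg_pythagoras) (auto simp: K_def)
      also have "(\<Sum>p\<in>K l'. (fibre_avg (K l') id (V l' i) p)\<^sup>2) = (\<Sum>p\<in>K l'. (V l' i p)\<^sup>2)"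
        by (intro sum.cong refl arg_cong[of _ _ "\<lambda>x. x\<^sup>2"] fibre_avg_measurable) (auto simp: K_def)
      also have "(\<Sum>p\<in>K l'. (fibre_avg (K l') ?B (V l' i) p)\<^sup>2) = (\<Sum>p\<in>K l'. (V l i (?B p))\<^sup>2)"
        using mart[OF l i] by (intro sum.cong refl) simp
      also have "((\<Sum>p\<in>K l'. (V l' i p)\<^sup>2) - (\<Sum>p\<in>K l'. (V l i (?B p))\<^sup>2)) / 4 ^ l' =
        (\<Sum>p\<in>K l'. (V l' i p)\<^sup>2) / 4 ^ l' - (\<Sum>p\<in>K l'. (V l i (?B p))\<^sup>2) / 4 ^ l'" by (rule diff_divide_distrib)
      also have "(\<Sum>p\<in>K l'. (V l i (?B p))\<^sup>2) / 4 ^ l' = (\<integral>z. step (2 ^ l') ((\<lambda>p. (V l i p)\<^sup>2) \<circ> ?B) z \<partial>?M)"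
        by (subst integral_step_all) (simp_all add: K_def four del: of_nat_power)
      also have "\<dots> = (\<integral>z. step (2 ^ l) (\<lambda>p. (V l i p)\<^sup>2) z \<partial>?M)"
        using Xl[of _ "\<lambda>p. (V l i p)\<^sup>2"] by (intro Bochner_Integration.integral_cong refl) simp
      also have "\<dots> = (\<Sum>z\<in>K l. (V l i z)\<^sup>2) / 4 ^ l"
        by (subst integral_step_all) (simp_all add: K_def four del: of_nat_power)
      finally show ?thesis .
    qed
    then show ?thesis by (simp add: E_def sum_subtractf)
  qed
  have E_le: "E l \<le> k" for l
  proof -
    have "(\<Sum>z\<in>K l. (V l i z)\<^sup>2) / 4 ^ l \<le> 1" if i: "i \<in> {1..k}" for i
    proof -
      have "(\<Sum>z\<in>K l. (V l i z)\<^sup>2) \<le> (\<Sum>z\<in>K l. 1)"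
        using V0[OF i] V_le[OF i] by (intro sum_mono power_le_one) auto
      also have "\<dots> = 4 ^ l" using four[of l] by (simp add: K_def card_cartesian_product power2_eq_square)
      finally show ?thesis by simp
    qed
    then have "E l \<le> (\<Sum>i=1..k. 1)" unfolding E_def by (rule sum_mono)
    then show ?thesis by simp
  qed
  have "incseq E"
  proof (rule monoI)
    fix l l' :: nat assume "l \<le> l'"
    have "0 \<le> E l' - E l"
      unfolding sqdiff[OF \<open>l \<le> l'\<close>, symmetric] by (intro sum_nonneg Bochner_Integration.integral_nonneg) simp
    then show "E l \<le> E l'" by simp
  qed
  then obtain Elim where "E \<longlonglongrightarrow> Elim" using incseq_convergent[of E "real k"] E_le by blast
  then have "Cauchy E" by (rule LIMSEQ_imp_Cauchy)
  then have ex: "\<exists>N. \<forall>m\<ge>N. \<forall>n\<ge>N. norm (E m - E n) < (1/4) ^ r" for r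
    by (rule CauchyD) simp
  \<comment> \<open>The rate \<open>(1/4) ^ r\<close> for squares becomes \<open>(1/2) ^ r\<close>
    for absolute values.\<close>
  define N where "N r = (SOME N. \<forall>m\<ge>N. \<forall>n\<ge>N. norm (E m - E n) < (1/4) ^ r)" for r
  have N: "norm (E m - E n) < (1/4) ^ r" if "m \<ge> N r" "n \<ge> N r" for r m n
    using someI_ex[OF ex, of r] that unfolding N_def by blast
  \<comment> \<open>The partial sums keep \<open>\<rho> r\<close> above \<open>N r\<close>, and the
    summand \<open>r\<close> makes it strictly increasing.\<close>
  define \<rho> where "\<rho> r = r + (\<Sum>s\<le>r. N s)" for r
  have \<rho>N: "N r \<le> \<rho> r" for r
  proof -
    have "N r \<le> (\<Sum>s\<le>r. N s)" by (intro member_le_sum) auto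
    then show ?thesis by (simp add: \<rho>_def)
  qed
  have mono: "strict_mono \<rho>" by (rule strict_monoI_Suc) (simp add: \<rho>_def)
  have Xb: "\<bar>X l' i z - X l i z\<bar> \<le> 1" if "i \<in> {1..k}" "z \<in> {0..<1} \<times> {0..<1}" for i z l l'
    using V0[OF that(1) idx[OF that(2)], of l] V_le[OF that(1) idx[OF that(2)], of l]
      V0[OF that(1) idx[OF that(2)], of l'] V_le[OF that(1) idx[OF that(2)], of l']
    by (simp add: X_def step_def)
  have int: "integrable ?M (\<lambda>z. \<bar>X l' i z - X l i z\<bar>)" "integrable ?M (\<lambda>z. (X l' i z - X l i z)\<^sup>2)" if i: "i \<in> {1..k}" for i l l'
  proof -
    have ae: "AE z in ?M. norm \<bar>X l' i z - X l i z\<bar> \<le> 1"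
      using AE_half_open by eventually_elim (simp add: Xb[OF i])
    show "integrable ?M (\<lambda>z. \<bar>X l' i z - X l i z\<bar>)"
      by (intro square.integrable_const_bound[OF ae] borel_measurable_abs borel_measurable_diff Xm)
    have ae2: "AE z in ?M. norm ((X l' i z - X l i z)\<^sup>2) \<le> 1"
      using AE_half_open by eventually_elim (simp add: Xb[OF i] abs_square_le_1)
    show "integrable ?M (\<lambda>z. (X l' i z - X l i z)\<^sup>2)"
      by (intro square.integrable_const_bound[OF ae2] borel_measurable_power borel_measurable_diff Xm)
  qed
  have step_l1: "(\<integral>z. \<bar>X (\<rho> (Suc r)) i z - X (\<rho> r) i z\<bar> \<partial>?M) \<le> (1/2) ^ r" if i: "i \<in> {1..k}" for r i
  proof -
    let ?D = "\<lambda>z. X (\<rho> (Suc r)) i z - X (\<rho> r) i z"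
    have le: "\<rho> r \<le> \<rho> (Suc r)" using mono by (simp add: strict_mono_less_eq)
    have "(\<integral>z. (?D z)\<^sup>2 \<partial>?M) \<le> (\<Sum>i=1..k. \<integral>z. (X (\<rho> (Suc r)) i z - X (\<rho> r) i z)\<^sup>2 \<partial>?M)"
      using i by (intro member_le_sum) auto
    also have "\<dots> = E (\<rho> (Suc r)) - E (\<rho> r)" by (rule sqdiff[OF le])
    also have "\<dots> \<le> (1/4) ^ r" using N[of r "\<rho> (Suc r)" "\<rho> r"] \<rho>N[of r] le by simp
    finally have sq: "(\<integral>z. (?D z)\<^sup>2 \<partial>?M) \<le> (1/4) ^ r" .
    \<comment> \<open>A weighted arithmetic-geometric inequality takes the place of Cauchy-Schwarz
      for integrals; the weight \<open>2 ^ r\<close> balances the two halves.\<close>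
    have amgm: "\<bar>x\<bar> \<le> 2 ^ r / 2 * x\<^sup>2 + (1/2) ^ r / 2" for x :: real
    proof -
      have "0 \<le> (2 ^ r * \<bar>x\<bar> - 1)\<^sup>2 / (2 * 2 ^ r)" by simp
      also have "\<dots> = 2 ^ r / 2 * x\<^sup>2 + (1/2) ^ r / 2 - \<bar>x\<bar>"
        by (simp add: power2_eq_square field_simps)
      finally show ?thesis by simp
    qed
    have "(\<integral>z. \<bar>?D z\<bar> \<partial>?M) \<le> (\<integral>z. 2 ^ r / 2 * (?D z)\<^sup>2 + (1/2) ^ r / 2 \<partial>?M)"
      using int[OF i] amgm by (intro integral_mono) auto
    also have "\<dots> = 2 ^ r / 2 * (\<integral>z. (?D z)\<^sup>2 \<partial>?M) + (1/2) ^ r / 2"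
      using int[OF i] square.prob_space by (subst Bochner_Integration.integral_add) auto
    also have "\<dots> \<le> 2 ^ r / 2 * (1/4) ^ r + (1/2) ^ r / 2" using sq by simp
    also have "2 ^ r / 2 * (1/4 :: real) ^ r = (1/2) ^ r / 2" by (simp flip: power_mult_distrib)
    finally show ?thesis by simp
  qed
  have "\<exists>W. kgraphon k W \<and> L \<le> graphon_entropy k W \<and>
    (\<forall>i\<in>{1..k}. (\<lambda>r. \<integral>z. \<bar>X (\<rho> r) i z - pmf (W z) i\<bar> \<partial>?M) \<longlonglongrightarrow> 0)"
  proof (rule AE_convergent_entropy_limit[OF k d])
    show "X (\<rho> r) i \<in> borel_measurable ?M" for r i by (rule Xm)
    show "0 \<le> X (\<rho> r) i z" if "i \<in> {1..k}" "z \<in> {0..<1} \<times> {0..<1}" for r i z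
      unfolding X_def step_def by (rule V0[OF that(1) idx[OF that(2)]])
    show "(\<Sum>i=1..k. X (\<rho> r) i z) = 1" if "z \<in> {0..<1} \<times> {0..<1}" for r z
      unfolding X_def step_def by (rule V1[OF idx[OF that]])
    show "X (\<rho> r) i (x, y) = X (\<rho> r) i (y, x)" if "i \<in> {1..k}" "x \<in> {0..<1}" "y \<in> {0..<1}" for r i x y
      using Vsym[OF that(1) idx[of "(x, y)" "\<rho> r", unfolded fst_conv snd_conv]] that by (simp add: X_def step_def)
    show "AE z in ?M. convergent (\<lambda>r. X (\<rho> r) i z)" if i: "i \<in> {1..k}" for i
    proof -
      have "AE z in ?M. summable (\<lambda>r. \<bar>X (\<rho> (Suc r)) i z - X (\<rho> r) i z\<bar>)"
        by (rule AE_summable[where a = "\<lambda>r. (1/2) ^ r"]) (auto intro: int[OF i] step_l1[OF i] simp: summable_geometric)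
      then show ?thesis by eventually_elim (rule convergent_of_summable_diff)
    qed
    show "L \<le> (\<integral>z. entropy_fun k (\<lambda>i. X (\<rho> r) i z) \<partial>?M)" for r
    proof -
      have "(\<integral>z. entropy_fun k (\<lambda>i. X (\<rho> r) i z) \<partial>?M) = (\<integral>z. step (2 ^ \<rho> r) (\<lambda>p. entropy_fun k (\<lambda>i. V (\<rho> r) i p)) z \<partial>?M)"
        by (simp add: X_def step_def)
      also have "\<dots> = (\<Sum>z\<in>K (\<rho> r). entropy_fun k (\<lambda>i. V (\<rho> r) i z)) / 4 ^ \<rho> r"
        by (subst integral_step_all) (simp_all add: K_def four del: of_nat_power)
      finally show ?thesis using ent by simp
    qed
  qed
  then show ?thesis using mono unfolding X_def by blast
qed

section \<open>Permuting blocks\<close>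

text \<open>Each block is translated onto the block that \<open>\<tau>\<close> assigns to it. The
  endpoint 1, which lies in no block, is fixed.\<close>

definition block_perm :: "nat \<Rightarrow> (nat \<Rightarrow> nat) \<Rightarrow> real \<Rightarrow> real" where
  "block_perm n \<tau> x = (if x \<in> {0..<1}
     then x + (real (\<tau> (block_index n x)) - real (block_index n x)) / real n else x)"

lemma block_shift:
  assumes "n > 0"
  shows "x + (real v - real u) / real n \<in> block n v \<longleftrightarrow> x \<in> block n u"
proof -
  have iff: "y \<in> block n w \<longleftrightarrow> real w \<le> real n * y \<and> real n * y < real w + 1" for y w
    using assms by (simp add: block_def pos_divide_le_eq pos_less_divide_eq mult.commute add.commute)
  have "real n * (x + (real v - real u) / real n) = real n * x + real v - real u"
    using assms by (simp add: distrib_left)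
  then show ?thesis unfolding iff by linarith
qed

lemma block_perm_in:
  assumes n: "n > 0" and \<tau>: "bij_betw \<tau> {..<n} {..<n}" and x: "x \<in> {0..<1}"
  shows "block_index n (block_perm n \<tau> x) = \<tau> (block_index n x)" and "block_perm n \<tau> x \<in> {0..<1}"
proof -
  define u where "u = block_index n x"
  have u: "u < n" unfolding u_def using block_index_less[of n x] n x by simp
  then have \<tau>u: "\<tau> u < n" using \<tau> by (auto simp: bij_betw_def)
  have "x \<in> block n u" using block_index_eq_iff[of n x u] n x u_def by simp
  then have in_block: "block_perm n \<tau> x \<in> block n (\<tau> u)"
    using block_shift[OF n, of x "\<tau> u" u] x by (simp add: block_perm_def u_def)
  then show sub: "block_perm n \<tau> x \<in> {0..<1}" using block_subset[OF \<tau>u] by blast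
  show "block_index n (block_perm n \<tau> x) = \<tau> (block_index n x)"
    using block_index_eq_iff[of n "block_perm n \<tau> x" "\<tau> u"] n sub in_block by (simp add: u_def)
qed

lemma disjoint_blocks: "n > 0 \<Longrightarrow> u < n \<Longrightarrow> v < n \<Longrightarrow> u \<noteq> v \<Longrightarrow> block n u \<inter> block n v = {}"
  using Union_block_Int[of n "{u}" v] by auto

lemma Union_blocks: "n > 0 \<Longrightarrow> (\<Union>u<n. block n u) = {0..<1}"
proof (intro equalityI subsetI)
  fix x :: real assume n: "n > 0" and x: "x \<in> {0..<1}"
  then have "block_index n x < n" "x \<in> block n (block_index n x)"
    using block_index_less[of n x] block_index_eq_iff[of n x "block_index n x"] by auto
  then show "x \<in> (\<Union>u<n. block n u)" by blast
next
  fix x assume "x \<in> (\<Union>u<n. block n u)"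
  then show "x \<in> {0..<1}" using block_subset by blast
qed

text \<open>The pieces are disjoint because the blocks are, and the single point 1 is null.\<close>

lemma emeasure_subset_blocks:
  assumes n: "n > 0" and F: "\<And>u. u < n \<Longrightarrow> F u \<in> sets lebesgue" "\<And>u. u < n \<Longrightarrow> F u \<subseteq> block n u"
    and A: "A - {1} = (\<Union>u<n. F u)"
  shows "A \<in> sets lebesgue" and "emeasure lebesgue A = (\<Sum>u<n. emeasure lebesgue (F u))"
proof -
  have U: "(\<Union>u<n. F u) \<in> sets lebesgue" using F(1) by (intro sets.finite_UN) auto
  have A1: "A \<inter> {1} \<in> null_sets lebesgue"
    by (rule null_sets_completion_subset[of _ "{1}"]) (auto intro!: null_sets_completionI)
  have eq: "A = (\<Union>u<n. F u) \<union> (A \<inter> {1})" using A by blast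
  show "A \<in> sets lebesgue" by (subst eq) (intro sets.Un U null_setsD2 A1)
  have "disjoint_family_on F {..<n}"
    unfolding disjoint_family_on_def
  proof (intro ballI impI)
    fix u v assume uv: "u \<in> {..<n}" "v \<in> {..<n}" "u \<noteq> v"
    then have "block n u \<inter> block n v = {}" by (intro disjoint_blocks n) auto
    moreover have "F u \<subseteq> block n u" "F v \<subseteq> block n v" using uv by (auto intro!: F(2))
    ultimately show "F u \<inter> F v = {}" by blast
  qed
  then have "(\<Sum>u<n. emeasure lebesgue (F u)) = emeasure lebesgue (\<Union>u<n. F u)"
    using F(1) by (intro sum_emeasure) auto
  also have "\<dots> = emeasure lebesgue ((\<Union>u<n. F u) \<union> (A \<inter> {1}))"
    by (rule emeasure_Un_null_set[OF U A1, symmetric])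
  also have "\<dots> = emeasure lebesgue A" using eq by (rule arg_cong[OF sym])
  finally show "emeasure lebesgue A = (\<Sum>u<n. emeasure lebesgue (F u))" ..
qed

text \<open>The preimage of \<open>A\<close> consists of translates of the pieces of
  \<open>A\<close> in the blocks. Translations preserve Lebesgue measure, and a permutation of the
  blocks only reorders the sum of the pieces.\<close>

lemma block_perm_measure_preserving:
  assumes n: "n > 0" and \<tau>: "bij_betw \<tau> {..<n} {..<n}"
  shows "block_perm n \<tau> \<in> measure_preserving_maps"
proof -
  let ?\<phi> = "block_perm n \<tau>" and ?M = "lebesgue_on {0..1::real}"
  have \<tau>n: "\<tau> u < n" if "u < n" for u using \<tau> that by (auto simp: bij_betw_def)
  have one: "?\<phi> 1 = 1" by (simp add: block_perm_def)
  have key: "?\<phi> -` A \<inter> {0..1} \<in> sets lebesgue" "emeasure lebesgue (?\<phi> -` A \<inter> {0..1}) = emeasure lebesgue A"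
    if A: "A \<in> sets lebesgue" "A \<subseteq> {0..1}" for A
  proof -
    define C where "C u = (\<lambda>x. - ((real (\<tau> u) - real u) / real n) + x) ` (A \<inter> block n (\<tau> u))" for u
    have Am: "A \<inter> block n u \<in> sets lebesgue" for u using A by (intro sets.Int) auto
    have Cm: "C u \<in> sets lebesgue" for u unfolding C_def by (rule lebesgue_sets_translation[OF Am])
    have Ce: "emeasure lebesgue (C u) = emeasure lebesgue (A \<inter> block n (\<tau> u))" for u
      using emeasure_lebesgue_affine[of 1 "- ((real (\<tau> u) - real u) / real n)" "A \<inter> block n (\<tau> u)"]
      by (simp add: C_def add.commute)
    have C_iff: "x \<in> C u \<longleftrightarrow> x \<in> block n u \<and> x + (real (\<tau> u) - real u) / real n \<in> A" for x u
      using block_shift[OF n, of x "\<tau> u" u] by (force simp: C_def image_iff)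
    have phi_eq: "?\<phi> x = x + (real (\<tau> u) - real u) / real n" if "u < n" "x \<in> block n u" for x u
      using that block_subset[OF that(1)] block_index_eq_iff[OF n, of x u] by (auto simp: block_perm_def)
    have eq: "(?\<phi> -` A \<inter> {0..1}) - {1} = (\<Union>u<n. C u)"
    proof (intro equalityI subsetI)
      fix x assume x: "x \<in> (?\<phi> -` A \<inter> {0..1}) - {1}"
      then have "x \<in> (\<Union>u<n. block n u)" unfolding Union_blocks[OF n] by auto
      then obtain u where u: "u < n" "x \<in> block n u" by blast
      then have "x \<in> C u" using C_iff phi_eq[OF u] x by simp
      then show "x \<in> (\<Union>u<n. C u)" using u by blast
    next
      fix x assume "x \<in> (\<Union>u<n. C u)"
      then obtain u where u: "u < n" "x \<in> C u" by blast
      then have "x \<in> block n u" "?\<phi> x \<in> A" using C_iff phi_eq[OF u(1)] by auto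
      then show "x \<in> (?\<phi> -` A \<inter> {0..1}) - {1}" using block_subset[OF u(1)] by auto
    qed
    have sub: "C u \<subseteq> block n u" for u using C_iff by blast
    show "?\<phi> -` A \<inter> {0..1} \<in> sets lebesgue" by (rule emeasure_subset_blocks(1)[OF n Cm sub eq])
    have "emeasure lebesgue (?\<phi> -` A \<inter> {0..1}) = (\<Sum>u<n. emeasure lebesgue (A \<inter> block n (\<tau> u)))"
      unfolding emeasure_subset_blocks(2)[OF n Cm sub eq] Ce ..
    also have "\<dots> = (\<Sum>u<n. emeasure lebesgue (A \<inter> block n u))"
      by (rule sum.reindex_bij_betw[OF \<tau>])
    also have "\<dots> = emeasure lebesgue A"
    proof (rule emeasure_subset_blocks(2)[OF n Am, symmetric])
      show "A - {1} = (\<Union>u<n. A \<inter> block n u)"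
        unfolding Int_UN_distrib[symmetric] Union_blocks[OF n] using A(2) by force
    qed auto
    finally show "emeasure lebesgue (?\<phi> -` A \<inter> {0..1}) = emeasure lebesgue A" .
  qed
  have in01: "?\<phi> x \<in> {0..1}" if "x \<in> {0..1}" for x
  proof (cases "x = 1")
    case False
    then have "x \<in> {0..<1}" using that by auto
    from block_perm_in(2)[OF n \<tau> this] show ?thesis by auto
  qed (simp add: one)
  have m: "?\<phi> \<in> measurable ?M ?M"
  proof (rule measurableI)
    show "?\<phi> -` A \<inter> space ?M \<in> sets ?M" if "A \<in> sets ?M" for A
      using key(1)[of A] that by (simp add: space_restrict_space sets_restrict_space_iff)
  qed (use in01 in \<open>simp add: space_restrict_space del: atLeastAtMost_iff\<close>)
  have "distr ?M ?M ?\<phi> = ?M"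
  proof (rule measure_eqI)
    fix A assume "A \<in> sets (distr ?M ?M ?\<phi>)"
    then have A: "A \<in> sets ?M" by simp
    then have A': "A \<in> sets lebesgue" "A \<subseteq> {0..1}" by (simp_all add: sets_restrict_space_iff)
    have "emeasure (distr ?M ?M ?\<phi>) A = emeasure ?M (?\<phi> -` A \<inter> {0..1})"
      using emeasure_distr[OF m A] by (simp add: space_restrict_space)
    also have "\<dots> = emeasure lebesgue (?\<phi> -` A \<inter> {0..1})" by (rule emeasure_restrict_space) auto
    also have "\<dots> = emeasure lebesgue A" by (rule key(2)[OF A'])
    also have "\<dots> = emeasure ?M A" by (rule emeasure_restrict_space[symmetric]) (use A' in auto)
    finally show "emeasure (distr ?M ?M ?\<phi>) A = emeasure ?M A" .
  qed simp
  then show ?thesis using m by (simp add: measure_preserving_maps_def)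
qed

section \<open>From discrete cut norms to the cut distance\<close>

lemma step_integrable:
  fixes F :: "nat \<times> nat \<Rightarrow> real"
  shows "integrable (lebesgue_on unit_square) (step n F)"
proof -
  obtain B where B: "\<forall>z\<in>unit_square. \<bar>step n F z\<bar> \<le> B" using step_bounded[of n F] by (rule exE)
  show ?thesis by (rule square_integrable_bounded[OF step_measurable, of n F B]) (use B in blast)
qed

lemma integrable_indicator_mult_square:
  fixes f :: "real \<times> real \<Rightarrow> real"
  assumes "S \<in> sets lebesgue" "T \<in> sets lebesgue" "integrable (lebesgue_on unit_square) f"
  shows "integrable (lebesgue_on unit_square) (\<lambda>z. indicator (S \<times> T) z * f z)"
proof (rule Bochner_Integration.integrable_bound[OF assms(3)])
  show "(\<lambda>z. indicator (S \<times> T) z * f z) \<in> borel_measurable (lebesgue_on unit_square)"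
    using assms by (intro borel_measurable_times indicator_Times_measurable) auto
  show "AE z in lebesgue_on unit_square. norm (indicator (S \<times> T) z * f z) \<le> norm (f z)"
    by (rule AE_I2) (simp add: indicator_def)
qed

text \<open>A measurable set meets a step function only through the fraction of each block that it
  fills. These fractions lie in [0,1] and are the weights \<open>s\<close> and
  \<open>t\<close>.\<close>

lemma abs_integral_step_le:
  assumes n: "n > 0" and F: "cut_bounded {..<n} F (e * (real n)\<^sup>2)"
    and ST: "S \<in> sets lebesgue" "T \<in> sets lebesgue" "S \<subseteq> {0..1}" "T \<subseteq> {0..1}"
  shows "\<bar>\<integral>z. indicator (S \<times> T) z * step n F z \<partial>lebesgue_on unit_square\<bar> \<le> e"
proof -
  define s where "s u = real n * measure lebesgue (S \<inter> block n u)" for u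
  define t where "t u = real n * measure lebesgue (T \<inter> block n u)" for u
  have le1: "real n * measure lebesgue (A \<inter> block n u) \<le> 1" if "A \<in> sets lebesgue" for A u
  proof -
    have "block n u \<in> lmeasurable"
      by (intro bounded_set_imp_lmeasurable block_sets) (simp add: block_def)
    then have "measure lebesgue (A \<inter> block n u) \<le> measure lebesgue (block n u)"
      using that by (intro measure_mono_fmeasurable) auto
    then show ?thesis using n measure_block[OF n, of u] by (simp add: field_simps)
  qed
  have "(\<integral>z. indicator (S \<times> T) z * step n F z \<partial>lebesgue_on unit_square) =
    (\<Sum>p\<in>{..<n} \<times> {..<n}. F p * (measure lebesgue (S \<inter> block n (fst p)) * measure lebesgue (T \<inter> block n (snd p))))"
    by (rule integral_step[OF n ST])
  also have "\<dots> = (\<Sum>p\<in>{..<n} \<times> {..<n}. F p * (s (fst p) * t (snd p))) / (real n)\<^sup>2"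
    unfolding sum_divide_distrib using n by (intro sum.cong refl) (simp add: s_def t_def power2_eq_square)
  also have "\<bar>\<dots>\<bar> = \<bar>\<Sum>p\<in>{..<n} \<times> {..<n}. F p * (s (fst p) * t (snd p))\<bar> / (real n)\<^sup>2" by simp
  also have "\<dots> \<le> (e * (real n)\<^sup>2) / (real n)\<^sup>2"
  proof (rule divide_right_mono)
    show "\<bar>\<Sum>p\<in>{..<n} \<times> {..<n}. F p * (s (fst p) * t (snd p))\<bar> \<le> e * (real n)\<^sup>2"
      by (rule cut_boundedD[OF F]) (simp_all add: s_def t_def le1 ST del: measure_completion)
  qed simp
  also have "\<dots> = e" using n by simp
  finally show ?thesis .
qed

text \<open>The matrix \<open>V\<close> describes the sorted colouring, so \<open>W\<close> is
  rearranged by the block permutation of the inverse of \<open>\<sigma>\<close>. The difference from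
  the step graphon is then a step function of small discrete cut norm plus a term of small
  \<open>L1\<close> norm; summing over colours gives the factor \<open>k\<close>.\<close>

lemma cut_dist_step_le:
  assumes n: "n > 0" and \<sigma>: "bij_betw \<sigma> {..<n} {..<n}" and W: "kgraphon k W" and nb: "n = b * N"
    and cut: "\<And>i. i \<in> {1..k} \<Longrightarrow> cut_bounded {..<n}
      (\<lambda>z. colour_indicator d c i (map_prod \<sigma> \<sigma> z) - V i (map_prod (\<lambda>u. u div b) (\<lambda>u. u div b) z)) (e * (real n)\<^sup>2)"
    and l1: "\<And>i. i \<in> {1..k} \<Longrightarrow> (\<integral>z. \<bar>step N (V i) z - pmf (W z) i\<bar> \<partial>lebesgue_on unit_square) \<le> e'"
  shows "cut_dist k (step_graphon d n c) W \<le> k * (e + e')"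
proof -
  let ?M = "lebesgue_on unit_square" and ?V = "{..<n}" and ?B = "map_prod (\<lambda>u. u div b) (\<lambda>u. u div b)"
  have b: "b > 0" using n nb by (cases b) auto
  define \<tau> where "\<tau> = the_inv_into ?V \<sigma>"
  have \<tau>: "bij_betw \<tau> ?V ?V" unfolding \<tau>_def by (rule bij_betw_the_inv_into[OF \<sigma>])
  have \<sigma>\<tau>: "\<sigma> (\<tau> u) = u" if "u \<in> ?V" for u
    unfolding \<tau>_def using \<sigma> that by (simp add: bij_betw_def f_the_inv_into_f)
  define \<phi> where "\<phi> = block_perm n \<tau>"
  have mp: "\<phi> \<in> measure_preserving_maps" unfolding \<phi>_def by (rule block_perm_measure_preserving[OF n \<tau>])
  define \<Phi> where "\<Phi> = (\<lambda>(x, y). (\<phi> x, \<phi> y))"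
  have pres: "square_preserving \<Phi>" unfolding \<Phi>_def by (rule measure_preserving_square[OF mp])
  have "cut_diff k (step_graphon d n c) (\<lambda>(x, y). W (\<phi> x, \<phi> y)) \<le> k * (e + e')"
    unfolding cut_diff_def
  proof (rule cSUP_least)
    fix p assume "p \<in> {S \<in> sets lebesgue. S \<subseteq> {0..1::real}} \<times> {T \<in> sets lebesgue. T \<subseteq> {0..1::real}}"
    then obtain S T where p: "p = (S, T)" and ST: "S \<in> sets lebesgue" "T \<in> sets lebesgue" "S \<subseteq> {0..1}" "T \<subseteq> {0..1}"
      by (cases p) auto
    let ?J = "indicator (S \<times> T) :: _ \<Rightarrow> real"
    have "\<bar>LINT z : S \<times> T | lebesgue. pmf (step_graphon d n c z) i - pmf (case z of (x, y) \<Rightarrow> W (\<phi> x, \<phi> y)) i\<bar> \<le> e + e'"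
      if i: "i \<in> {1..k}" for i
    proof -
      define f where "f = colour_indicator d c i"
      \<comment> \<open>Vertex \<open>u\<close> stands at position \<open>\<tau> u\<close> in the
        sorted order, hence in the block \<open>\<tau> u div b\<close>.\<close>
      define F where "F z = f z - V i (?B (map_prod \<tau> \<tau> z))" for z
      define G where "G z = step N (V i) z - pmf (W z) i" for z
      have Wm: "(\<lambda>z. pmf (W z) i) \<in> borel_measurable ?M" by (rule kgraphon_measurable[OF W i])
      have Gm: "G \<in> borel_measurable ?M" unfolding G_def by (intro borel_measurable_diff step_measurable Wm)
      have G\<Phi>m: "(\<lambda>z. G (\<Phi> z)) \<in> borel_measurable ?M" by (rule square_preserving_compose(1)[OF pres Gm])
      obtain B where B: "\<forall>z\<in>unit_square. \<bar>step N (V i) z\<bar> \<le> B" using step_bounded[of N "V i"] by (rule exE)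
      have Gb: "\<bar>G z\<bar> \<le> B + 1" if "z \<in> unit_square" for z
        using B[rule_format, OF that] pmf_nonneg[of "W z" i] pmf_le_1[of "W z" i] unfolding G_def by linarith
      have \<Phi>_in: "\<Phi> z \<in> unit_square" if "z \<in> unit_square" for z
      proof -
        have "\<phi> x \<in> {0..1}" if "x \<in> {0..1}" for x
          using mp measurable_space[of \<phi> "lebesgue_on {0..1}" "lebesgue_on {0..1}" x] that
          by (simp add: measure_preserving_maps_def space_restrict_space)
        then show ?thesis using that by (auto simp: \<Phi>_def)
      qed
      have G\<Phi>i: "integrable ?M (\<lambda>z. G (\<Phi> z))"
        by (rule square_integrable_bounded[OF G\<Phi>m, of "B + 1"]) (intro Gb \<Phi>_in)
      have F: "cut_bounded ?V F (e * (real n)\<^sup>2)"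
      proof -
        let ?H = "(\<lambda>z. f (map_prod \<sigma> \<sigma> z) - V i (?B z)) \<circ> map_prod \<tau> \<tau>"
        have "F z = ?H z" if "z \<in> ?V \<times> ?V" for z
          using that by (cases z) (simp add: F_def \<sigma>\<tau>)
        then have "cut_bounded ?V F (e * (real n)\<^sup>2) \<longleftrightarrow> cut_bounded ?V ?H (e * (real n)\<^sup>2)"
          by (rule cut_bounded_cong)
        moreover have "cut_bounded ?V ?H (e * (real n)\<^sup>2)"
          unfolding f_def by (rule cut_bounded_reindex[OF \<tau> cut[OF i]])
        ultimately show ?thesis by (rule iffD2)
      qed
      have split: "?J z * (pmf (step_graphon d n c z) i - pmf (W (\<Phi> z)) i) = ?J z * step n F z + ?J z * G (\<Phi> z)"
        if z: "z \<in> {0..<1} \<times> {0..<1}" for z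
      proof -
        obtain x y where xy: "z = (x, y)" "x \<in> {0..<1}" "y \<in> {0..<1}" using z by (cases z) auto
        \<comment> \<open>Here the continuous rearrangement meets the discrete one:
          \<open>\<phi>\<close> moves fine blocks as \<open>\<tau>\<close> moves vertices, and
          division by \<open>b\<close> gives the coarse block.\<close>
        have idx: "block_index N (\<phi> w) = \<tau> (block_index n w) div b" if "w \<in> {0..<1}" for w
        proof -
          have "0 \<le> \<phi> w" using block_perm_in(2)[OF n \<tau> that] by (simp add: \<phi>_def)
          then have "block_index N (\<phi> w) = block_index n (\<phi> w) div b"
            unfolding nb by (rule block_index_coarsen) (rule b)
          then show ?thesis using block_perm_in(1)[OF n \<tau> that] by (simp add: \<phi>_def)
        qed
        have "step N (V i) (\<Phi> z) = V i (?B (map_prod \<tau> \<tau> (block_index n x, block_index n y)))"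
          using xy by (simp add: step_def \<Phi>_def idx)
        moreover have "pmf (step_graphon d n c z) i = f (block_index n x, block_index n y)"
          unfolding pmf_step_graphon[OF n z] by (simp add: step_def xy f_def colour_indicator_def)
        ultimately have "pmf (step_graphon d n c z) i - pmf (W (\<Phi> z)) i = step n F z + G (\<Phi> z)"
          by (simp add: F_def G_def step_def xy)
        then show ?thesis by (simp add: distrib_left)
      qed
      have Jm: "?J \<in> borel_measurable ?M" by (intro indicator_Times_measurable ST)
      have "(LINT z : S \<times> T | lebesgue. pmf (step_graphon d n c z) i - pmf (case z of (x, y) \<Rightarrow> W (\<phi> x, \<phi> y)) i)
          = (\<integral>z. ?J z * (pmf (step_graphon d n c z) i - pmf (W (\<Phi> z)) i) \<partial>?M)"
        unfolding set_integral_square[OF ST(3,4)] by (simp add: \<Phi>_def case_prod_beta)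
      also have "\<dots> = (\<integral>z. ?J z * step n F z + ?J z * G (\<Phi> z) \<partial>?M)"
      proof (rule integral_cong_AE)
        show "(\<lambda>z. ?J z * (pmf (step_graphon d n c z) i - pmf (W (\<Phi> z)) i)) \<in> borel_measurable ?M"
          by (intro borel_measurable_times borel_measurable_diff Jm step_graphon_measurable n square_preserving_compose(1)[OF pres Wm])
        show "(\<lambda>z. ?J z * step n F z + ?J z * G (\<Phi> z)) \<in> borel_measurable ?M"
          by (intro borel_measurable_add borel_measurable_times Jm step_measurable G\<Phi>m)
        show "AE z in ?M. ?J z * (pmf (step_graphon d n c z) i - pmf (W (\<Phi> z)) i) = ?J z * step n F z + ?J z * G (\<Phi> z)"
          using AE_half_open by eventually_elim (rule split)
      qed
      also have "\<dots> = (\<integral>z. ?J z * step n F z \<partial>?M) + (\<integral>z. ?J z * G (\<Phi> z) \<partial>?M)"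
        by (intro Bochner_Integration.integral_add integrable_indicator_mult_square ST step_integrable G\<Phi>i)
      finally have eq: "(LINT z : S \<times> T | lebesgue. pmf (step_graphon d n c z) i - pmf (case z of (x, y) \<Rightarrow> W (\<phi> x, \<phi> y)) i)
          = (\<integral>z. ?J z * step n F z \<partial>?M) + (\<integral>z. ?J z * G (\<Phi> z) \<partial>?M)" .
      have "\<bar>\<integral>z. ?J z * G (\<Phi> z) \<partial>?M\<bar> \<le> (\<integral>z. \<bar>?J z * G (\<Phi> z)\<bar> \<partial>?M)" by (rule integral_abs_bound)
      also have "\<dots> \<le> (\<integral>z. \<bar>G (\<Phi> z)\<bar> \<partial>?M)"
        by (intro integral_mono integrable_abs integrable_indicator_mult_square ST G\<Phi>i) (simp add: indicator_def)
      also have "\<dots> = (\<integral>z. \<bar>G z\<bar> \<partial>?M)"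
        by (rule square_preserving_compose(2)[OF pres]) (intro borel_measurable_abs Gm)
      also have "\<dots> \<le> e'" using l1[OF i] by (simp add: G_def)
      finally have "\<bar>\<integral>z. ?J z * G (\<Phi> z) \<partial>?M\<bar> \<le> e'" .
      then show ?thesis unfolding eq using abs_integral_step_le[OF n F ST] by linarith
    qed
    then have "(\<Sum>i=1..k. \<bar>LINT z : S \<times> T | lebesgue. pmf (step_graphon d n c z) i - pmf (case z of (x, y) \<Rightarrow> W (\<phi> x, \<phi> y)) i\<bar>) \<le> (\<Sum>i=1..k. e + e')"
      by (rule sum_mono)
    then show "(case p of (S, T) \<Rightarrow> \<Sum>i=1..k. \<bar>LINT z : S \<times> T | lebesgue. pmf (step_graphon d n c z) i - pmf (case z of (x, y) \<Rightarrow> W (\<phi> x, \<phi> y)) i\<bar>) \<le> k * (e + e')"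
      by (simp add: p)
  next
    have "({}, {}) \<in> {S \<in> sets lebesgue. S \<subseteq> {0..1::real}} \<times> {T \<in> sets lebesgue. T \<subseteq> {0..1::real}}" by simp
    then show "{S \<in> sets lebesgue. S \<subseteq> {0..1::real}} \<times> {T \<in> sets lebesgue. T \<subseteq> {0..1::real}} \<noteq> {}" by blast
  qed
  then show ?thesis using cut_dist_le[OF mp] by (rule order_trans[rotated])
qed

section \<open>Block densities\<close>

abbreviation grid :: "nat \<Rightarrow> (nat \<times> nat) set" where
  "grid n \<equiv> {..<n} \<times> {..<n}"

abbreviation div2 :: "nat \<Rightarrow> nat \<times> nat \<Rightarrow> nat \<times> nat" where
  "div2 b \<equiv> map_prod (\<lambda>u. u div b) (\<lambda>u. u div b)"

text \<open>The block average as a function of the position of the block instead of a vertex in it,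
  so that values for different \<open>n\<close> can be compared and sent to a limit.\<close>

definition block_density :: "nat \<Rightarrow> nat \<Rightarrow> (nat \<times> nat \<Rightarrow> real) \<Rightarrow> nat \<times> nat \<Rightarrow> real" where
  "block_density n b f z = (\<Sum>y\<in>{y \<in> grid n. div2 b y = z}. f y) / (real b)\<^sup>2"

lemma div_fibre:
  fixes a b N :: nat
  assumes "b > 0" "a < N"
  shows "{u \<in> {..<b * N}. u div b = a} = {a * b..<a * b + b}"
proof (intro equalityI subsetI)
  fix u assume "u \<in> {u \<in> {..<b * N}. u div b = a}"
  then have "u = a * b + u mod b" by auto
  moreover have "u mod b < b" using assms by simp
  ultimately have "a * b \<le> u" "u < a * b + b" by linarith+
  then show "u \<in> {a * b..<a * b + b}" by simp
next
  fix u assume u: "u \<in> {a * b..<a * b + b}"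
  have "a * b + b \<le> b * N" using mult_le_mono1[OF Suc_leI[OF assms(2)], of b] by (simp add: mult.commute)
  moreover have "u div b = a" using u assms(1) by (intro div_nat_eqI) (auto simp: mult.commute)
  ultimately show "u \<in> {u \<in> {..<b * N}. u div b = a}" using u by auto
qed

lemma card_div2_fibre:
  assumes "b > 0" "z \<in> grid N"
  shows "card {y \<in> grid (b * N). div2 b y = z} = b\<^sup>2"
proof -
  have "{y \<in> grid (b * N). div2 b y = z} =
      {u \<in> {..<b * N}. u div b = fst z} \<times> {u \<in> {..<b * N}. u div b = snd z}"
    by (cases z) auto
  also have "\<dots> = {fst z * b..<fst z * b + b} \<times> {snd z * b..<snd z * b + b}"
    using assms by (subst (1 2) div_fibre) auto
  finally show ?thesis by (simp add: card_cartesian_product power2_eq_square)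
qed

lemma div2_mem: "b > 0 \<Longrightarrow> y \<in> grid (b * N) \<Longrightarrow> div2 b y \<in> grid N"
  by (cases y) (auto simp: less_mult_imp_div_less mult.commute)

lemma avg2_eq_block_density:
  assumes "b > 0" "y \<in> grid (b * N)"
  shows "avg2 {..<b * N} (\<lambda>u. u div b) f y = block_density (b * N) b f (div2 b y)"
  unfolding fibre_avg_def block_density_def
  using card_div2_fibre[OF assms(1) div2_mem[OF assms]] by simp

lemma sum_div2:
  assumes "b > 0"
  shows "(\<Sum>y\<in>grid (b * N). g (div2 b y)) = (real b)\<^sup>2 * (\<Sum>z\<in>grid N. (g z :: real))"
proof -
  have "(\<Sum>y\<in>grid (b * N). g (div2 b y)) = (\<Sum>z\<in>grid N. \<Sum>y\<in>{y \<in> grid (b * N). div2 b y = z}. g (div2 b y))"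
  proof (rule sum.group[symmetric])
    show "div2 b ` grid (b * N) \<subseteq> grid N" by (intro image_subsetI div2_mem[OF assms])
  qed simp_all
  also have "\<dots> = (\<Sum>z\<in>grid N. \<Sum>y\<in>{y \<in> grid (b * N). div2 b y = z}. g z)"
    by (rule sum.cong[OF refl], rule sum.cong[OF refl]) simp
  also have "\<dots> = (\<Sum>z\<in>grid N. (real b)\<^sup>2 * g z)"
  proof (rule sum.cong[OF refl])
    fix z assume "z \<in> grid N"
    from card_div2_fibre[OF assms this] show "(\<Sum>y\<in>{y \<in> grid (b * N). div2 b y = z}. g z) = (real b)\<^sup>2 * g z"
      by simp
  qed
  finally show ?thesis by (simp add: sum_distrib_left)
qed

text \<open>An average of averages is the total average, since every coarse block contains the same
  number \<open>t\<^sup>2\<close> of fine ones. In the limit this is the martingale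
  property.\<close>

lemma block_density_refine:
  assumes b: "b > 0" and t: "t > 0" and z: "z \<in> grid (t * N)"
  shows "block_density (b * (t * N)) (b * t) f (div2 t z) =
    fibre_avg (grid (t * N)) (div2 t) (block_density (b * (t * N)) b f) z"
proof -
  let ?n = "b * (t * N)"
  let ?T = "{z' \<in> grid (t * N). div2 t z' = div2 t z}" and ?S = "{y \<in> grid ?n. div2 (b * t) y = div2 t z}"
  have dd: "div2 (b * t) y = div2 t (div2 b y)" for y by (cases y) (simp add: div_mult2_eq)
  have ?thesis if card: "card ?T = t\<^sup>2"
  proof -
    have "(\<Sum>y\<in>?S. f y) = (\<Sum>z'\<in>?T. \<Sum>y\<in>{y \<in> ?S. div2 b y = z'}. f y)"
    proof (rule sum.group[symmetric])
      show "div2 b ` ?S \<subseteq> ?T"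
      proof (rule image_subsetI)
        fix y assume "y \<in> ?S"
        then have y: "y \<in> grid ?n" "div2 (b * t) y = div2 t z" by blast+
        from y(2) have "div2 t (div2 b y) = div2 t z" unfolding dd .
        with div2_mem[OF b y(1)] show "div2 b y \<in> ?T" by blast
      qed
    qed simp_all
    also have "\<dots> = (\<Sum>z'\<in>?T. \<Sum>y\<in>{y \<in> grid ?n. div2 b y = z'}. f y)"
    proof (rule sum.cong[OF refl], rule sum.cong)
      fix z' assume "z' \<in> ?T"
      then have z': "div2 t z' = div2 t z" by blast
      have "div2 (b * t) y = div2 t z" if "div2 b y = z'" for y unfolding dd that by (rule z')
      then show "{y \<in> ?S. div2 b y = z'} = {y \<in> grid ?n. div2 b y = z'}" by blast
    qed (rule refl)
    finally have "(\<Sum>y\<in>?S. f y) / (real (b * t))\<^sup>2 = (\<Sum>z'\<in>?T. block_density ?n b f z') / real (card ?T)"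
      using b t by (simp add: block_density_def card power_mult_distrib flip: sum_divide_distrib)
    then show ?thesis by (simp add: block_density_def[of _ "b * t"] fibre_avg_def)
  qed
  moreover have "card ?T = t\<^sup>2" by (rule card_div2_fibre[OF t div2_mem[OF t z]])
  ultimately show ?thesis by blast
qed

lemma block_density_nonneg: "(\<And>y. 0 \<le> f y) \<Longrightarrow> 0 \<le> block_density n b f z"
  unfolding block_density_def by (intro divide_nonneg_nonneg sum_nonneg) auto

lemma block_density_one:
  assumes "b > 0" "z \<in> grid N" "\<And>y. y \<in> grid (b * N) \<Longrightarrow> (\<Sum>i\<in>I. f i y) = 1"
  shows "(\<Sum>i\<in>I. block_density (b * N) b (f i) z) = 1"
proof -
  let ?S = "{y \<in> grid (b * N). div2 b y = z}"
  have "(\<Sum>i\<in>I. block_density (b * N) b (f i) z) = (\<Sum>y\<in>?S. \<Sum>i\<in>I. f i y) / (real b)\<^sup>2"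
    unfolding block_density_def sum_divide_distrib[symmetric] by (subst sum.swap) simp
  also have "(\<Sum>y\<in>?S. \<Sum>i\<in>I. f i y) = (\<Sum>y\<in>?S. 1)" by (intro sum.cong refl assms(3)) simp
  finally show ?thesis using card_div2_fibre[OF assms(1,2)] assms(1) by simp
qed

lemma block_density_swap:
  assumes "\<And>u v. f (u, v) = f (v, u)"
  shows "block_density n b f (a, a') = block_density n b f (a', a)"
proof -
  have "(\<Sum>y\<in>{y \<in> grid n. div2 b y = (a, a')}. f y) = (\<Sum>y\<in>{y \<in> grid n. div2 b y = (a', a)}. f y)"
    by (rule sum.reindex_bij_witness[of _ "\<lambda>(u, v). (v, u)" "\<lambda>(u, v). (v, u)"]) (auto intro: assms)
  then show ?thesis by (simp add: block_density_def)
qed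

text \<open>A fibre has at most \<open>b\<^sup>2\<close> points, also when blocks do not fit evenly
  into the grid or \<open>b = 0\<close>. The subsequence argument needs this bound at every
  level.\<close>

lemma block_density_le_1:
  assumes f: "\<And>y. f y \<le> 1"
  shows "block_density n b f z \<le> 1"
proof (cases "b = 0")
  case False
  let ?S = "{y \<in> grid n. div2 b y = z}"
  have "?S \<subseteq> {fst z * b..<fst z * b + b} \<times> {snd z * b..<snd z * b + b}"
  proof
    fix y assume y: "y \<in> ?S"
    have mem: "u \<in> {u div b * b..<u div b * b + b}" for u
    proof -
      have "u = u div b * b + u mod b" "u mod b < b" using False by simp_all
      then have "u div b * b \<le> u" "u < u div b * b + b" by linarith+
      then show ?thesis by simp
    qed
    have z: "z = div2 b y" using y by blast
    have "fst z = fst y div b" "snd z = snd y div b" unfolding z by simp_all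
    then show "y \<in> {fst z * b..<fst z * b + b} \<times> {snd z * b..<snd z * b + b}"
      using mem[of "fst y"] mem[of "snd y"] by (simp only: mem_Times_iff)
  qed
  then have "card ?S \<le> card ({fst z * b..<fst z * b + b} \<times> {snd z * b..<snd z * b + b})"
    by (rule card_mono[rotated]) simp
  then have "real (card ?S) \<le> (real b)\<^sup>2" by (simp add: card_cartesian_product power2_eq_square flip: of_nat_mult)
  moreover have "(\<Sum>y\<in>?S. f y) \<le> real (card ?S) * 1" by (rule sum_bounded_above) (rule f)
  ultimately have "(\<Sum>y\<in>?S. f y) \<le> (real b)\<^sup>2" by linarith
  then show ?thesis using False by (simp add: block_density_def)
qed (simp add: block_density_def)

section \<open>Counting colourings\<close>

text \<open>A realisation chooses the colour of each edge independently, so the realisations form a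
  product.\<close>

lemma template_entropy_eq_log_card:
  assumes k: "k \<ge> 2" and t: "t \<in> templates k n"
  shows "template_entropy k n t = log (real k) (real (card (realisations k n t)))"
proof -
  have sub: "t e \<subseteq> {1..k}" "t e \<noteq> {}" if "e \<in> edges n" for e
    using t that by (auto simp: templates_def)
  have "realisations k n t = PiE (edges n) t"
    using PiE_mono[of "edges n" t "\<lambda>_. {1..k}", OF sub(1)]
    by (auto simp: realisations_def colourings_def PiE_iff extensional_def simp del: atLeastAtMost_iff)
  then have "card (realisations k n t) = (\<Prod>e\<in>edges n. card (t e))" by (simp add: card_PiE)
  moreover have "real (card (t e)) \<noteq> 0" if "e \<in> edges n" for e
    using sub[OF that] finite_subset[of "t e" "{1..k}"] by auto
  ultimately show ?thesis
    unfolding template_entropy_def log_def by (simp add: ln_prod sum_divide_distrib)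
qed

lemma extremal_entropy_le_log_card:
  assumes k: "k \<ge> 2" and P: "P n \<subseteq> colourings k n" "P n \<noteq> {}"
  shows "extremal_entropy k n P \<le> log (real k) (real (card (P n)))"
proof -
  let ?X = "{template_entropy k n t |t. t \<in> templates k n \<and> realisations k n t \<subseteq> P n}"
  have fin: "finite (P n)" using P(1) finite_colourings finite_subset by blast
  have "finite ?X" using finite_templates[of k n] by simp
  moreover obtain c where "c \<in> P n" using P(2) by blast
  then have "template_entropy k n (\<lambda>e\<in>edges n. {c e}) \<in> ?X"
    using singleton_template[of c k n] P(1) by blast
  moreover have "x \<le> log (real k) (real (card (P n)))" if "x \<in> ?X" for x
  proof -
    obtain t where t: "x = template_entropy k n t" "t \<in> templates k n" "realisations k n t \<subseteq> P n"
      using \<open>x \<in> ?X\<close> by blast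
    have "realisations k n t \<noteq> {}"
    proof -
      have "PiE (edges n) t \<noteq> {}" using t(2) by (auto simp: templates_def PiE_eq_empty_iff)
      moreover have "PiE (edges n) t \<subseteq> realisations k n t"
        using PiE_mono[of "edges n" t "\<lambda>_. {1..k}"] t(2)
        by (auto simp: realisations_def colourings_def templates_def PiE_iff simp del: atLeastAtMost_iff)
      ultimately show ?thesis by blast
    qed
    then have "0 < card (realisations k n t)" using t(3) fin finite_subset by (auto simp: card_gt_0_iff)
    moreover have "card (realisations k n t) \<le> card (P n)" using t(3) fin by (rule card_mono[rotated])
    ultimately show ?thesis
      unfolding t(1) template_entropy_eq_log_card[OF k t(2)] using k by (intro log_mono) auto
  qed
  ultimately show ?thesis unfolding extremal_entropy_def by (subst Max_le_iff) auto
qed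

lemma log_card_bounds:
  assumes k: "k \<ge> 2" and P: "P \<subseteq> colourings k n" "P \<noteq> {}"
  shows "0 \<le> log (real k) (real (card P))" and "log (real k) (real (card P)) \<le> real (n choose 2)"
proof -
  have fin: "finite P" using P(1) finite_colourings finite_subset by blast
  then have "1 \<le> card P" using P(2) by (simp add: Suc_le_eq card_gt_0_iff)
  then show "0 \<le> log (real k) (real (card P))" using k by simp
  have "card P \<le> k ^ (n choose 2)"
    using card_mono[OF finite_colourings P(1)] by (simp add: card_colourings)
  then have "real (card P) \<le> real k ^ (n choose 2)" by (metis of_nat_le_iff of_nat_power)
  then have "log (real k) (real (card P)) \<le> log (real k) (real k ^ (n choose 2))"
    using k \<open>1 \<le> card P\<close> by (intro log_mono) auto
  also have "\<dots> = real (n choose 2)" using k by (simp add: log_nat_power)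
  finally show "log (real k) (real (card P)) \<le> real (n choose 2)" .
qed

text \<open>The larger end of a lost edge exceeds \<open>m\<close>.\<close>

lemma card_edges_diff_le: "m \<le> n \<Longrightarrow> card (edges n - edges m) \<le> (n - m) * n"
proof -
  assume "m \<le> n"
  have "edges n - edges m \<subseteq> (\<lambda>(a, b). {a, b}) ` ({1..n} \<times> {m<..n})"
  proof
    fix e assume e: "e \<in> edges n - edges m"
    then obtain a b where ab: "(a, b) \<in> pairs n" "e = {a, b}" by (auto elim: edge_pairE)
    then have "\<not> b \<le> m" using e pair_edge[of a b m] by (auto simp: pairs_def)
    then show "e \<in> (\<lambda>(a, b). {a, b}) ` ({1..n} \<times> {m<..n})"
      using ab by (intro image_eqI[of _ _ "(a, b)"]) (auto simp: pairs_def)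
  qed
  then have "card (edges n - edges m) \<le> card ({1..n} \<times> {m<..n})" by (rule surj_card_le[rotated]) simp
  then show ?thesis by (simp add: card_cartesian_product mult.commute)
qed

text \<open>A colouring is determined by the one induced on the first \<open>m\<close> vertices,
  which is again in \<open>P\<close>, and its colours on the remaining edges. This allows rounding
  \<open>n\<close> to a multiple of a power of 2.\<close>

lemma log_card_delete_vertices:
  assumes k: "k \<ge> 2" and P: "order_hereditary k P" "P n \<noteq> {}" and mn: "m \<le> n"
  shows "log (real k) (real (card (P n))) \<le> log (real k) (real (card (P m))) + real ((n - m) * n)"
proof -
  have sub: "P n \<subseteq> colourings k n" for n using P(1) by (simp add: order_hereditary_def)
  have fin: "finite (P n)" for n using sub finite_colourings finite_subset by blast
  have subset: "{1..m} \<subseteq> {1..n}" using mn by auto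
  have sl: "sorted_list_of_set {1..m} = [1..<Suc m]"
    using sorted_list_of_set.idem_if_sorted_distinct[of "[1..<Suc m]"] by (simp add: atLeastLessThanSuc_atLeastAtMost del: upt_Suc)
  have ind: "induced c {1..m} e = c e" if e: "e \<in> edges m" for c e
  proof -
    have "e \<subseteq> {1..m}" using e by (simp add: edges_def)
    then have "(\<lambda>i. [1..<Suc m] ! (i - 1)) ` e = (\<lambda>i. i) ` e"
      by (intro image_cong refl) (auto simp del: upt_Suc)
    then show ?thesis using e unfolding induced_def by (simp only: sl card_atLeastAtMost diff_Suc_1 restrict_apply image_ident if_True)
  qed
  let ?R = "edges n - edges m"
  let ?h = "\<lambda>c. (induced c {1..m}, restrict c ?R)"
  have inj: "inj_on ?h (P n)"
  proof (rule inj_onI)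
    fix c c' assume c: "c \<in> P n" "c' \<in> P n" and eq: "?h c = ?h c'"
    have "c \<in> edges n \<rightarrow>\<^sub>E {1..k}" "c' \<in> edges n \<rightarrow>\<^sub>E {1..k}" using c sub by (auto simp: colourings_def)
    then show "c = c'"
    proof (rule PiE_ext)
      fix e assume e: "e \<in> edges n"
      show "c e = c' e"
      proof (cases "e \<in> edges m")
        case True
        then show ?thesis using ind[OF True, of c] ind[OF True, of c'] eq by simp
      next
        case False
        then have "restrict c ?R e = c e" "restrict c' ?R e = c' e" using e by auto
        then show ?thesis using arg_cong[where f = "\<lambda>y. snd y e", OF eq] by simp
      qed
    qed
  qed
  have "?h ` P n \<subseteq> P m \<times> (?R \<rightarrow>\<^sub>E {1..k})"
  proof (rule image_subsetI)
    fix c assume c: "c \<in> P n"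
    have "induced c {1..m} \<in> P (card {1..m})" using P(1) c subset unfolding order_hereditary_def by blast
    moreover have "c \<in> edges n \<rightarrow>\<^sub>E {1..k}" using c sub by (auto simp: colourings_def)
    then have "restrict c ?R \<in> ?R \<rightarrow>\<^sub>E {1..k}" by (auto simp: PiE_iff)
    ultimately show "?h c \<in> P m \<times> (?R \<rightarrow>\<^sub>E {1..k})" by simp
  qed
  then have le: "card (P n) \<le> card (P m \<times> (?R \<rightarrow>\<^sub>E {1..k}))"
    by (intro card_inj_on_le[OF inj]) (auto intro!: finite_PiE fin)
  have "card (P n) > 0" using P(2) fin by (simp add: card_gt_0_iff)
  have "P m \<noteq> {}"
  proof -
    obtain c where "c \<in> P n" using P(2) by blast
    then have "induced c {1..m} \<in> P (card {1..m})" using P(1) subset unfolding order_hereditary_def by blast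
    then show ?thesis by auto
  qed
  then have m0: "0 < card (P m)" using fin by (simp add: card_gt_0_iff)
  have "card (P m \<times> (?R \<rightarrow>\<^sub>E {1..k})) = card (P m) * k ^ card ?R"
    by (simp add: card_cartesian_product card_PiE)
  also have "\<dots> \<le> card (P m) * k ^ ((n - m) * n)"
    using card_edges_diff_le[OF mn] k by (intro mult_le_mono2 power_increasing) auto
  finally have "card (P n) \<le> card (P m) * k ^ ((n - m) * n)" using le by (rule order_trans[rotated])
  then have "real (card (P n)) \<le> real (card (P m)) * real k ^ ((n - m) * n)"
    by (metis of_nat_le_iff of_nat_mult of_nat_power)
  then have "log (real k) (real (card (P n))) \<le> log (real k) (real (card (P m)) * real k ^ ((n - m) * n))"
    using \<open>card (P n) > 0\<close> k by (intro log_mono) auto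
  also have "\<dots> = log (real k) (real (card (P m))) + real ((n - m) * n)"
    using m0 k by (simp add: log_mult log_nat_power del: of_nat_mult)
  finally show ?thesis .
qed

lemma real_choose_two: "real (n choose 2) = real n * (real n - 1) / 2"
  by (cases n) (auto simp: choose_two real_of_nat_div algebra_simps)

text \<open>The normalised cost of sorting colourings into classes by permutation and
  \<open>C\<close> block counts.\<close>

lemma tendsto_classes_error:
  assumes "k \<ge> 2"
  shows "(\<lambda>n. (real n * log (real k) (real n) + C * log (real k) (real (n\<^sup>2 + 1))) / (real n)\<^sup>2) \<longlonglongrightarrow> 0"
proof -
  have "(\<lambda>n. (real n * ln (real n)) / (real n)\<^sup>2) \<longlonglongrightarrow> 0" "(\<lambda>n. ln (real n ^ 2 + 1) / (real n)\<^sup>2) \<longlonglongrightarrow> 0"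
    by real_asymp+
  then have "(\<lambda>n. (real n * ln (real n)) / (real n)\<^sup>2 / ln (real k) + C / ln (real k) * (ln (real n ^ 2 + 1) / (real n)\<^sup>2)) \<longlonglongrightarrow>
      0 / ln (real k) + C / ln (real k) * 0"
    using assms by (intro tendsto_add tendsto_divide tendsto_mult tendsto_const) auto
  then show ?thesis unfolding log_def add_divide_distrib by (simp add: mult.commute add.commute[of 1])
qed

text \<open>The colouring for stage \<open>j\<close>: a size where the count is nearly maximal is
  rounded down so that dyadic blocks fit exactly, and the class argument is applied there.\<close>

lemma stage_colouring:
  assumes k: "k \<ge> 2" and d: "d \<in> {1..k}" and P: "order_hereditary k P" "\<And>n. P n \<noteq> {}"
    and L: "L \<le> 1" "\<And>\<eta> N. \<eta> > 0 \<Longrightarrow> \<exists>n\<ge>N. (L - \<eta>) * real (n choose 2) \<le> log (real k) (real (card (P n)))"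
  shows "\<exists>n c \<sigma>. j < n \<and> 2 ^ j dvd n \<and> c \<in> P n \<and> bij_betw \<sigma> {..<n} {..<n} \<and>
    (\<forall>M l b i. 0 < M \<and> M \<le> j \<and> n = b * 2 ^ l \<and> i \<in> {1..k} \<longrightarrow>
      cut_bounded {..<n} (\<lambda>z. colour_indicator d c i (map_prod \<sigma> \<sigma> z) -
          avg2 {..<n} (\<lambda>u. u div b) (colour_indicator d c i \<circ> map_prod \<sigma> \<sigma>) z)
        ((2 / sqrt M + 2 * 4 ^ M / 2 ^ l) * (real n)\<^sup>2)) \<and>
    (\<forall>l b. l \<le> j \<and> n = b * 2 ^ l \<longrightarrow> L - 5 / real (Suc j) \<le>
      (\<Sum>z\<in>grid n. entropy_fun k (\<lambda>i. avg2 {..<n} (\<lambda>u. u div b) (colour_indicator d c i \<circ> map_prod \<sigma> \<sigma>) z)) / (real n)\<^sup>2)"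
proof -
  define J where "J = real (Suc j)"
  have J: "J \<ge> 1" by (simp add: J_def)
  define q where "q = (2::nat) ^ j"
  have q: "q > 0" by (simp add: q_def)
  define C where "C = real (Suc j * k * 4 ^ j)"
  define err where "err n = real n * log (real k) (real n) + C * log (real k) (real (n\<^sup>2 + 1))" for n
  have "(\<lambda>n. err n / (real n)\<^sup>2) \<longlonglongrightarrow> 0" unfolding err_def by (rule tendsto_classes_error[OF k])
  then have "\<forall>\<^sub>F n in sequentially. err n / (real n)\<^sup>2 < 1 / J"
    by (rule order_tendstoD) (use J in simp)
  then obtain N1 where N1: "\<And>n. n \<ge> N1 \<Longrightarrow> err n / (real n)\<^sup>2 < 1 / J"
    unfolding eventually_sequentially by blast
  \<comment> \<open>After deleting fewer than \<open>q\<close> vertices there still hold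
    \<open>n \<ge> N1\<close> and \<open>n > j\<close>. The summand \<open>2 * q * Suc j\<close>
    makes the deletion loss \<open>q * n0\<close> at most a share \<open>1 / J\<close> of all
    pairs.\<close>
  obtain n0 where n0: "n0 \<ge> N1 + q + j + 2 * q * Suc j + 2"
    and large: "(L - 1 / J) * real (n0 choose 2) \<le> log (real k) (real (card (P n0)))"
    using L(2)[of "1 / J" "N1 + q + j + 2 * q * Suc j + 2"] J by auto
  define n where "n = q * (n0 div q)"
  have n_le: "n \<le> n0" by (simp add: n_def)
  have n_gt: "n0 < n + q"
    using q mult_div_mod_eq[of q n0] mod_less_divisor[of q n0] unfolding n_def by linarith
  have n: "n \<ge> N1" "n > j" "n > 0" using n0 n_gt by linarith+
  have dvd: "2 ^ j dvd n" by (simp add: n_def q_def)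
  let ?p = "\<lambda>n. log (real k) (real (card (P n)))"
  have Pn: "P n \<subseteq> colourings k n" using P(1) by (simp add: order_hereditary_def)
  have "?p n0 \<le> ?p n + real ((n0 - n) * n0)" by (rule log_card_delete_vertices[OF k P(1) P(2) n_le])
  also have "\<dots> \<le> ?p n + real (q * n0)"
    using n_gt by (intro add_left_mono of_nat_mono mult_le_mono1) linarith
  finally have del: "?p n0 \<le> ?p n + real q * real n0" by simp
  have pn: "(L - 2 / J) * (real n * (real n - 1) / 2) \<le> ?p n"
  \<comment> \<open>A nonpositive factor makes the claim trivial, the logarithm being nonnegative; a
    positive one may multiply the comparison of \<open>n\<close> with \<open>n0\<close>.\<close>
  proof (cases "L - 2 / J \<le> 0")
    case True
    then have "(L - 2 / J) * (real n * (real n - 1) / 2) \<le> 0"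
      using n(3) by (intro mult_nonpos_nonneg) auto
    also have "\<dots> \<le> ?p n" by (rule log_card_bounds(1)[OF k Pn P(2)])
    finally show ?thesis .
  next
    case False
    have "(L - 2 / J) * (real n * (real n - 1) / 2) \<le> (L - 2 / J) * (real n0 * (real n0 - 1) / 2)"
      using False n_le n(3) by (intro mult_left_mono divide_right_mono mult_mono) auto
    also have "\<dots> = (L - 1 / J) * (real n0 * (real n0 - 1) / 2) - real n0 * ((real n0 - 1) / (2 * J))"
      using J by (simp add: field_simps)
    also have "\<dots> \<le> (L - 1 / J) * (real n0 * (real n0 - 1) / 2) - real n0 * real q"
    proof -
      have "2 * q * Suc j + 1 \<le> n0" using n0 by linarith
      then have "real (2 * q * Suc j + 1) \<le> real n0" by (rule of_nat_mono)
      then have "real q * (2 * J) \<le> real n0 - 1" by (simp add: J_def algebra_simps)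
      then have "real q \<le> (real n0 - 1) / (2 * J)" using J by (simp add: pos_le_divide_eq)
      then have "real n0 * real q \<le> real n0 * ((real n0 - 1) / (2 * J))" by (intro mult_left_mono) auto
      then show ?thesis by linarith
    qed
    also have "\<dots> \<le> ?p n" using large del unfolding real_choose_two times_divide_eq_right by (simp only: mult.commute[of "real n0" "real q"])
    finally show ?thesis .
  qed
  obtain c \<sigma> where c: "c \<in> P n" and \<sigma>: "bij_betw \<sigma> {..<n} {..<n}"
    and reg: "\<forall>M l b i. 0 < M \<and> M \<le> j \<and> n = b * 2 ^ l \<and> i \<in> {1..k} \<longrightarrow>
      cut_bounded {..<n} (\<lambda>z. colour_indicator d c i (map_prod \<sigma> \<sigma> z) -
          avg2 {..<n} (\<lambda>u. u div b) (colour_indicator d c i \<circ> map_prod \<sigma> \<sigma>) z)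
        ((2 / sqrt M + 2 * 4 ^ M / 2 ^ l) * (real n)\<^sup>2)"
    and ent: "\<forall>l b. l \<le> j \<and> n = b * 2 ^ l \<longrightarrow>
      2 * (?p n - n * log (real k) n - (Suc j * k * 4 ^ j) * log (real k) (real (n\<^sup>2 + 1))) \<le>
      (\<Sum>z\<in>grid n. entropy_fun k (\<lambda>i. avg2 {..<n} (\<lambda>u. u div b) (colour_indicator d c i \<circ> map_prod \<sigma> \<sigma>) z))"
    using regular_colouring_of_large_entropy[OF k d Pn P(2) n(3), of j] by (elim bexE exE conjE)
  \<comment> \<open>The loss splits as \<open>2 / J\<close> from the choice of \<open>n0\<close> and
    the deletion, \<open>1 / J\<close> from \<open>n - 1\<close> against \<open>n\<close>, and
    \<open>2 / J\<close> from twice the class error.\<close>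
  have lower: "L - 5 / J \<le> 2 * (?p n - err n) / (real n)\<^sup>2"
  proof -
    have "(L - 2 / J) / real n \<le> 1 / J"
    proof -
      have "(L - 2 / J) / real n \<le> 1 / real n" using L(1) J n(3) by (intro divide_right_mono) (auto simp: diff_le_eq intro: order_trans)
      also have "\<dots> \<le> 1 / J" using n(2) J by (intro divide_left_mono) (auto simp: J_def)
      finally show ?thesis .
    qed
    moreover have "2 * err n / (real n)\<^sup>2 \<le> 2 / J" using N1[OF n(1)] by simp
    moreover have "(L - 2 / J) - (L - 2 / J) / real n \<le> 2 * ?p n / (real n)\<^sup>2"
    proof -
      have "(L - 2 / J) - (L - 2 / J) / real n = (L - 2 / J) * (real n * (real n - 1)) / (real n)\<^sup>2"
        using n(3) by (simp add: power2_eq_square field_simps)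
      also have "\<dots> \<le> 2 * ?p n / (real n)\<^sup>2" using pn by (intro divide_right_mono) auto
      finally show ?thesis .
    qed
    moreover have "2 * (?p n - err n) / (real n)\<^sup>2 = 2 * ?p n / (real n)\<^sup>2 - 2 * err n / (real n)\<^sup>2"
      by (simp add: right_diff_distrib diff_divide_distrib)
    moreover have "5 / J = 2 / J + 1 / J + 2 / J" by simp
    ultimately show ?thesis by linarith
  qed
  have "L - 5 / real (Suc j) \<le>
      (\<Sum>z\<in>grid n. entropy_fun k (\<lambda>i. avg2 {..<n} (\<lambda>u. u div b) (colour_indicator d c i \<circ> map_prod \<sigma> \<sigma>) z)) / (real n)\<^sup>2"
    if "l \<le> j \<and> n = b * 2 ^ l" for l b
  proof -
    have "2 * (?p n - err n) \<le> (\<Sum>z\<in>grid n. entropy_fun k (\<lambda>i. avg2 {..<n} (\<lambda>u. u div b) (colour_indicator d c i \<circ> map_prod \<sigma> \<sigma>) z))"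
      using ent[rule_format, OF that] by (simp only: err_def C_def diff_diff_eq)
    then show ?thesis using lower unfolding J_def by (meson divide_right_mono order_trans zero_le_power2)
  qed
  then show ?thesis using n(2) dvd c \<sigma> reg by (intro exI[of _ n] exI[of _ c] exI[of _ \<sigma>] conjI) blast+
qed

lemma tendsto_fibre_avg:
  assumes "\<And>y. y \<in> A \<Longrightarrow> (\<lambda>j. f j y) \<longlonglongrightarrow> g y"
  shows "(\<lambda>j. fibre_avg A \<kappa> (f j) x) \<longlonglongrightarrow> fibre_avg A \<kappa> g x"
  unfolding fibre_avg_def divide_inverse by (intro tendsto_mult tendsto_sum tendsto_const assms) simp

text \<open>Stage \<open>j\<close> is regular up to accuracy and level \<open>j\<close>, so any
  fixed accuracy and level are eventually available along a subsequence. One subsequence fixes all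
  block densities; their limits form the martingale whose limit graphon inherits the entropy
  bound.\<close>

lemma exists_limit_graphon:
  assumes k: "k \<ge> 2" and d: "d \<in> {1..k}" and P: "order_hereditary k P" "\<And>n. P n \<noteq> {}"
    and L: "L \<le> 1" "\<And>\<eta> N. \<eta> > 0 \<Longrightarrow> \<exists>n\<ge>N. (L - \<eta>) * real (n choose 2) \<le> log (real k) (real (card (P n)))"
  shows "\<exists>W\<in>limit_graphons k d P. L \<le> graphon_entropy k W"
proof -
  define Q where "Q j n c \<sigma> \<longleftrightarrow> j < n \<and> 2 ^ j dvd n \<and> c \<in> P n \<and> bij_betw \<sigma> {..<n} {..<n} \<and>
    (\<forall>M l b i. 0 < M \<and> M \<le> j \<and> n = b * 2 ^ l \<and> i \<in> {1..k} \<longrightarrow>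
      cut_bounded {..<n} (\<lambda>z. colour_indicator d c i (map_prod \<sigma> \<sigma> z) -
          avg2 {..<n} (\<lambda>u. u div b) (colour_indicator d c i \<circ> map_prod \<sigma> \<sigma>) z)
        ((2 / sqrt M + 2 * 4 ^ M / 2 ^ l) * (real n)\<^sup>2)) \<and>
    (\<forall>l b. l \<le> j \<and> n = b * 2 ^ l \<longrightarrow> L - 5 / real (Suc j) \<le>
      (\<Sum>z\<in>grid n. entropy_fun k (\<lambda>i. avg2 {..<n} (\<lambda>u. u div b) (colour_indicator d c i \<circ> map_prod \<sigma> \<sigma>) z)) / (real n)\<^sup>2)"
    for j n c \<sigma>
  have "\<exists>n c \<sigma>. Q j n c \<sigma>" for j unfolding Q_def by (rule stage_colouring[OF k d P L])
  then have "\<exists>p. Q j (fst p) (fst (snd p)) (snd (snd p))" for j by force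
  then obtain p where p: "\<And>j. Q j (fst (p j)) (fst (snd (p j))) (snd (snd (p j)))" by metis
  define n c s where "n j = fst (p j)" and "c j = fst (snd (p j))" and "s j = snd (snd (p j))" for j
  have Q: "Q j (n j) (c j) (s j)" for j using p by (simp add: n_def c_def s_def)
  have n_gt: "j < n j" and dvd: "2 ^ j dvd n j" and cP: "c j \<in> P (n j)" and bij: "bij_betw (s j) {..<n j} {..<n j}" for j
    using Q[of j] unfolding Q_def by blast+
  define f where "f j i = colour_indicator d (c j) i \<circ> map_prod (s j) (s j)" for j i
  have reg: "cut_bounded {..<n j} (\<lambda>z. f j i z - avg2 {..<n j} (\<lambda>u. u div b) (f j i) z) ((2 / sqrt M + 2 * 4 ^ M / 2 ^ l) * (real (n j))\<^sup>2)"
    if "0 < M" "M \<le> j" "n j = b * 2 ^ l" "i \<in> {1..k}" for j M l b i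
    using Q[of j] that unfolding Q_def f_def comp_apply by blast
  have ent: "L - 5 / real (Suc j) \<le> (\<Sum>z\<in>grid (n j). entropy_fun k (\<lambda>i. avg2 {..<n j} (\<lambda>u. u div b) (f j i) z)) / (real (n j))\<^sup>2"
    if "l \<le> j" "n j = b * 2 ^ l" for j l b
    using Q[of j] that unfolding Q_def f_def by blast
  have col: "c j \<in> colourings k (n j)" for j using P(1) cP by (auto simp: order_hereditary_def)
  have f0: "0 \<le> f j i z" and f1: "f j i z \<le> 1" for j i z by (auto simp: f_def colour_indicator_def)
  have fsym: "f j i (u, v) = f j i (v, u)" for j i u v
    by (auto simp: f_def colour_indicator_def colour_matrix_def insert_commute)
  have fsum: "(\<Sum>i=1..k. f j i z) = 1" if "z \<in> grid (n j)" for j z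
  proof -
    have "map_prod (s j) (s j) z \<in> grid (n j)" using that bij_betw_apply[OF bij[of j]] by (auto simp: lessThan_def)
    from sum_colour_indicator[OF col d this] show ?thesis by (simp add: f_def)
  qed
  \<comment> \<open>Levels, colours and block positions together are countably many, so a single
    diagonal subsequence makes every density converge.\<close>
  define D where "D j = (\<lambda>(l, i, z). block_density (n j) (n j div 2 ^ l) (f j i) z)" for j
  have "norm (D j x) \<le> 1" for j x
    using block_density_nonneg[OF f0] block_density_le_1[OF f1] by (simp add: D_def split: prod.split)
  then obtain r where r: "strict_mono r" "\<And>x. \<exists>a. (\<lambda>j. D (r j) x) \<longlonglongrightarrow> a"
    by (rule function_convergent_subsequence[of UNIV D 1, OF countableI_type]) (simp only: UNIV_I)+
  have rj: "j \<le> r j" for j by (rule seq_suble[OF r(1)])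
  define V where "V l i z = lim (\<lambda>j. D (r j) (l, i, z))" for l i z
  have V: "(\<lambda>j. D (r j) (l, i, z)) \<longlonglongrightarrow> V l i z" for l i z
    using r(2)[of "(l, i, z)"] unfolding V_def by (simp add: convergent_LIMSEQ_iff[symmetric] convergent_def)
  have nb: "n j = (n j div 2 ^ l) * 2 ^ l" "n j div 2 ^ l > 0" if "l \<le> j" for j l
  proof -
    have "(2::nat) ^ l dvd 2 ^ j" using that by (rule le_imp_power_dvd)
    then have "2 ^ l dvd n j" using dvd dvd_trans by blast
    then show eq: "n j = (n j div 2 ^ l) * 2 ^ l" by simp
    show "n j div 2 ^ l > 0" using eq n_gt[of j] by (metis gr0I mult_0 not_less0)
  qed
  have D_eq: "D j (l, i, z) = block_density (n j div 2 ^ l * 2 ^ l) (n j div 2 ^ l) (f j i) z" if "l \<le> j" for j l i z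
    using nb(1)[OF that] by (simp add: D_def)
  have avg_D: "avg2 {..<n j} (\<lambda>u. u div (n j div 2 ^ l)) (f j i) y = D j (l, i, div2 (n j div 2 ^ l) y)"
    if "l \<le> j" "y \<in> grid (n j)" for j l i y
    using avg2_eq_block_density[OF nb(2)[OF that(1)], of y "2 ^ l" "f j i"] nb(1)[OF that(1)] that(2) by (simp add: D_def)
  have ev: "eventually (\<lambda>j. l \<le> r j) sequentially" for l
    using eventually_ge_at_top[of l] by eventually_elim (rule order_trans[OF _ rj])
  have D01: "0 \<le> D j x" "D j x \<le> 1" for j x
    using block_density_nonneg[OF f0] block_density_le_1[OF f1] by (simp_all add: D_def split: prod.split)
  have V0: "0 \<le> V l i z" for l i z by (rule LIMSEQ_le_const[OF V]) (use D01 in blast)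
  have V1: "(\<Sum>i=1..k. V l i z) = 1" if z: "z \<in> grid (2 ^ l)" for l z
  proof -
    have "(\<lambda>j. \<Sum>i=1..k. D (r j) (l, i, z)) \<longlonglongrightarrow> (\<Sum>i=1..k. V l i z)" by (intro tendsto_sum V)
    moreover have "\<forall>\<^sub>F j in sequentially. (\<Sum>i=1..k. D (r j) (l, i, z)) = 1"
      using ev[of l]
    proof eventually_elim
      fix j assume j: "l \<le> r j"
      have "(\<Sum>i=1..k. f (r j) i y) = 1" if "y \<in> grid (n (r j) div 2 ^ l * 2 ^ l)" for y
        by (rule fsum) (use that nb(1)[OF j] in simp)
      from block_density_one[OF nb(2)[OF j] z this]
      show "(\<Sum>i=1..k. D (r j) (l, i, z)) = 1" by (simp only: D_eq[OF j])
    qed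
    then have "(\<lambda>j. \<Sum>i=1..k. D (r j) (l, i, z)) \<longlonglongrightarrow> 1" by (rule tendsto_eventually)
    ultimately show ?thesis by (rule LIMSEQ_unique)
  qed
  have Vsym: "V l i (a, b) = V l i (b, a)" for l i a b
    unfolding V_def D_def by (simp add: block_density_swap[of "f _ _", OF fsym])
  \<comment> \<open>For all large \<open>j\<close> the identity is exact, because both powers of 2
    divide \<open>n (r j)\<close>; a finite average passes to the limit.\<close>
  have mart: "V l i (div2 (2 ^ (l' - l)) z) = fibre_avg (grid (2 ^ l')) (div2 (2 ^ (l' - l))) (V l' i) z"
    if l: "l \<le> l'" and z: "z \<in> grid (2 ^ l')" for l l' i z
  proof -
    let ?t = "2 ^ (l' - l) :: nat"
    have pow: "(2::nat) ^ l' = ?t * 2 ^ l" using l by (simp flip: power_add)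
    have "\<forall>\<^sub>F j in sequentially. D (r j) (l, i, div2 ?t z) = fibre_avg (grid (2 ^ l')) (div2 ?t) (\<lambda>z. D (r j) (l', i, z)) z"
      using ev[of l']
    proof eventually_elim
      fix j assume j: "l' \<le> r j"
      let ?b = "n (r j) div 2 ^ l'"
      have nj: "n (r j) = ?b * (?t * 2 ^ l)" using nb(1)[OF j] unfolding pow .
      then have "n (r j) div 2 ^ l = ?b * ?t" by (metis mult.assoc nonzero_mult_div_cancel_right power_not_zero zero_neq_numeral)
      then have "D (r j) (l, i, div2 ?t z) = block_density (?b * (?t * 2 ^ l)) (?b * ?t) (f (r j) i) (div2 ?t z)"
        using nj by (simp add: D_def)
      also have "\<dots> = fibre_avg (grid (?t * 2 ^ l)) (div2 ?t) (block_density (?b * (?t * 2 ^ l)) ?b (f (r j) i)) z"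
        using z nb(2)[OF j] unfolding pow by (intro block_density_refine) auto
      also have "\<dots> = fibre_avg (grid (2 ^ l')) (div2 ?t) (\<lambda>z. D (r j) (l', i, z)) z"
        unfolding pow[symmetric] D_eq[OF j] ..
      finally show "D (r j) (l, i, div2 ?t z) = fibre_avg (grid (2 ^ l')) (div2 ?t) (\<lambda>z. D (r j) (l', i, z)) z" .
    qed
    moreover have "(\<lambda>j. fibre_avg (grid (2 ^ l')) (div2 ?t) (\<lambda>z. D (r j) (l', i, z)) z) \<longlonglongrightarrow>
        fibre_avg (grid (2 ^ l')) (div2 ?t) (V l' i) z"
      by (rule tendsto_fibre_avg) (rule V)
    ultimately have "(\<lambda>j. D (r j) (l, i, div2 ?t z)) \<longlonglongrightarrow> fibre_avg (grid (2 ^ l')) (div2 ?t) (V l' i) z"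
      by (subst tendsto_cong)
    then show ?thesis using V by (rule LIMSEQ_unique[rotated])
  qed
  \<comment> \<open>At a fixed level the entropy is a finite sum of continuous functions of the
    densities, and the loss \<open>5 / (r j + 1)\<close> vanishes.\<close>
  have entV: "L \<le> (\<Sum>z\<in>grid (2 ^ l). entropy_fun k (\<lambda>i. V l i z)) / 4 ^ l" for l
  proof (rule tendsto_le[OF sequentially_bot])
    show "(\<lambda>j. (\<Sum>z\<in>grid (2 ^ l). entropy_fun k (\<lambda>i. D (r j) (l, i, z))) / 4 ^ l) \<longlonglongrightarrow>
        (\<Sum>z\<in>grid (2 ^ l). entropy_fun k (\<lambda>i. V l i z)) / 4 ^ l"
      by (intro tendsto_divide tendsto_sum tendsto_const tendsto_entropy_fun[OF k V D01]) simp
    have "(\<lambda>j. 5 / real (Suc (r j))) \<longlonglongrightarrow> 0"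
      using LIMSEQ_subseq_LIMSEQ[OF LIMSEQ_Suc[OF lim_const_over_n[of "5 :: real"]] r(1)] by (simp add: o_def)
    then have "(\<lambda>j. L - 5 / real (Suc (r j))) \<longlonglongrightarrow> L - 0" by (intro tendsto_diff tendsto_const)
    then show "(\<lambda>j. L - 5 / real (Suc (r j))) \<longlonglongrightarrow> L" by simp
    show "\<forall>\<^sub>F j in sequentially. L - 5 / real (Suc (r j)) \<le> (\<Sum>z\<in>grid (2 ^ l). entropy_fun k (\<lambda>i. D (r j) (l, i, z))) / 4 ^ l"
      using ev[of l]
    proof eventually_elim
      fix j assume j: "l \<le> r j"
      let ?b = "n (r j) div 2 ^ l"
      have b: "?b > 0" by (rule nb(2)[OF j])
      have n2: "(real (n (r j)))\<^sup>2 = (real ?b)\<^sup>2 * 4 ^ l"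
      proof -
        have "real (n (r j)) = real ?b * 2 ^ l" by (subst nb(1)[OF j]) simp
        then show ?thesis by (simp add: power2_eq_square flip: power_mult_distrib)
      qed
      have "L - 5 / real (Suc (r j)) \<le> (\<Sum>z\<in>grid (n (r j)). entropy_fun k (\<lambda>i. avg2 {..<n (r j)} (\<lambda>u. u div ?b) (f (r j) i) z)) / (real (n (r j)))\<^sup>2"
        by (rule ent[OF j nb(1)[OF j]])
      also have "(\<Sum>z\<in>grid (n (r j)). entropy_fun k (\<lambda>i. avg2 {..<n (r j)} (\<lambda>u. u div ?b) (f (r j) i) z)) =
        (\<Sum>z\<in>grid (n (r j)). entropy_fun k (\<lambda>i. D (r j) (l, i, div2 ?b z)))"
        by (intro sum.cong refl) (simp only: avg_D[OF j])
      also have "\<dots> = (\<Sum>z\<in>grid (?b * 2 ^ l). entropy_fun k (\<lambda>i. D (r j) (l, i, div2 ?b z)))"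
        using nb(1)[OF j] by simp
      also have "\<dots> = (real ?b)\<^sup>2 * (\<Sum>z\<in>grid (2 ^ l). entropy_fun k (\<lambda>i. D (r j) (l, i, z)))"
        by (rule sum_div2[OF b, of "\<lambda>z. entropy_fun k (\<lambda>i. D (r j) (l, i, z))"])
      also have "\<dots> / (real (n (r j)))\<^sup>2 = (\<Sum>z\<in>grid (2 ^ l). entropy_fun k (\<lambda>i. D (r j) (l, i, z))) / 4 ^ l"
        unfolding n2 using b by simp
      finally show "L - 5 / real (Suc (r j)) \<le> (\<Sum>z\<in>grid (2 ^ l). entropy_fun k (\<lambda>i. D (r j) (l, i, z))) / 4 ^ l" .
    qed
  qed
  have "\<exists>W \<rho>. kgraphon k W \<and> L \<le> graphon_entropy k W \<and> strict_mono \<rho> \<and>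
    (\<forall>i\<in>{1..k}. (\<lambda>t. \<integral>z. \<bar>step (2 ^ \<rho> t) (V (\<rho> t) i) z - pmf (W z) i\<bar> \<partial>lebesgue_on unit_square) \<longlonglongrightarrow> 0)"
    by (rule limit_of_block_densities[OF k d V0 V1 Vsym mart entV])
  then obtain W \<rho> where W: "kgraphon k W" "L \<le> graphon_entropy k W" and \<rho>: "strict_mono \<rho>"
    and l1: "\<forall>i\<in>{1..k}. (\<lambda>t. \<integral>z. \<bar>step (2 ^ \<rho> t) (V (\<rho> t) i) z - pmf (W z) i\<bar> \<partial>lebesgue_on unit_square) \<longlonglongrightarrow> 0"
    by (elim exE conjE)
  have lim0: "(\<lambda>j. cut_dist k (step_graphon d (n (r j)) (c (r j))) W) \<longlonglongrightarrow> 0"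
  proof (rule LIMSEQ_I)
    fix e :: real assume e: "0 < e"
    \<comment> \<open>Per colour the error is \<open>4 * \<epsilon>\<close>: two for regularity, one
      for the densities against \<open>V\<close>, one for \<open>V\<close> against \<open>W\<close>.
      Over \<open>k\<close> colours this is \<open>e / 2\<close>.\<close>
    define \<epsilon> where "\<epsilon> = e / (8 * real k)"
    have \<epsilon>: "\<epsilon> > 0" using e k by (simp add: \<epsilon>_def)
    obtain M :: nat where M: "4 / \<epsilon>\<^sup>2 < real M" using reals_Archimedean2 by blast
    have "0 < 4 / \<epsilon>\<^sup>2" using \<epsilon> by simp
    then have M0: "0 < M" using M by (cases M) auto
    have M2: "2 / sqrt (real M) \<le> \<epsilon>"
    proof -
      have "sqrt (4 / \<epsilon>\<^sup>2) \<le> sqrt (real M)" using M by simp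
      then have "2 / \<epsilon> \<le> sqrt (real M)" using \<epsilon> by (simp add: real_sqrt_divide)
      then show ?thesis using \<epsilon> M0 by (simp add: field_simps)
    qed
    \<comment> \<open>The order of choices matters: with \<open>M\<close> fixed, the level has to
      outweigh \<open>4 ^ M\<close>, and only afterwards is \<open>j\<close> taken large for this
      level.\<close>
    obtain l0 where l0: "2 * 4 ^ M / \<epsilon> < (2::real) ^ l0" using real_arch_pow[of 2] by auto
    have "\<forall>\<^sub>F t in sequentially. \<forall>i\<in>{1..k}. (\<integral>z. \<bar>step (2 ^ \<rho> t) (V (\<rho> t) i) z - pmf (W z) i\<bar> \<partial>lebesgue_on unit_square) < \<epsilon>"
      using l1 \<epsilon> by (intro eventually_ball_finite ballI order_tendstoD(2)) auto
    moreover have "\<forall>\<^sub>F t in sequentially. l0 \<le> \<rho> t"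
      using eventually_ge_at_top[of l0] by eventually_elim (rule order_trans[OF _ seq_suble[OF \<rho>]])
    ultimately have "\<forall>\<^sub>F t in sequentially. (\<forall>i\<in>{1..k}. (\<integral>z. \<bar>step (2 ^ \<rho> t) (V (\<rho> t) i) z - pmf (W z) i\<bar> \<partial>lebesgue_on unit_square) < \<epsilon>) \<and> l0 \<le> \<rho> t"
      by (rule eventually_conj)
    then obtain t where t: "\<forall>i\<in>{1..k}. (\<integral>z. \<bar>step (2 ^ \<rho> t) (V (\<rho> t) i) z - pmf (W z) i\<bar> \<partial>lebesgue_on unit_square) < \<epsilon>" "l0 \<le> \<rho> t"
      using eventually_happens[of _ sequentially] by auto
    define l where "l = \<rho> t"
    have l2: "2 * 4 ^ M / 2 ^ l \<le> \<epsilon>"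
    proof -
      have "2 * 4 ^ M / \<epsilon> \<le> (2::real) ^ l"
        using l0 power_increasing[of l0 l "2::real"] t(2) unfolding l_def by linarith
      then show ?thesis using \<epsilon> by (simp add: field_simps)
    qed
    have "\<forall>\<^sub>F j in sequentially. \<forall>x\<in>{1..k} \<times> grid (2 ^ l). \<bar>D (r j) (l, fst x, snd x) - V l (fst x) (snd x)\<bar> < \<epsilon>"
    proof (intro eventually_ball_finite ballI)
      fix x :: "nat \<times> nat \<times> nat"
      have "(\<lambda>j. \<bar>D (r j) (l, fst x, snd x) - V l (fst x) (snd x)\<bar>) \<longlonglongrightarrow> 0"
        using V[of l "fst x" "snd x"] by (intro tendsto_rabs_zero LIM_zero)
      then show "\<forall>\<^sub>F j in sequentially. \<bar>D (r j) (l, fst x, snd x) - V l (fst x) (snd x)\<bar> < \<epsilon>"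
        by (rule order_tendstoD(2)) (rule \<epsilon>)
    qed simp
    then have "\<forall>\<^sub>F j in sequentially. cut_dist k (step_graphon d (n (r j)) (c (r j))) W < e"
      using ev[of l] ev[of M]
    proof eventually_elim
      fix j assume close: "\<forall>x\<in>{1..k} \<times> grid (2 ^ l). \<bar>D (r j) (l, fst x, snd x) - V l (fst x) (snd x)\<bar> < \<epsilon>"
        and j: "l \<le> r j" "M \<le> r j"
      let ?n = "n (r j)" and ?b = "n (r j) div 2 ^ l"
      have "cut_dist k (step_graphon d ?n (c (r j))) W \<le> k * (3 * \<epsilon> + \<epsilon>)"
      proof (rule cut_dist_step_le[OF _ bij W(1) nb(1)[OF j(1)], where V = "V l"])
        show "0 < ?n" using n_gt[of "r j"] by simp
        show "(\<integral>z. \<bar>step (2 ^ l) (V l i) z - pmf (W z) i\<bar> \<partial>lebesgue_on unit_square) \<le> \<epsilon>" if "i \<in> {1..k}" for i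
          using t(1) that by (simp add: l_def less_imp_le del: atLeastAtMost_iff)
        show "cut_bounded {..<?n} (\<lambda>z. colour_indicator d (c (r j)) i (map_prod (s (r j)) (s (r j)) z) - V l i (div2 ?b z)) (3 * \<epsilon> * (real ?n)\<^sup>2)"
          if i: "i \<in> {1..k}" for i
        proof -
          \<comment> \<open>Regularity is used at accuracy \<open>M\<close> and level
            \<open>l\<close>, both of which stage \<open>r j\<close> has reached.\<close>
          have 1: "cut_bounded {..<?n} (\<lambda>z. f (r j) i z - avg2 {..<?n} (\<lambda>u. u div ?b) (f (r j) i) z) ((2 / sqrt M + 2 * 4 ^ M / 2 ^ l) * (real ?n)\<^sup>2)"
            by (rule reg[OF M0 j(2) nb(1)[OF j(1)] i])
          have 2: "cut_bounded {..<?n} (\<lambda>z. avg2 {..<?n} (\<lambda>u. u div ?b) (f (r j) i) z - V l i (div2 ?b z)) (\<epsilon> * (real ?n)\<^sup>2)"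
          proof (rule cut_bounded_l1)
            have "\<bar>avg2 {..<?n} (\<lambda>u. u div ?b) (f (r j) i) z - V l i (div2 ?b z)\<bar> \<le> \<epsilon>" if z: "z \<in> grid ?n" for z
            proof -
              have "div2 ?b z \<in> grid (2 ^ l)"
                by (rule div2_mem[OF nb(2)[OF j(1)]]) (use z nb(1)[OF j(1)] in simp)
              then have "(i, div2 ?b z) \<in> {1..k} \<times> grid (2 ^ l)" using i by (rule SigmaI[rotated])
              from close[rule_format, OF this] show ?thesis unfolding avg_D[OF j(1) z] by simp
            qed
            then have "(\<Sum>z\<in>grid ?n. \<bar>avg2 {..<?n} (\<lambda>u. u div ?b) (f (r j) i) z - V l i (div2 ?b z)\<bar>) \<le> real (card (grid ?n)) * \<epsilon>"
              by (rule sum_bounded_above)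
            then show "(\<Sum>z\<in>grid ?n. \<bar>avg2 {..<?n} (\<lambda>u. u div ?b) (f (r j) i) z - V l i (div2 ?b z)\<bar>) \<le> \<epsilon> * (real ?n)\<^sup>2"
              by (simp add: card_cartesian_product power2_eq_square mult.commute)
          qed
          have "cut_bounded {..<?n} (\<lambda>z. f (r j) i z - V l i (div2 ?b z)) ((2 / sqrt M + 2 * 4 ^ M / 2 ^ l) * (real ?n)\<^sup>2 + \<epsilon> * (real ?n)\<^sup>2)"
            using cut_bounded_add[OF 1 2] by simp
          moreover have "(2 / sqrt M + 2 * 4 ^ M / 2 ^ l) * (real ?n)\<^sup>2 + \<epsilon> * (real ?n)\<^sup>2 \<le> 3 * \<epsilon> * (real ?n)\<^sup>2"
          proof -
            have "(2 / sqrt M + 2 * 4 ^ M / 2 ^ l) * (real ?n)\<^sup>2 \<le> (\<epsilon> + \<epsilon>) * (real ?n)\<^sup>2"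
              using M2 l2 by (intro mult_right_mono add_mono) auto
            then show ?thesis by (simp add: distrib_right)
          qed
          ultimately show ?thesis unfolding f_def comp_apply by (rule cut_bounded_mono)
        qed
      qed
      also have "\<dots> = e / 2" using k by (simp add: \<epsilon>_def)
      also have "\<dots> < e" using e by simp
      finally show "cut_dist k (step_graphon d ?n (c (r j))) W < e" .
    qed
    then show "\<exists>no. \<forall>j\<ge>no. norm (cut_dist k (step_graphon d (n (r j)) (c (r j))) W - 0) < e"
      unfolding eventually_sequentially using cut_dist_nonneg by simp
  qed
  have "filterlim (\<lambda>j. n (r j)) at_top sequentially"
    unfolding filterlim_at_top
  proof
    fix Z
    show "\<forall>\<^sub>F j in sequentially. Z \<le> n (r j)"
      using ev[of Z] by eventually_elim (rule less_imp_le[OF le_less_trans[OF _ n_gt]])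
  qed
  then have "W \<in> limit_graphons k d P"
    unfolding limit_graphons_def using W(1) lim0 cP
    by (intro CollectI conjI exI[of _ "\<lambda>j. n (r j)"] exI[of _ "\<lambda>j. c (r j)"] allI)
  then show ?thesis using W(2) by blast
qed



text \<open>The upper limit as the infimum of all eventual upper bounds, which remains a real number
  since 0 and 1 bound the sequence.\<close>

lemma limsup_witness:
  fixes a :: "nat \<Rightarrow> real"
  assumes a: "\<And>n. 0 \<le> a n" "\<And>n. a n \<le> 1"
  obtains L where "L \<le> 1" "\<And>\<eta>. \<eta> > 0 \<Longrightarrow> \<forall>\<^sub>F n in sequentially. a n \<le> L + \<eta>"
    "\<And>\<eta> N. \<eta> > 0 \<Longrightarrow> \<exists>n\<ge>N. L - \<eta> < a n"
proof -
  let ?X = "{x. \<forall>\<^sub>F n in sequentially. a n \<le> x}"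
  have one: "1 \<in> ?X" using a(2) by simp
  have bdd: "bdd_below ?X"
  proof (rule bdd_belowI[of _ 0])
    fix x assume "x \<in> ?X"
    then obtain n where "a n \<le> x" by (auto simp: eventually_sequentially)
    then show "0 \<le> x" using a(1)[of n] by linarith
  qed
  show ?thesis
  proof (rule that[of "Inf ?X"])
    show "Inf ?X \<le> 1" by (rule cInf_lower[OF one bdd])
    show "\<forall>\<^sub>F n in sequentially. a n \<le> Inf ?X + \<eta>" if "\<eta> > 0" for \<eta>
    proof -
      have "Inf ?X < Inf ?X + \<eta>" using that by simp
      then obtain x where "x \<in> ?X" "x < Inf ?X + \<eta>" using one bdd cInf_less_iff[of ?X] by blast
      then show ?thesis by (auto elim: eventually_mono)
    qed
    show "\<exists>n\<ge>N. Inf ?X - \<eta> < a n" if "\<eta> > 0" for \<eta> N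
    proof (rule ccontr)
      assume "\<not> (\<exists>n\<ge>N. Inf ?X - \<eta> < a n)"
      then have "Inf ?X - \<eta> \<in> ?X" by (auto simp: eventually_sequentially not_less)
      then have "Inf ?X \<le> Inf ?X - \<eta>" by (rule cInf_lower[OF _ bdd])
      then show False using that by simp
    qed
  qed
qed

theorem theorem6p2:
  fixes k d :: nat and P :: "nat \<Rightarrow> (nat set \<Rightarrow> nat) set"
  assumes "k \<ge> 2" and "d \<in> {1..k}"
    and "order_hereditary k P"
    and "\<And>n. P n \<noteq> {}"
  shows "convergent (\<lambda>n. extremal_entropy k n P / real (n choose 2)) \<and>
    (\<exists>W \<in> limit_graphons k d P.
      (\<forall>U \<in> limit_graphons k d P. graphon_entropy k U \<le> graphon_entropy k W) \<and>
      extremal_density k P = graphon_entropy k W \<and>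
      (\<lambda>n. log (real k) (real (card (P n))) / real (n choose 2)) \<longlonglongrightarrow> graphon_entropy k W)"
proof -
  define x where "x n = extremal_entropy k n P / real (n choose 2)" for n
  define a where "a n = log (real k) (real (card (P n))) / real (n choose 2)" for n
  have sub: "P n \<subseteq> colourings k n" for n using assms(3) by (simp add: order_hereditary_def)
  have xa: "x n \<le> a n" for n
    unfolding x_def a_def by (intro divide_right_mono extremal_entropy_le_log_card[OF assms(1) sub assms(4)]) simp
  have a01: "0 \<le> a n" "a n \<le> 1" for n
    using log_card_bounds[OF assms(1) sub assms(4), of n] by (auto simp: a_def divide_le_eq)
  \<comment> \<open>The loss \<open>n / 2\<close> is of lower order than the number of pairs; the
    quotient simplifies to an expression tending to the entropy.\<close>
  have lower: "(real n * graphon_entropy k U - 1) / (real n - 1) \<le> x n"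
    if U: "U \<in> limit_graphons k d P" and n: "n \<ge> 2" for U n
  proof -
    have "((real n)\<^sup>2 / 2 * graphon_entropy k U - real n / 2) / real (n choose 2) \<le> x n"
      unfolding x_def by (intro divide_right_mono graphon_entropy_le_extremal[OF assms(1,3) U n]) simp
    also have "((real n)\<^sup>2 / 2 * graphon_entropy k U - real n / 2) / real (n choose 2) =
        (real n * (real n * graphon_entropy k U - 1)) / (real n * (real n - 1))"
      using n unfolding real_choose_two by (simp add: power2_eq_square field_simps)
    also have "\<dots> = (real n * graphon_entropy k U - 1) / (real n - 1)" using n by simp
    finally show ?thesis .
  qed
  have lim: "(\<lambda>n. (real n * u - 1) / (real n - 1)) \<longlonglongrightarrow> u" for u :: real by real_asymp
  obtain L where L: "L \<le> 1" and upper: "\<And>\<eta>. \<eta> > 0 \<Longrightarrow> \<forall>\<^sub>F n in sequentially. a n \<le> L + \<eta>"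
    and freq: "\<And>\<eta> N. \<eta> > 0 \<Longrightarrow> \<exists>n\<ge>N. L - \<eta> < a n"
    by (rule limsup_witness[OF a01]) (rule that)
  \<comment> \<open>Every limit graphon bounds the extremal densities from below, and these lie
    below the counts, which are eventually below \<open>L + \<eta>\<close>.\<close>
  have le_L: "graphon_entropy k U \<le> L" if U: "U \<in> limit_graphons k d P" for U
  proof (rule field_le_epsilon)
    fix \<eta> :: real assume "\<eta> > 0"
    from upper[OF this] eventually_ge_at_top[of 2]
    have "\<forall>\<^sub>F n in sequentially. (real n * graphon_entropy k U - 1) / (real n - 1) \<le> L + \<eta>"
    proof eventually_elim
      case (elim n)
      then show ?case using lower[OF U elim(2)] xa[of n] by linarith
    qed
    then show "graphon_entropy k U \<le> L + \<eta>" by (rule tendsto_upperbound[OF lim]) simp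
  qed
  have "\<exists>n\<ge>N. (L - \<eta>) * real (n choose 2) \<le> log (real k) (real (card (P n)))" if \<eta>: "\<eta> > 0" for \<eta> N
  proof -
    obtain n where n: "n \<ge> max N 2" "L - \<eta> < a n" using freq[OF \<eta>] by blast
    then have "real (n choose 2) > 0" by simp
    then have "(L - \<eta>) * real (n choose 2) \<le> log (real k) (real (card (P n)))"
      using n(2) by (simp add: a_def pos_less_divide_eq)
    then show ?thesis using n(1) by (intro exI[of _ n]) simp
  qed
  from exists_limit_graphon[OF assms L this]
  obtain W where W: "W \<in> limit_graphons k d P" "L \<le> graphon_entropy k W" by (rule bexE)
  have WL: "graphon_entropy k W = L" using W(2) le_L[OF W(1)] by simp
  \<comment> \<open>Any sequence between the extremal densities and the normalised counts is
    squeezed: the attained entropy of \<open>W\<close> holds it up, the upper limit \<open>L\<close>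
    of the counts holds it down. Both ends of the range are such sequences.\<close>
  have conv: "y \<longlonglongrightarrow> L" if y: "\<And>n. x n \<le> y n" "\<And>n. y n \<le> a n" for y
  proof (rule order_tendstoI)
    fix l assume "l < L"
    then have "\<forall>\<^sub>F n in sequentially. l < (real n * L - 1) / (real n - 1)" by (rule order_tendstoD(1)[OF lim])
    with eventually_ge_at_top[of 2] show "\<forall>\<^sub>F n in sequentially. l < y n"
    proof eventually_elim
      case (elim n)
      then show ?case using lower[OF W(1) elim(1)] y(1)[of n] unfolding WL by linarith
    qed
  next
    fix u assume "L < u"
    then have "(u - L) / 2 > 0" by simp
    from upper[OF this] show "\<forall>\<^sub>F n in sequentially. y n < u"
    proof eventually_elim
      case (elim n)
      then show ?case using y(2)[of n] \<open>L < u\<close> by (simp add: field_simps)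
    qed
  qed
  have x_lim: "x \<longlonglongrightarrow> L" by (rule conv[OF order_refl xa])
  have a_lim: "a \<longlonglongrightarrow> L" by (rule conv[OF xa order_refl])
  have "convergent x" using x_lim by (rule convergentI)
  moreover have "extremal_density k P = L"
    unfolding extremal_density_def using limI[OF x_lim] by (simp add: x_def[abs_def])
  ultimately show ?thesis
    using a_lim le_L unfolding x_def[abs_def] a_def[abs_def] WL[symmetric]
    by (intro conjI bexI[OF _ W(1)] ballI)
qed

end
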